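(* There is an equivalence between Lie $\mathfrak g$-quasi-bialgebras and Manin quadruples, given as follows: if $(\mathfrak d,\mathfrak h,\mathfrak g,\mathfrak h^* )$ is a Manin quadruple, then $(\mathfrak h,\dot\rho,\delta)$ is a Lie $\mathfrak g$-quasi-bialgebra, where $$\dot\rho(v)X=[v,X]\qquad(v\in\mathfrak g,\ X\in\mathfrak h),$$ $$\langle\delta(X),A\otimes B\rangle=\langle X,[B,A]\rangle\qquad(X\in\mathfrak h,\ A,B\in\mathfrak h^* ).$$
   Context: $(\mathfrak d,\mathfrak a,\mathfrak b,\mathfrak c)$ is a Manin quadruple if $\mathfrak d$ is a Lie algebra with an invariant non-degenerate symmetric pairing $\langle\,,\rangle$ and $\mathfrak a,\mathfrak b,\mathfrak c\subset\mathfrak d$ are Lie subalgebras such that $\mathfrak d=\mathfrak a\oplus\mathfrak b\oplus\mathfrak c$ as vector spaces, $\mathfrak a^\perp=\mathfrak a\oplus\mathfrak b$ and $\mathfrak c^\perp=\mathfrak b\oplus\mathfrak c$. Then the restriction of $\langle\,,\rangle$ to $\mathfrak b$ is non-degenerate and $\langle\,,\rangle$ provides an isomorphism $\mathfrak a^*\cong\mathfrak c$. Accordingly, in a Manin quadruple written $(\mathfrak d,\mathfrak h,\mathfrak g,\mathfrak h^* )$ the last subalgebra is identified with the dual of $\mathfrak h$ via the pairing of $\mathfrak d$, and $t\in(S^2\mathfrak g)^{\mathfrak g}$ is the inverse of the restriction of $\langle\,,\rangle$ to $\mathfrak g$. Let $\mathfrak g$ be a Lie algebra with a non-degenerate invariant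 element $t=t^{ij}e_i\otimes e_j\in(S^2\mathfrak g)^{\mathfrak g}$ ($e_i$ a basis of $\mathfrak g$, summation convention). A Lie $\mathfrak g$-quasi-bialgebra is a triple $(\mathfrak h,\dot\rho,\delta)$ where $\mathfrak h$ is a Lie algebra, $\dot\rho$ is an action of $\mathfrak g$ on $\mathfrak h$ by Lie algebra derivations, and $\delta:\mathfrak h\to\bigwedge^2\mathfrak h$ is a $\mathfrak g$-invariant Lie cobracket on $\mathfrak h$ (i.e. its transpose $\mathfrak h^*\otimes\mathfrak h^*\to\mathfrak h^*$ is a Lie bracket) such that for all $X,Y\in\mathfrak h$ $$\operatorname{ad}^{(2)}_X\delta(Y)-\operatorname{ad}^{(2)}_Y\delta(X)-\delta([X,Y])-t^{ij}\,\dot\rho(e_i)(X)\wedge\dot\rho(e_j)(Y)=0,$$ where $\operatorname{ad}^{(2)}_X:=\operatorname{ad}_X\otimes1+1\otimes\operatorname{ad}_X$ and $a\wedge b=a\otimes b-b\otimes a$. *)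

theory Defs
  imports Complex_Main "HOL-Library.FuncSet" "HOL-Library.Function_Algebras" "HOL-Library.Product_Plus"
begin

section \<open>Vector spaces carried by subspaces, their duals and tensor squares\<close>

definition linear_on ::
  "('k \<Rightarrow> 'v \<Rightarrow> 'v) \<Rightarrow> ('k \<Rightarrow> 'w \<Rightarrow> 'w) \<Rightarrow> 'v set \<Rightarrow> ('v::plus \<Rightarrow> 'w::plus) \<Rightarrow> bool" where
  "linear_on s s' V f \<longleftrightarrow>
     (\<forall>x\<in>V. \<forall>y\<in>V. f (x + y) = f x + f y) \<and> (\<forall>c. \<forall>x\<in>V. f (s c x) = s' c (f x))"

record ('k, 'v) lie_struct =
  lscale :: "'k \<Rightarrow> 'v \<Rightarrow> 'v"
  lcarrier :: "'v set"
  lbracket :: "'v \<Rightarrow> 'v \<Rightarrow> 'v"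

definition finite_dim :: "('k::field, 'v::ab_group_add) lie_struct \<Rightarrow> bool" where
  "finite_dim L \<longleftrightarrow> (\<exists>B. finite B \<and> lcarrier L = module.span (lscale L) B)"

text \<open>Functionals on the carrier are made extensional by the value 0 outside it, so that
  equality of functionals is equality of functions.\<close>

definition dual :: "('k::field, 'v::ab_group_add) lie_struct \<Rightarrow> ('v \<Rightarrow> 'k) set" where
  "dual L = {\<alpha>. linear_on (lscale L) (*) (lcarrier L) \<alpha> \<and> (\<forall>x. x \<notin> lcarrier L \<longrightarrow> \<alpha> x = 0)}"

definition fun_scale :: "'k::field \<Rightarrow> ('v \<Rightarrow> 'k) \<Rightarrow> 'v \<Rightarrow> 'k" where
  "fun_scale c \<alpha> = (\<lambda>x. c * \<alpha> x)"

text \<open>A tensor is represented by the function it induces on pairs of functionals, \<open>a \<otimes> b\<close> being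
  \<open>(\<alpha>, \<beta>) \<mapsto> \<alpha>(a) \<beta>(b)\<close>.  Over a field this embeds \<open>V \<otimes> V\<close> into the functions on
  \<open>V\<^sup>* \<times> V\<^sup>*\<close>, with image the span of the pure tensors.
  The pairing of \<open>T \<in> V \<otimes> V\<close> with \<open>\<alpha> \<otimes> \<beta>\<close> is the value \<open>T \<alpha> \<beta>\<close>.\<close>

type_synonym ('k, 'v) tensor2 = "('v \<Rightarrow> 'k) \<Rightarrow> ('v \<Rightarrow> 'k) \<Rightarrow> 'k"

definition tensor_scale :: "'k::field \<Rightarrow> ('k, 'v) tensor2 \<Rightarrow> ('k, 'v) tensor2" where
  "tensor_scale c T = (\<lambda>\<alpha> \<beta>. c * T \<alpha> \<beta>)"

definition pure_tensor ::
  "('k::field, 'v::ab_group_add) lie_struct \<Rightarrow> 'v \<Rightarrow> 'v \<Rightarrow> ('k, 'v) tensor2" where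
  "pure_tensor L a b = (\<lambda>\<alpha> \<beta>. if \<alpha> \<in> dual L \<and> \<beta> \<in> dual L then \<alpha> a * \<beta> b else 0)"

definition wedge ::
  "('k::field, 'v::ab_group_add) lie_struct \<Rightarrow> 'v \<Rightarrow> 'v \<Rightarrow> ('k, 'v) tensor2" where
  "wedge L a b = pure_tensor L a b - pure_tensor L b a"

definition tensor_square ::
  "('k::field, 'v::ab_group_add) lie_struct \<Rightarrow> ('k, 'v) tensor2 set" where
  "tensor_square L =
     module.span tensor_scale {pure_tensor L a b | a b. a \<in> lcarrier L \<and> b \<in> lcarrier L}"

definition sym_square ::
  "('k::field, 'v::ab_group_add) lie_struct \<Rightarrow> ('k, 'v) tensor2 set" where
  "sym_square L = {T \<in> tensor_square L. \<forall>\<alpha> \<beta>. T \<alpha> \<beta> = T \<beta> \<alpha>}"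

definition ext_square ::
  "('k::field, 'v::ab_group_add) lie_struct \<Rightarrow> ('k, 'v) tensor2 set" where
  "ext_square L =
     module.span tensor_scale {wedge L a b | a b. a \<in> lcarrier L \<and> b \<in> lcarrier L}"

definition pullback ::
  "('k::field, 'v::ab_group_add) lie_struct \<Rightarrow> ('v \<Rightarrow> 'w) \<Rightarrow> ('w \<Rightarrow> 'k) \<Rightarrow> 'v \<Rightarrow> 'k" where
  "pullback L f \<alpha> = (\<lambda>x. if x \<in> lcarrier L then \<alpha> (f x) else 0)"

text \<open>The map \<open>f \<otimes> g\<close> on tensors, for linear \<open>f\<close> and \<open>g\<close> from \<open>L\<close> to \<open>M\<close>.\<close>

definition tensor_map ::
  "('k::field, 'v::ab_group_add) lie_struct \<Rightarrow> ('k, 'w::ab_group_add) lie_struct \<Rightarrow>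
   ('v \<Rightarrow> 'w) \<Rightarrow> ('v \<Rightarrow> 'w) \<Rightarrow> ('k, 'v) tensor2 \<Rightarrow> ('k, 'w) tensor2" where
  "tensor_map L M f g T =
     (\<lambda>\<alpha> \<beta>. if \<alpha> \<in> dual M \<and> \<beta> \<in> dual M then T (pullback L f \<alpha>) (pullback L g \<beta>) else 0)"

text \<open>\<open>f \<otimes> 1 + 1 \<otimes> f\<close>; for \<open>f = ad X\<close> this is \<open>ad\<^sup>(\<^sup>2\<^sup>)\<close> of \<open>X\<close>.\<close>

definition tensor_deriv ::
  "('k::field, 'v::ab_group_add) lie_struct \<Rightarrow> ('v \<Rightarrow> 'v) \<Rightarrow>
   ('k, 'v) tensor2 \<Rightarrow> ('k, 'v) tensor2" where
  "tensor_deriv L f T = tensor_map L L f id T + tensor_map L L id f T"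

definition flat ::
  "('k::field, 'v::ab_group_add) lie_struct \<Rightarrow> ('v \<Rightarrow> 'v \<Rightarrow> 'k) \<Rightarrow> 'v \<Rightarrow> 'v \<Rightarrow> 'k" where
  "flat L K v = (\<lambda>w. if w \<in> lcarrier L then K v w else 0)"

text \<open>The inverse \<open>t\<close> of a non-degenerate bilinear form \<open>K\<close>: its contraction \<open>\<beta> \<mapsto> t(-, \<beta>)\<close>
  is the inverse of \<open>v \<mapsto> K(v, -)\<close>.\<close>

definition inverse_form ::
  "('k::field, 'v::ab_group_add) lie_struct \<Rightarrow> ('v \<Rightarrow> 'v \<Rightarrow> 'k) \<Rightarrow> ('k, 'v) tensor2" where
  "inverse_form L K =
     (\<lambda>\<alpha> \<beta>. if \<alpha> \<in> dual L \<and> \<beta> \<in> dual L then \<alpha> (the_inv_into (lcarrier L) (flat L K) \<beta>) else 0)"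


section \<open>Lie algebras\<close>

definition lie_algebra :: "('k::field, 'v::ab_group_add) lie_struct \<Rightarrow> bool" where
  "lie_algebra L \<longleftrightarrow>
     vector_space (lscale L) \<and> module.subspace (lscale L) (lcarrier L) \<and>
     (\<forall>x\<in>lcarrier L. \<forall>y\<in>lcarrier L. lbracket L x y \<in> lcarrier L) \<and>
     (\<forall>x\<in>lcarrier L. linear_on (lscale L) (lscale L) (lcarrier L) (\<lambda>y. lbracket L x y)) \<and>
     (\<forall>y\<in>lcarrier L. linear_on (lscale L) (lscale L) (lcarrier L) (\<lambda>x. lbracket L x y)) \<and>
     (\<forall>x\<in>lcarrier L. lbracket L x x = 0) \<and>
     (\<forall>x\<in>lcarrier L. \<forall>y\<in>lcarrier L. \<forall>z\<in>lcarrier L.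
        lbracket L x (lbracket L y z) + lbracket L y (lbracket L z x)
          + lbracket L z (lbracket L x y) = 0)"

definition lie_subalgebra :: "('k::field, 'v::ab_group_add) lie_struct \<Rightarrow> 'v set \<Rightarrow> bool" where
  "lie_subalgebra L A \<longleftrightarrow>
     A \<subseteq> lcarrier L \<and> module.subspace (lscale L) A \<and> (\<forall>x\<in>A. \<forall>y\<in>A. lbracket L x y \<in> A)"

definition lie_iso ::
  "('k::field, 'v::ab_group_add) lie_struct \<Rightarrow> ('k, 'w::ab_group_add) lie_struct \<Rightarrow>
   ('v \<Rightarrow> 'w) \<Rightarrow> bool" where
  "lie_iso L M f \<longleftrightarrow>
     f \<in> extensional (lcarrier L) \<and> bij_betw f (lcarrier L) (lcarrier M) \<and>
     linear_on (lscale L) (lscale M) (lcarrier L) f \<and>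
     (\<forall>x\<in>lcarrier L. \<forall>y\<in>lcarrier L. f (lbracket L x y) = lbracket M (f x) (f y))"

definition nondegenerate_invariant ::
  "('k::field, 'g::ab_group_add) lie_struct \<Rightarrow> ('k, 'g) tensor2 \<Rightarrow> bool" where
  "nondegenerate_invariant G t \<longleftrightarrow>
     t \<in> sym_square G \<and>
     (\<forall>v\<in>lcarrier G. tensor_deriv G (lbracket G v) t = 0) \<and>
     (\<forall>\<alpha>\<in>dual G. (\<forall>\<beta>\<in>dual G. t \<alpha> \<beta> = 0) \<longrightarrow> \<alpha> = 0)"


section \<open>Lie quasi-bialgebras\<close>

text \<open>The base pair \<open>(\<gg>, t)\<close> is bundled with the triple \<open>(\<hh>, \<rho>, \<delta>)\<close>.\<close>

record ('k, 'g, 'h) qbialg =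
  base :: "('k, 'g) lie_struct"
  tens :: "('k, 'g) tensor2"
  alg :: "('k, 'h) lie_struct"
  act :: "'g \<Rightarrow> 'h \<Rightarrow> 'h"
  cobr :: "'h \<Rightarrow> ('k, 'h) tensor2"

definition lie_action_by_derivations ::
  "('k::field, 'g::ab_group_add) lie_struct \<Rightarrow> ('k, 'h::ab_group_add) lie_struct \<Rightarrow>
   ('g \<Rightarrow> 'h \<Rightarrow> 'h) \<Rightarrow> bool" where
  "lie_action_by_derivations G H \<rho> \<longleftrightarrow>
     (\<forall>v\<in>lcarrier G. \<forall>X\<in>lcarrier H. \<rho> v X \<in> lcarrier H) \<and>
     (\<forall>v\<in>lcarrier G. linear_on (lscale H) (lscale H) (lcarrier H) (\<rho> v)) \<and>
     (\<forall>X\<in>lcarrier H. linear_on (lscale G) (lscale H) (lcarrier G) (\<lambda>v. \<rho> v X)) \<and>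
     (\<forall>v\<in>lcarrier G. \<forall>w\<in>lcarrier G. \<forall>X\<in>lcarrier H.
        \<rho> (lbracket G v w) X = \<rho> v (\<rho> w X) - \<rho> w (\<rho> v X)) \<and>
     (\<forall>v\<in>lcarrier G. \<forall>X\<in>lcarrier H. \<forall>Y\<in>lcarrier H.
        \<rho> v (lbracket H X Y) = lbracket H (\<rho> v X) Y + lbracket H X (\<rho> v Y))"

text \<open>The dual space with the transpose of \<open>\<delta>\<close> as bracket.\<close>

definition transpose_struct ::
  "('k::field, 'h::ab_group_add) lie_struct \<Rightarrow> ('h \<Rightarrow> ('k, 'h) tensor2) \<Rightarrow>
   ('k, 'h \<Rightarrow> 'k) lie_struct" where
  "transpose_struct H \<delta> =
     \<lparr>lscale = fun_scale, lcarrier = dual H,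
      lbracket = (\<lambda>\<alpha> \<beta> X. if X \<in> lcarrier H then \<delta> X \<alpha> \<beta> else 0)\<rparr>"

definition lie_cobracket ::
  "('k::field, 'h::ab_group_add) lie_struct \<Rightarrow> ('h \<Rightarrow> ('k, 'h) tensor2) \<Rightarrow> bool" where
  "lie_cobracket H \<delta> \<longleftrightarrow>
     (\<forall>X\<in>lcarrier H. \<delta> X \<in> ext_square H) \<and>
     linear_on (lscale H) tensor_scale (lcarrier H) \<delta> \<and>
     lie_algebra (transpose_struct H \<delta>)"

definition tensor_coeffs ::
  "('k::field, 'g::ab_group_add) lie_struct \<Rightarrow> ('k, 'g) tensor2 \<Rightarrow> 'g set \<Rightarrow>
   ('g \<Rightarrow> 'g \<Rightarrow> 'k) \<Rightarrow> bool" where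
  "tensor_coeffs G t E c \<longleftrightarrow>
     finite E \<and> \<not> module.dependent (lscale G) E \<and> module.span (lscale G) E = lcarrier G \<and>
     t = (\<Sum>e\<in>E. \<Sum>e'\<in>E. tensor_scale (c e e') (pure_tensor G e e'))"

text \<open>In the last clause \<open>E\<close> is a basis of \<open>\<gg>\<close> and \<open>c\<close> the matrix of coefficients of \<open>t\<close>
  in it; the sum does not depend on the choice of the basis.\<close>

definition lie_quasi_bialgebra ::
  "('k::field, 'g::ab_group_add, 'h::ab_group_add) qbialg \<Rightarrow> bool" where
  "lie_quasi_bialgebra S \<longleftrightarrow>
     (let G = base S; t = tens S; H = alg S; \<rho> = act S; \<delta> = cobr S in
        lie_algebra G \<and> finite_dim G \<and> nondegenerate_invariant G t \<and>
        lie_algebra H \<and> finite_dim H \<and>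
        lie_action_by_derivations G H \<rho> \<and>
        lie_cobracket H \<delta> \<and>
        (\<forall>v\<in>lcarrier G. \<forall>X\<in>lcarrier H. \<delta> (\<rho> v X) = tensor_deriv H (\<rho> v) (\<delta> X)) \<and>
        (\<forall>E c. tensor_coeffs G t E c \<longrightarrow>
           (\<forall>X\<in>lcarrier H. \<forall>Y\<in>lcarrier H.
              tensor_deriv H (lbracket H X) (\<delta> Y) - tensor_deriv H (lbracket H Y) (\<delta> X)
                - \<delta> (lbracket H X Y)
                - (\<Sum>e\<in>E. \<Sum>e'\<in>E. tensor_scale (c e e') (wedge H (\<rho> e X) (\<rho> e' Y))) = 0)))"

definition qbialg_isos ::
  "('k::field, 'g::ab_group_add, 'h::ab_group_add) qbialg \<Rightarrow>
   ('k, 'g'::ab_group_add, 'h'::ab_group_add) qbialg \<Rightarrow> (('g \<Rightarrow> 'g') \<times> ('h \<Rightarrow> 'h')) set" where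
  "qbialg_isos S S' =
     {(\<phi>, \<psi>).
        lie_iso (base S) (base S') \<phi> \<and> tensor_map (base S) (base S') \<phi> \<phi> (tens S) = tens S' \<and>
        lie_iso (alg S) (alg S') \<psi> \<and>
        (\<forall>v\<in>lcarrier (base S). \<forall>X\<in>lcarrier (alg S). \<psi> (act S v X) = act S' (\<phi> v) (\<psi> X)) \<and>
        (\<forall>X\<in>lcarrier (alg S). cobr S' (\<psi> X) = tensor_map (alg S) (alg S') \<psi> \<psi> (cobr S X))}"


section \<open>Manin quadruples\<close>

record ('k, 'd) quadruple =
  double :: "('k, 'd) lie_struct"
  pairing :: "'d \<Rightarrow> 'd \<Rightarrow> 'k"
  part_a :: "'d set"
  part_b :: "'d set"
  part_c :: "'d set"

definition orth :: "('k::field, 'd::ab_group_add) quadruple \<Rightarrow> 'd set \<Rightarrow> 'd set" where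
  "orth Q A = {x \<in> lcarrier (double Q). \<forall>y\<in>A. pairing Q x y = 0}"

definition manin_quadruple :: "('k::field, 'd::ab_group_add) quadruple \<Rightarrow> bool" where
  "manin_quadruple Q \<longleftrightarrow>
     (let L = double Q; D = lcarrier L; K = pairing Q;
          A = part_a Q; B = part_b Q; C = part_c Q in
        lie_algebra L \<and> finite_dim L \<and>
        (\<forall>x\<in>D. linear_on (lscale L) (*) D (K x)) \<and>
        (\<forall>x\<in>D. \<forall>y\<in>D. K x y = K y x) \<and>
        (\<forall>x\<in>D. (\<forall>y\<in>D. K x y = 0) \<longrightarrow> x = 0) \<and>
        (\<forall>x\<in>D. \<forall>y\<in>D. \<forall>z\<in>D. K (lbracket L x y) z + K y (lbracket L x z) = 0) \<and>
        lie_subalgebra L A \<and> lie_subalgebra L B \<and> lie_subalgebra L C \<and>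
        bij_betw (\<lambda>(x, y, z). x + y + z) (A \<times> B \<times> C) D \<and>
        orth Q A = {x + y | x y. x \<in> A \<and> y \<in> B} \<and>
        orth Q C = {x + y | x y. x \<in> B \<and> y \<in> C})"

definition quadruple_isos ::
  "('k::field, 'd::ab_group_add) quadruple \<Rightarrow> ('k, 'e::ab_group_add) quadruple \<Rightarrow>
   ('d \<Rightarrow> 'e) set" where
  "quadruple_isos Q Q' =
     {F. lie_iso (double Q) (double Q') F \<and>
         (\<forall>x\<in>lcarrier (double Q). \<forall>y\<in>lcarrier (double Q).
            pairing Q' (F x) (F y) = pairing Q x y) \<and>
         F ` part_a Q = part_a Q' \<and> F ` part_b Q = part_b Q' \<and> F ` part_c Q = part_c Q'}"

definition alg_of :: "('k::field, 'd::ab_group_add) quadruple \<Rightarrow> ('k, 'd) lie_struct" where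
  "alg_of Q = (double Q)\<lparr>lcarrier := part_a Q\<rparr>"

definition base_of :: "('k::field, 'd::ab_group_add) quadruple \<Rightarrow> ('k, 'd) lie_struct" where
  "base_of Q = (double Q)\<lparr>lcarrier := part_b Q\<rparr>"

text \<open>The functional on \<open>\<hh>\<close> identified with \<open>A \<in> \<hh>\<^sup>*\<close> (the third subalgebra) by the
  pairing.\<close>

definition functional_of ::
  "('k::field, 'd::ab_group_add) quadruple \<Rightarrow> 'd \<Rightarrow> 'd \<Rightarrow> 'k" where
  "functional_of Q A = flat (alg_of Q) (pairing Q) A"

definition element_of ::
  "('k::field, 'd::ab_group_add) quadruple \<Rightarrow> ('d \<Rightarrow> 'k) \<Rightarrow> 'd" where
  "element_of Q \<alpha> = the_inv_into (part_c Q) (functional_of Q) \<alpha>"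

definition induced_cobr ::
  "('k::field, 'd::ab_group_add) quadruple \<Rightarrow> 'd \<Rightarrow> ('k, 'd) tensor2" where
  "induced_cobr Q X =
     (\<lambda>\<alpha> \<beta>. if \<alpha> \<in> dual (alg_of Q) \<and> \<beta> \<in> dual (alg_of Q)
            then pairing Q X (lbracket (double Q) (element_of Q \<beta>) (element_of Q \<alpha>)) else 0)"

definition induced_qbialg ::
  "('k::field, 'd::ab_group_add) quadruple \<Rightarrow> ('k, 'd, 'd) qbialg" where
  "induced_qbialg Q =
     \<lparr>base = base_of Q, tens = inverse_form (base_of Q) (pairing Q), alg = alg_of Q,
      act = lbracket (double Q), cobr = induced_cobr Q\<rparr>"

text \<open>The equivalence is one of groupoids: \<open>induced_qbialg\<close> is its effect on objects, and
  on an isomorphism of Manin quadruples it is the (evidently functorial) restriction to \<open>\<gg>\<close>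
  and \<open>\<hh>\<close>.  Here \<open>(\<gg>, t)\<close> is allowed to vary; for a fixed \<open>(\<gg>, t)\<close> consider
  quadruples with an identification of \<open>\<gg>\<close> with \<open>part_b\<close>.\<close>

definition induced_iso ::
  "('k::field, 'd::ab_group_add) quadruple \<Rightarrow> ('d \<Rightarrow> 'e) \<Rightarrow> ('d \<Rightarrow> 'e) \<times> ('d \<Rightarrow> 'e)" where
  "induced_iso Q F = (restrict F (part_b Q), restrict F (part_a Q))"

end

theory Submission imports Defs begin

text \<open>
  In a Lie algebra \<open>\<dd>\<close> with invariant pairing the form \<open>\<langle>[x, y], z\<rangle>\<close> alternates, and for
  \<open>\<dd> = \<hh> \<oplus> \<gg> \<oplus> \<hh>\<^sup>*\<close> orthogonality leaves only its components of types \<open>\<hh>\<hh>\<hh>\<^sup>*\<close>,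
  \<open>\<hh>\<gg>\<hh>\<^sup>*\<close>, \<open>\<hh>\<hh>\<^sup>*\<hh>\<^sup>*\<close> and \<open>\<gg>\<gg>\<gg>\<close>, which are the bracket of \<open>\<hh>\<close>, the action, the cobracket and
  the bracket of \<open>\<gg>\<close>. So these data determine the bracket of \<open>\<dd>\<close>, which gives full faithfulness, and
  conversely define it. The form \<open>\<langle>Jac(x, y, z), w\<rangle>\<close> alternates as well; its
  non-trivial components on pure elements are the axioms of a Lie \<open>\<gg>\<close>-quasi-bialgebra, one each:
  Jacobi for \<open>\<hh>\<close>, for \<open>\<gg>\<close> and for \<open>\<hh>\<^sup>*\<close>, the derivation property, the action property, invariance of
  the cobracket, and (type \<open>\<hh>\<hh>\<hh>\<^sup>*\<hh>\<^sup>*\<close>) the compatibility condition.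
\<close>

section \<open>Finite-dimensional linear algebra on carriers\<close>

text \<open>Where the term in \<open>t\<close> comes from: for P in the third summand C and X in
  \<hh>, the bracket [P, X] has components in all three summands. Its C-component is the coadjoint
  action on P. Its \<gg>-component b is fixed by \<langle>b, v\<rangle> = \<langle>P,
  [X, v]\<rangle>, so it lowers to minus the functional that sends v to \<langle>P, \<rho>(v)
  X\<rangle>. The Jacobi identity of type \<hh>, \<hh>, C, C contains products \<langle>b,
  b'\<rangle>, and such a product is the value of the inverse form on two of these functionals. This
  computation is needed in both directions of the equivalence, so it is done once, with the Jacobi
  identity not assumed. For morphisms, the component on C is forced to be the contragredient of the
  one on \<hh>, while preservation of the form on \<gg> has to be deduced from preservation of its
  inverse.\<close>

lemma sum_fun_apply: "(\<Sum>i\<in>I. f i) x = (\<Sum>i\<in>I. f i x)"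
  by (induction I rule: infinite_finite_induct) auto

lemma fun_scale_apply: "fun_scale c \<alpha> x = c * \<alpha> x"
  by (simp add: fun_scale_def)

lemma vector_space_fun_scale: "vector_space (fun_scale :: 'k::field \<Rightarrow> ('v \<Rightarrow> 'k) \<Rightarrow> _)"
  by unfold_locales (auto simp: fun_scale_def fun_eq_iff algebra_simps)

lemma vector_space_tensor_scale: "vector_space (tensor_scale :: 'k::field \<Rightarrow> ('k, 'v) tensor2 \<Rightarrow> _)"
  by unfold_locales (auto simp: tensor_scale_def fun_eq_iff algebra_simps)

context vector_space
begin

text \<open>Extend a basis of V by x and then to a basis of the whole space. The coordinate along x
  vanishes on V, because vectors of V are already expanded in the basis of V.\<close>

lemma separating_functional:
  assumes V: "subspace V" and x: "x \<notin> V"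
  obtains g where "\<And>u v. g (u + v) = g u + g v" "\<And>c v. g (scale c v) = c * g v"
    "\<And>v. v \<in> V \<Longrightarrow> g v = 0" "g x = 1"
proof -
  obtain B where B: "B \<subseteq> V" "independent B" "V \<subseteq> span B"
    using maximal_independent_subset by blast
  have spB: "span B = V"
    using B V by (intro span_subspace)
  have ind: "independent (insert x B)"
    using B x spB by (intro independent_insertI) auto
  define E where "E = extend_basis (insert x B)"
  have E: "independent E" "span E = UNIV" "insert x B \<subseteq> E"
    using ind by (auto simp: E_def independent_extend_basis span_extend_basis
        extend_basis_superset[THEN subsetD])
  have "representation E v x = 0" if "v \<in> V" for v
  proof -
    have "representation E v = representation B v"
      using that E spB by (intro representation_extend) auto
    moreover have "x \<notin> B"
      using x B by auto
    ultimately show ?thesis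
      using representation_ne_zero by fastforce
  qed
  then show thesis
    using E by (intro that[of "\<lambda>v. representation E v x"])
      (auto simp: representation_add representation_scale representation_basis)
qed

lemma subspace_finite_span:
  assumes "subspace V" "finite B" "V \<subseteq> span B"
  obtains E where "finite E" "independent E" "span E = V"
proof -
  obtain E where E: "E \<subseteq> V" "independent E" "V \<subseteq> span E"
    using maximal_independent_subset by blast
  then have "finite E"
    using independent_span_bound[of B E] assms by auto
  then show thesis
    using E assms(1) that span_subspace by blast
qed

end

text \<open>Only linear data are required, so that duality is available for the double before
  anything is known about its bracket.\<close>

locale fd_struct =
  fixes L :: "('k::field, 'v::ab_group_add) lie_struct"
  assumes vector_space: "vector_space (lscale L)"
    and subspace_carrier: "module.subspace (lscale L) (lcarrier L)"
    and finite_dim: "finite_dim L"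

sublocale fd_struct \<subseteq> vector_space "lscale L"
  by (rule vector_space)

lemma linear_on_sum:
  assumes "module s" "module.subspace s V" "linear_on s s' V f"
    "\<And>i. i \<in> I \<Longrightarrow> g i \<in> V" "f 0 = 0"
  shows "f (\<Sum>i\<in>I. g i) = (\<Sum>i\<in>I. f (g i))"
  using assms(4)
proof (induction I rule: infinite_finite_induct)
  case (insert i I)
  interpret module s by fact
  have "(\<Sum>i\<in>I. g i) \<in> V"
    using assms(2) insert.prems by (intro subspace_sum) auto
  then show ?case
    using insert assms(3) by (auto simp: linear_on_def)
qed (use assms in auto)

lemma linear_on_zero:
  assumes "module s" "module s'" "module.subspace s V" "linear_on s s' V f"
  shows "f 0 = 0"
proof -
  have "0 \<in> V"
    using module.subspace_0 assms by auto
  then have "f (s 0 0) = s' 0 (f 0)"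
    using assms(4) by (auto simp: linear_on_def)
  then show ?thesis
    using assms by (simp add: module.scale_zero_left)
qed

lemma module_mult: "module ((*) :: 'k::field \<Rightarrow> _)"
  by unfold_locales (auto simp: algebra_simps)

lemma module_fun_scale: "module fun_scale"
  using vector_space_fun_scale module_iff_vector_space by blast

section \<open>Dual spaces, coordinates and reflexivity\<close>

context fd_struct
begin

lemma dual_add: "\<alpha> \<in> dual L \<Longrightarrow> x \<in> lcarrier L \<Longrightarrow> y \<in> lcarrier L \<Longrightarrow> \<alpha> (x + y) = \<alpha> x + \<alpha> y"
  and dual_scale: "\<alpha> \<in> dual L \<Longrightarrow> x \<in> lcarrier L \<Longrightarrow> \<alpha> (lscale L c x) = c * \<alpha> x"
  and dual_outside: "\<alpha> \<in> dual L \<Longrightarrow> x \<notin> lcarrier L \<Longrightarrow> \<alpha> x = 0"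
  by (auto simp: dual_def linear_on_def)

lemma dual_0: "\<alpha> \<in> dual L \<Longrightarrow> \<alpha> 0 = 0"
  using dual_scale[of \<alpha> 0 0] subspace_0[OF subspace_carrier] by simp

lemma dual_sum:
  assumes "\<alpha> \<in> dual L" "\<And>i. i \<in> I \<Longrightarrow> f i \<in> lcarrier L"
  shows "\<alpha> (\<Sum>i\<in>I. f i) = (\<Sum>i\<in>I. \<alpha> (f i))"
  using assms dual_0 subspace_carrier module_axioms
  by (intro linear_on_sum[where V = "lcarrier L" and s = "lscale L" and s' = "(*)"]) (auto simp: dual_def)

lemma dual_minus: "\<alpha> \<in> dual L \<Longrightarrow> x \<in> lcarrier L \<Longrightarrow> \<alpha> (- x) = - \<alpha> x"
  using dual_scale[of \<alpha> x "-1"] by simp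

lemma dual_eqI:
  "\<alpha> \<in> dual L \<Longrightarrow> \<beta> \<in> dual L \<Longrightarrow> (\<And>x. x \<in> lcarrier L \<Longrightarrow> \<alpha> x = \<beta> x) \<Longrightarrow> \<alpha> = \<beta>"
  using dual_outside by (auto simp: fun_eq_iff) metis

lemma subspace_dual: "module.subspace fun_scale (dual L)"
proof -
  interpret fs: module fun_scale by (rule module_fun_scale)
  show ?thesis
    unfolding fs.subspace_def
    by (auto simp: dual_def linear_on_def fun_scale_def algebra_simps)
qed

lemma dual_separating:
  assumes "x \<in> lcarrier L" "subspace V" "x \<notin> V"
  obtains \<alpha> where "\<alpha> \<in> dual L" "\<And>v. v \<in> V \<Longrightarrow> \<alpha> v = 0" "\<alpha> x = 1"
proof -
  obtain g where g: "\<And>u v. g (u + v) = g u + g v" "\<And>c v. g (lscale L c v) = c * g v"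
    "\<And>v. v \<in> V \<Longrightarrow> g v = 0" "g x = 1"
    using separating_functional assms(2,3) by metis
  show thesis
    using g assms(1) subspace_carrier
    by (intro that[of "\<lambda>v. if v \<in> lcarrier L then g v else 0"])
      (auto simp: dual_def linear_on_def subspace_def)
qed

lemma dual_zero_imp:
  assumes "x \<in> lcarrier L" "\<And>\<alpha>. \<alpha> \<in> dual L \<Longrightarrow> \<alpha> x = 0"
  shows "x = 0"
proof (rule ccontr)
  assume "x \<noteq> 0"
  then obtain \<alpha> where "\<alpha> \<in> dual L" "\<alpha> x = 1"
    using dual_separating[of x "{0}"] assms(1) by auto
  then show False
    using assms(2) by force
qed

text \<open>The dual basis of E; the cut-off outside the carrier places it in
  \<open>dual L\<close>.\<close>

definition coord :: "'v set \<Rightarrow> 'v \<Rightarrow> 'v \<Rightarrow> 'k" where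
  "coord E e = (\<lambda>x. if x \<in> lcarrier L then representation E x e else 0)"

definition is_basis :: "'v set \<Rightarrow> bool" where
  "is_basis E \<longleftrightarrow> finite E \<and> independent E \<and> span E = lcarrier L"

lemma basis_ex: obtains E where "is_basis E"
proof -
  obtain B where "finite B" "lcarrier L = span B"
    using finite_dim by (auto simp: finite_dim_def)
  then show thesis
    using subspace_finite_span[OF subspace_carrier, of B] that by (auto simp: is_basis_def)
qed

lemma basis_in: "is_basis E \<Longrightarrow> e \<in> E \<Longrightarrow> e \<in> lcarrier L"
  unfolding is_basis_def using span_base by blast

lemma coord_dual: "is_basis E \<Longrightarrow> coord E e \<in> dual L"
  using subspace_carrier
  by (auto simp: dual_def linear_on_def coord_def is_basis_def representation_add representation_scale
      subspace_def)

lemma coord_expand: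
  assumes "is_basis E" "x \<in> lcarrier L"
  shows "(\<Sum>e\<in>E. lscale L (coord E e x) e) = x"
  using assms by (auto simp: coord_def is_basis_def intro!: sum_representation_eq)

lemma dual_expand_apply:
  assumes "is_basis E" "\<alpha> \<in> dual L" "x \<in> lcarrier L"
  shows "\<alpha> x = (\<Sum>e\<in>E. \<alpha> e * coord E e x)"
proof -
  have "\<alpha> x = \<alpha> (\<Sum>e\<in>E. lscale L (coord E e x) e)"
    using assms by (simp add: coord_expand)
  also have "\<dots> = (\<Sum>e\<in>E. \<alpha> (lscale L (coord E e x) e))"
    using assms basis_in subspace_carrier by (intro dual_sum) (auto simp: subspace_def)
  also have "\<dots> = (\<Sum>e\<in>E. \<alpha> e * coord E e x)"
    using assms basis_in by (intro sum.cong) (auto simp: dual_scale)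
  finally show ?thesis .
qed

lemma dual_expand:
  assumes "is_basis E" "\<alpha> \<in> dual L"
  shows "\<alpha> = (\<Sum>e\<in>E. fun_scale (\<alpha> e) (coord E e))"
proof
  fix x show "\<alpha> x = (\<Sum>e\<in>E. fun_scale (\<alpha> e) (coord E e)) x"
    using dual_expand_apply[OF assms] dual_outside[OF assms(2)]
    by (cases "x \<in> lcarrier L") (auto simp: sum_fun_apply fun_scale_def coord_def)
qed

lemma linear_on_dual_expand:
  assumes "is_basis E" "\<alpha> \<in> dual L" "linear_on fun_scale (*) (dual L) f"
  shows "f \<alpha> = (\<Sum>e\<in>E. \<alpha> e * f (coord E e))"
proof -
  interpret fs: module fun_scale by (rule module_fun_scale)
  have "f \<alpha> = f (\<Sum>e\<in>E. fun_scale (\<alpha> e) (coord E e))"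
    using dual_expand assms by metis
  also have "\<dots> = (\<Sum>e\<in>E. f (fun_scale (\<alpha> e) (coord E e)))"
  proof (rule linear_on_sum[OF module_fun_scale subspace_dual assms(3)])
    show "f 0 = 0"
      using linear_on_zero[OF module_fun_scale module_mult subspace_dual assms(3)] .
  qed (use assms subspace_dual coord_dual in \<open>auto intro: fs.subspace_scale\<close>)
  also have "\<dots> = (\<Sum>e\<in>E. \<alpha> e * f (coord E e))"
    using assms coord_dual by (intro sum.cong) (auto simp: linear_on_def)
  finally show ?thesis .
qed

text \<open>Reflexivity: the vector has the values of f on the dual basis as its coordinates. Finite
  dimension is essential here.\<close>

lemma bidual:
  assumes "linear_on fun_scale (*) (dual L) f"
  obtains x where "x \<in> lcarrier L" "\<And>\<alpha>. \<alpha> \<in> dual L \<Longrightarrow> \<alpha> x = f \<alpha>"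
proof -
  obtain E where E: "is_basis E" by (rule basis_ex)
  define x where "x = (\<Sum>e\<in>E. lscale L (f (coord E e)) e)"
  have in_c: "lscale L c e \<in> lcarrier L" if "e \<in> E" for c e
    using subspace_carrier basis_in[OF E] that by (auto simp: subspace_def)
  have "x \<in> lcarrier L"
    unfolding x_def using in_c by (intro subspace_sum subspace_carrier)
  moreover have "\<alpha> x = f \<alpha>" if "\<alpha> \<in> dual L" for \<alpha>
  proof -
    have "\<alpha> x = (\<Sum>e\<in>E. \<alpha> (lscale L (f (coord E e)) e))"
      unfolding x_def using in_c that by (intro dual_sum)
    also have "\<dots> = (\<Sum>e\<in>E. \<alpha> e * f (coord E e))"
      using that basis_in[OF E] by (intro sum.cong) (auto simp: dual_scale)
    finally show ?thesis
      using linear_on_dual_expand[OF E that assms] by simp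
  qed
  ultimately show thesis by (rule that)
qed

lemma finite_span_dual: "\<exists>B. finite B \<and> dual L = module.span fun_scale B"
proof -
  interpret fs: module fun_scale by (rule module_fun_scale)
  obtain E where E: "is_basis E" by (rule basis_ex)
  have "dual L \<subseteq> fs.span (coord E ` E)"
  proof
    fix \<alpha> assume "\<alpha> \<in> dual L"
    then have "\<alpha> = (\<Sum>e\<in>E. fun_scale (\<alpha> e) (coord E e))"
      using E dual_expand by blast
    also have "\<dots> \<in> fs.span (coord E ` E)"
      by (intro fs.span_sum fs.span_scale fs.span_base) auto
    finally show "\<alpha> \<in> fs.span (coord E ` E)" .
  qed
  moreover have "fs.span (coord E ` E) \<subseteq> dual L"
    using coord_dual[OF E] subspace_dual by (intro fs.span_minimal) auto
  moreover have "finite E"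
    using E by (auto simp: is_basis_def)
  ultimately show ?thesis by blast
qed

text \<open>If the image of \<open>W\<close> in the dual were proper, some nonzero functional on the dual would vanish
  on it; that functional is evaluation at a vector, which separation by \<open>W\<close> forces to be zero.\<close>

lemma bij_betw_flat:
  assumes W: "module.subspace s W" "module s"
    and left: "\<And>x. x \<in> lcarrier L \<Longrightarrow> linear_on s (*) W (\<lambda>w. K w x)"
    and right: "\<And>w. w \<in> W \<Longrightarrow> linear_on (lscale L) (*) (lcarrier L) (K w)"
    and inj: "\<And>w. w \<in> W \<Longrightarrow> (\<And>x. x \<in> lcarrier L \<Longrightarrow> K w x = 0) \<Longrightarrow> w = 0"
    and sep: "\<And>x. x \<in> lcarrier L \<Longrightarrow> (\<And>w. w \<in> W \<Longrightarrow> K w x = 0) \<Longrightarrow> x = 0"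
  shows "bij_betw (flat L K) W (dual L)"
proof -
  interpret s: module s by fact
  interpret fs: vector_space fun_scale by (rule vector_space_fun_scale)
  have im: "flat L K w \<in> dual L" if "w \<in> W" for w
    using right[OF that] subspace_carrier by (auto simp: dual_def flat_def linear_on_def subspace_def)
  have sub: "fs.subspace (flat L K ` W)"
    unfolding fs.subspace_def
  proof (intro conjI ballI allI)
    have "K 0 x = 0" if "x \<in> lcarrier L" for x
      using W left[OF that] by (intro linear_on_zero[of s "(*)" W "\<lambda>w. K w x"] module_mult)
    then have "flat L K 0 = 0"
      by (auto simp: flat_def fun_eq_iff)
    then show "0 \<in> flat L K ` W"
      using s.subspace_0[OF W(1)] by force
  next
    fix a b assume "a \<in> flat L K ` W" "b \<in> flat L K ` W"
    then obtain u v where uv: "a = flat L K u" "b = flat L K v" "u \<in> W" "v \<in> W" by auto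
    then have "a + b = flat L K (u + v)"
      using left by (auto simp: flat_def fun_eq_iff linear_on_def)
    then show "a + b \<in> flat L K ` W"
      using uv W by (auto simp: s.subspace_def)
  next
    fix a c assume "a \<in> flat L K ` W"
    then obtain u where uv: "a = flat L K u" "u \<in> W" by auto
    then have "fun_scale c a = flat L K (s c u)"
      using left by (auto simp: flat_def fun_eq_iff linear_on_def fun_scale_def)
    then show "fun_scale c a \<in> flat L K ` W"
      using uv W by (auto simp: s.subspace_def)
  qed
  have "inj_on (flat L K) W"
  proof (rule inj_onI)
    fix u v assume uv: "u \<in> W" "v \<in> W" "flat L K u = flat L K v"
    have "K (u - v) x = 0" if x: "x \<in> lcarrier L" for x
    proof -
      \<comment> \<open>\<open>linear_on\<close> speaks of sums and multiples only, so the
        difference is entered as a sum with a multiple by -1.\<close>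
      have "K (u + s (-1) v) x = K u x + (-1) * K v x"
        using left[OF x] uv W by (auto simp: linear_on_def s.subspace_def simp del: s.scale_minus_left)
      moreover have "K u x = K v x"
        using uv(3) x by (auto simp: flat_def fun_eq_iff split: if_splits)
      ultimately show ?thesis by simp
    qed
    moreover have "u - v \<in> W"
      using uv W s.subspace_diff by auto
    ultimately show "u = v"
      using inj by fastforce
  qed
  moreover have "dual L \<subseteq> flat L K ` W"
  proof (rule ccontr)
    assume "\<not> dual L \<subseteq> flat L K ` W"
    then obtain \<alpha> where \<alpha>: "\<alpha> \<in> dual L" "\<alpha> \<notin> flat L K ` W" by auto
    obtain g where g: "\<And>u v. g (u + v) = g u + g v" "\<And>c v. g (fun_scale c v) = c * g v"
      "\<And>v. v \<in> flat L K ` W \<Longrightarrow> g v = 0" "g \<alpha> = 1"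
      using fs.separating_functional[OF sub \<alpha>(2)] by metis
    obtain x where x: "x \<in> lcarrier L" "\<And>\<beta>. \<beta> \<in> dual L \<Longrightarrow> \<beta> x = g \<beta>"
      using bidual[of g] g by (auto simp: linear_on_def)
    have "K w x = 0" if "w \<in> W" for w
    proof -
      have "flat L K w x = 0"
        using x(2)[OF im[OF that]] g(3) that by simp
      then show ?thesis
        using x(1) by (simp add: flat_def)
    qed
    then have "x = 0"
      using sep x(1) by blast
    then show False
      using x(2)[OF \<alpha>(1)] g(4) dual_0[OF \<alpha>(1)] by simp
  qed
  moreover have "flat L K ` W \<subseteq> dual L"
    using im by blast
  ultimately show ?thesis
    unfolding bij_betw_def by blast
qed

section \<open>Tensors as bilinear functions on the dual\<close>

definition bilinear_tensor :: "('k, 'v) tensor2 \<Rightarrow> bool" where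
  "bilinear_tensor T \<longleftrightarrow>
     (\<forall>\<beta>\<in>dual L. linear_on fun_scale (*) (dual L) (\<lambda>\<alpha>. T \<alpha> \<beta>)) \<and>
     (\<forall>\<alpha>\<in>dual L. linear_on fun_scale (*) (dual L) (T \<alpha>)) \<and>
     (\<forall>\<alpha> \<beta>. \<alpha> \<notin> dual L \<or> \<beta> \<notin> dual L \<longrightarrow> T \<alpha> \<beta> = 0)"

lemma bilinear_tensor_expand:
  assumes "is_basis E" "bilinear_tensor T"
  shows "T = (\<Sum>e\<in>E. \<Sum>e'\<in>E. tensor_scale (T (coord E e) (coord E e')) (pure_tensor L e e'))"
proof (intro ext)
  fix \<alpha> \<beta>
  show "T \<alpha> \<beta> = (\<Sum>e\<in>E. \<Sum>e'\<in>E. tensor_scale (T (coord E e) (coord E e')) (pure_tensor L e e')) \<alpha> \<beta>"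
  proof (cases "\<alpha> \<in> dual L \<and> \<beta> \<in> dual L")
    case True
    have "T \<alpha> \<beta> = (\<Sum>e\<in>E. \<alpha> e * T (coord E e) \<beta>)"
      using True assms by (intro linear_on_dual_expand) (auto simp: bilinear_tensor_def)
    also have "\<dots> = (\<Sum>e\<in>E. \<alpha> e * (\<Sum>e'\<in>E. \<beta> e' * T (coord E e) (coord E e')))"
      using True assms coord_dual
      by (intro sum.cong refl arg_cong[where f = "(*) _"] linear_on_dual_expand) (auto simp: bilinear_tensor_def)
    finally show ?thesis
      using True by (simp add: sum_fun_apply tensor_scale_def pure_tensor_def sum_distrib_left mult_ac)
  next
    case False
    then show ?thesis
      using assms by (auto simp: bilinear_tensor_def sum_fun_apply tensor_scale_def pure_tensor_def)
  qed
qed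

text \<open>Together with \<open>tensor_square_bilinear\<close>, this trades membership in a span
  for bilinearity, which can be checked without a basis. The coefficients are the values of T on the
  dual basis.\<close>

lemma bilinear_tensor_square:
  assumes "bilinear_tensor T"
  shows "T \<in> tensor_square L"
proof -
  interpret ts: vector_space "tensor_scale :: 'k \<Rightarrow> ('k, 'v) tensor2 \<Rightarrow> _"
    by (rule vector_space_tensor_scale)
  obtain E where E: "is_basis E" by (rule basis_ex)
  show ?thesis
    unfolding tensor_square_def
    by (subst bilinear_tensor_expand[OF E assms]; intro ts.span_sum ts.span_scale ts.span_base)
      (use basis_in[OF E] in auto)
qed

lemma tensor_square_bilinear:
  assumes "T \<in> tensor_square L"
  shows "bilinear_tensor T"
proof -
  interpret ts: vector_space "tensor_scale :: 'k \<Rightarrow> ('k, 'v) tensor2 \<Rightarrow> _"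
    by (rule vector_space_tensor_scale)
  interpret fs: module fun_scale by (rule module_fun_scale)
  have "ts.subspace (Collect bilinear_tensor)"
    unfolding ts.subspace_def bilinear_tensor_def linear_on_def
    by (simp add: tensor_scale_def distrib_left mult.left_commute add.commute add.left_commute)
  moreover have "bilinear_tensor (pure_tensor L a b)" for a b
    using subspace_dual unfolding bilinear_tensor_def linear_on_def fs.subspace_def
    by (auto simp: pure_tensor_def fun_scale_apply distrib_left distrib_right)
  ultimately have "tensor_square L \<subseteq> Collect bilinear_tensor"
    unfolding tensor_square_def by (intro ts.span_minimal) auto
  then show ?thesis
    using assms by auto
qed

lemma ext_square_bilinear:
  assumes "T \<in> ext_square L"
  shows "bilinear_tensor T"
proof (rule tensor_square_bilinear)
  interpret ts: vector_space "tensor_scale :: 'k \<Rightarrow> ('k, 'v) tensor2 \<Rightarrow> _"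
    by (rule vector_space_tensor_scale)
  have "ext_square L \<subseteq> tensor_square L"
    unfolding ext_square_def
  proof (rule ts.span_minimal)
    show "ts.subspace (tensor_square L)"
      by (simp add: tensor_square_def)
    show "{wedge L a b | a b. a \<in> lcarrier L \<and> b \<in> lcarrier L} \<subseteq> tensor_square L"
      unfolding tensor_square_def wedge_def by (auto intro!: ts.span_diff intro: ts.span_base)
  qed
  then show "T \<in> tensor_square L"
    using assms by auto
qed

text \<open>In characteristic 2 the coefficients cannot be halved: alternation, not just antisymmetry,
  has to be used on the diagonal.\<close>

lemma alternating_sum_in_span:
  fixes c :: "'b \<Rightarrow> 'b \<Rightarrow> 'k" and P :: "'b \<Rightarrow> 'b \<Rightarrow> ('k, 'v) tensor2"
  assumes "finite E" "\<And>e. e \<in> E \<Longrightarrow> c e e = 0" "\<And>e e'. e \<in> E \<Longrightarrow> e' \<in> E \<Longrightarrow> c e e' = - c e' e"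
    "\<And>e e'. e \<in> E \<Longrightarrow> e' \<in> E \<Longrightarrow> P e e' - P e' e \<in> S"
  shows "(\<Sum>e\<in>E. \<Sum>e'\<in>E. tensor_scale (c e e') (P e e')) \<in> module.span tensor_scale S"
  using assms
proof (induction E rule: finite_induct)
  interpret ts: vector_space "tensor_scale :: 'k \<Rightarrow> ('k, 'v) tensor2 \<Rightarrow> _"
    by (rule vector_space_tensor_scale)
  case empty
  show ?case by (simp only: sum.empty ts.span_zero)
next
  interpret ts: vector_space "tensor_scale :: 'k \<Rightarrow> ('k, 'v) tensor2 \<Rightarrow> _"
    by (rule vector_space_tensor_scale)
  case (insert x E)
  have diag: "c x x = 0"
    using insert.prems(1) by blast
  have flip: "tensor_scale (c e x) (P e x) = - tensor_scale (c x e) (P e x)" if "e \<in> E" for e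
  proof -
    have "c e x = - c x e"
      using that by (intro insert.prems(2)) auto
    then show ?thesis
      by (simp only: ts.scale_minus_left)
  qed
  \<comment> \<open>The row and the column of the new index x are merged into one sum of differences
    P x e - P e x, each of which lies in S; the diagonal entry vanishes by itself.\<close>
  have "(\<Sum>e\<in>E. tensor_scale (c x e) (P x e - P e x)) =
      (\<Sum>e\<in>E. tensor_scale (c x e) (P x e)) + (\<Sum>e\<in>E. tensor_scale (c e x) (P e x))"
    unfolding sum.distrib[symmetric] by (intro sum.cong refl) (simp add: flip ts.scale_right_diff_distrib)
  then have eq: "(\<Sum>e\<in>insert x E. \<Sum>e'\<in>insert x E. tensor_scale (c e e') (P e e')) =
    (\<Sum>e\<in>E. tensor_scale (c x e) (P x e - P e x)) + (\<Sum>e\<in>E. \<Sum>e'\<in>E. tensor_scale (c e e') (P e e'))"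
    using insert.hyps by (simp add: sum.distrib diag add.assoc)
  have "P x e - P e x \<in> S" if "e \<in> E" for e
    using that by (intro insert.prems(3)) auto
  then have "(\<Sum>e\<in>E. tensor_scale (c x e) (P x e - P e x)) \<in> ts.span S"
    by (intro ts.span_sum ts.span_scale ts.span_base)
  moreover have "(\<Sum>e\<in>E. \<Sum>e'\<in>E. tensor_scale (c e e') (P e e')) \<in> ts.span S"
    by (rule insert.IH) (blast intro: insert.prems)+
  ultimately show ?case
    unfolding eq by (rule ts.span_add)
qed

lemma alternating_ext_square:
  assumes T: "bilinear_tensor T" and alt: "\<And>\<alpha>. \<alpha> \<in> dual L \<Longrightarrow> T \<alpha> \<alpha> = 0"
  shows "T \<in> ext_square L"
proof -
  interpret fs: module fun_scale by (rule module_fun_scale)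
  obtain E where E: "is_basis E" by (rule basis_ex)
  \<comment> \<open>Polarisation: expand the value of T on the pair formed by \<alpha> + \<beta> and
    itself.\<close>
  have anti: "T \<alpha> \<beta> = - T \<beta> \<alpha>" if "\<alpha> \<in> dual L" "\<beta> \<in> dual L" for \<alpha> \<beta>
  proof -
    have "T (\<alpha> + \<beta>) (\<alpha> + \<beta>) = 0" "\<alpha> + \<beta> \<in> dual L"
      using alt that subspace_dual by (auto simp: fs.subspace_def)
    moreover have "T (\<alpha> + \<beta>) (\<alpha> + \<beta>) = T \<alpha> \<alpha> + T \<alpha> \<beta> + (T \<beta> \<alpha> + T \<beta> \<beta>)"
      using T that calculation(2) by (simp add: bilinear_tensor_def linear_on_def)
    ultimately show ?thesis
      using that alt by (simp add: eq_neg_iff_add_eq_0)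
  qed
  show ?thesis
    unfolding ext_square_def
    by (subst bilinear_tensor_expand[OF E T], rule alternating_sum_in_span)
      (use E coord_dual[OF E] alt anti basis_in[OF E] in \<open>unfold is_basis_def wedge_def, blast+\<close>)
qed

text \<open>The compatibility axiom is quantified over all presentations of \<open>t\<close> in a
  basis. Nothing can be drawn from it until one presentation is known to exist.\<close>

lemma tensor_coeffs_ex:
  assumes "T \<in> tensor_square L"
  obtains E c where "tensor_coeffs L T E c"
proof -
  obtain E where E: "is_basis E" by (rule basis_ex)
  show thesis
    using E bilinear_tensor_expand[OF E tensor_square_bilinear[OF assms]]
    by (intro that[of E "\<lambda>e e'. T (coord E e) (coord E e')"]) (auto simp: tensor_coeffs_def is_basis_def)
qed

lemma tensor_coeffs_apply:
  assumes "tensor_coeffs L T E c" "\<alpha> \<in> dual L" "\<beta> \<in> dual L"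
  shows "(\<Sum>e\<in>E. \<Sum>e'\<in>E. c e e' * (\<alpha> e * \<beta> e')) = T \<alpha> \<beta>"
  using assms by (simp add: tensor_coeffs_def sum_fun_apply tensor_scale_def pure_tensor_def)

text \<open>Evaluation at a vector is linear in the functional. For the inverse form and the induced
  cobracket these vectors can be named, which saves separate linearity proofs.\<close>

lemma bilinear_tensorI:
  assumes "\<And>\<beta>. \<beta> \<in> dual L \<Longrightarrow> \<exists>v\<in>lcarrier L. \<forall>\<alpha>\<in>dual L. T \<alpha> \<beta> = \<alpha> v"
    "\<And>\<alpha>. \<alpha> \<in> dual L \<Longrightarrow> \<exists>v\<in>lcarrier L. \<forall>\<beta>\<in>dual L. T \<alpha> \<beta> = \<beta> v"
    "\<And>\<alpha> \<beta>. \<alpha> \<notin> dual L \<or> \<beta> \<notin> dual L \<Longrightarrow> T \<alpha> \<beta> = 0"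
  shows "bilinear_tensor T"
proof -
  interpret fs: module fun_scale by (rule module_fun_scale)
  have cl: "\<alpha> + \<beta> \<in> dual L" "fun_scale c \<alpha> \<in> dual L" if "\<alpha> \<in> dual L" "\<beta> \<in> dual L" for \<alpha> \<beta> c
    using that subspace_dual by (auto simp: fs.subspace_def)
  have lin: "linear_on fun_scale (*) (dual L) f"
    if "\<exists>v\<in>lcarrier L. \<forall>\<alpha>\<in>dual L. f \<alpha> = \<alpha> v" for f
    using that cl by (fastforce simp: linear_on_def fun_scale_apply)
  show ?thesis
    unfolding bilinear_tensor_def
    by (intro conjI ballI allI impI lin assms(1) assms(2)) (simp_all add: assms(3))
qed

lemma pullback_id: "\<alpha> \<in> dual L \<Longrightarrow> pullback L id \<alpha> = \<alpha>"
  by (auto simp: pullback_def fun_eq_iff dual_outside)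

lemma tensor_deriv_apply:
  "\<alpha> \<in> dual L \<Longrightarrow> \<beta> \<in> dual L \<Longrightarrow>
    tensor_deriv L f T \<alpha> \<beta> = T (pullback L f \<alpha>) \<beta> + T \<alpha> (pullback L f \<beta>)"
  by (simp add: tensor_deriv_def tensor_map_def pullback_id)

lemma tensor_deriv_outside:
  "\<alpha> \<notin> dual L \<or> \<beta> \<notin> dual L \<Longrightarrow> tensor_deriv L f T \<alpha> \<beta> = 0"
  by (auto simp: tensor_deriv_def tensor_map_def)

text \<open>A functional on H composed with the orbit map of X is a functional on L, so each half of
  the wedge sum is T evaluated on two such functionals. The basis disappears, which is why its
  choice does not matter.\<close>

lemma wedge_sum_apply:
  assumes T: "tensor_coeffs L T E c" and ab: "\<alpha> \<in> dual H" "\<beta> \<in> dual H"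
    and pb: "\<And>X \<gamma>. X \<in> lcarrier H \<Longrightarrow> \<gamma> \<in> dual H \<Longrightarrow> pullback L (\<lambda>v. \<rho> v X) \<gamma> \<in> dual L"
    and XY: "X \<in> lcarrier H" "Y \<in> lcarrier H"
  shows "(\<Sum>e\<in>E. \<Sum>e'\<in>E. tensor_scale (c e e') (wedge H (\<rho> e X) (\<rho> e' Y))) \<alpha> \<beta> =
    T (pullback L (\<lambda>v. \<rho> v X) \<alpha>) (pullback L (\<lambda>v. \<rho> v Y) \<beta>)
      - T (pullback L (\<lambda>v. \<rho> v X) \<beta>) (pullback L (\<lambda>v. \<rho> v Y) \<alpha>)"
proof -
  have E: "e \<in> lcarrier L" if "e \<in> E" for e
    using T that span_base unfolding tensor_coeffs_def by blast
  have "(\<Sum>e\<in>E. \<Sum>e'\<in>E. tensor_scale (c e e') (wedge H (\<rho> e X) (\<rho> e' Y))) \<alpha> \<beta> =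
    (\<Sum>e\<in>E. \<Sum>e'\<in>E. c e e' * (pullback L (\<lambda>v. \<rho> v X) \<alpha> e * pullback L (\<lambda>v. \<rho> v Y) \<beta> e')
      - c e e' * (pullback L (\<lambda>v. \<rho> v X) \<beta> e * pullback L (\<lambda>v. \<rho> v Y) \<alpha> e'))"
    using ab E by (simp add: sum_fun_apply tensor_scale_def wedge_def pure_tensor_def pullback_def
        right_diff_distrib mult.commute cong: sum.cong)
  also have "\<dots> = T (pullback L (\<lambda>v. \<rho> v X) \<alpha>) (pullback L (\<lambda>v. \<rho> v Y) \<beta>)
      - T (pullback L (\<lambda>v. \<rho> v X) \<beta>) (pullback L (\<lambda>v. \<rho> v Y) \<alpha>)"
    unfolding sum_subtractf using pb ab XY by (simp add: tensor_coeffs_apply[OF T])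
  finally show ?thesis .
qed

end

section \<open>Manin quadruples without the Jacobi identity\<close>

text \<open>The inclusions between brackets, the component formulas and the symmetries of the
  Jacobiator follow from invariance and orthogonality alone. Kept apart from the Jacobi identity,
  they can be used in the double of a quasi-bialgebra while its Jacobi identity is still being
  proved. The assumptions copy the remaining conjuncts of \<open>manin_quadruple\<close>, so that
  \<open>manin_quadruple_iff\<close> merely regroups them.\<close>

locale quad =
  fixes Q :: "('k::field, 'd::ab_group_add) quadruple"
  assumes vs: "vector_space (lscale (double Q))"
    and sub_D: "module.subspace (lscale (double Q)) (lcarrier (double Q))"
    and fin_D: "finite_dim (double Q)"
    and br_closed_ball: "\<forall>x\<in>lcarrier (double Q). \<forall>y\<in>lcarrier (double Q).
      lbracket (double Q) x y \<in> lcarrier (double Q)"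
    and br_linear_right: "\<forall>x\<in>lcarrier (double Q).
      linear_on (lscale (double Q)) (lscale (double Q)) (lcarrier (double Q)) (\<lambda>y. lbracket (double Q) x y)"
    and br_linear_left: "\<forall>y\<in>lcarrier (double Q).
      linear_on (lscale (double Q)) (lscale (double Q)) (lcarrier (double Q)) (\<lambda>x. lbracket (double Q) x y)"
    and br_self_ball: "\<forall>x\<in>lcarrier (double Q). lbracket (double Q) x x = 0"
    and K_linear: "\<forall>x\<in>lcarrier (double Q).
      linear_on (lscale (double Q)) (*) (lcarrier (double Q)) (pairing Q x)"
    and K_sym_ball: "\<forall>x\<in>lcarrier (double Q). \<forall>y\<in>lcarrier (double Q). pairing Q x y = pairing Q y x"
    and K_nondeg_ball: "\<forall>x\<in>lcarrier (double Q).
      (\<forall>y\<in>lcarrier (double Q). pairing Q x y = 0) \<longrightarrow> x = 0"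
    and K_inv_ball: "\<forall>x\<in>lcarrier (double Q). \<forall>y\<in>lcarrier (double Q). \<forall>z\<in>lcarrier (double Q).
      pairing Q (lbracket (double Q) x y) z + pairing Q y (lbracket (double Q) x z) = 0"
    and subalg_A: "lie_subalgebra (double Q) (part_a Q)"
    and subalg_B: "lie_subalgebra (double Q) (part_b Q)"
    and subalg_C: "lie_subalgebra (double Q) (part_c Q)"
    and bij: "bij_betw (\<lambda>(x, y, z). x + y + z) (part_a Q \<times> part_b Q \<times> part_c Q) (lcarrier (double Q))"
    and orth_A: "orth Q (part_a Q) = {x + y | x y. x \<in> part_a Q \<and> y \<in> part_b Q}"
    and orth_C: "orth Q (part_c Q) = {x + y | x y. x \<in> part_b Q \<and> y \<in> part_c Q}"
begin

abbreviation "s \<equiv> lscale (double Q)"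
abbreviation "D \<equiv> lcarrier (double Q)"
abbreviation "br \<equiv> lbracket (double Q)"
abbreviation "K \<equiv> pairing Q"
abbreviation "A \<equiv> part_a Q"
abbreviation "B \<equiv> part_b Q"
abbreviation "C \<equiv> part_c Q"

end

definition jac :: "('k, 'd) quadruple \<Rightarrow> 'd \<Rightarrow> 'd \<Rightarrow> 'd \<Rightarrow> 'd::ab_group_add" where
  "jac Q x y z = lbracket (double Q) x (lbracket (double Q) y z)
    + lbracket (double Q) y (lbracket (double Q) z x) + lbracket (double Q) z (lbracket (double Q) x y)"

lemma manin_quadruple_iff:
  "manin_quadruple Q \<longleftrightarrow> quad Q \<and>
     (\<forall>x\<in>lcarrier (double Q). \<forall>y\<in>lcarrier (double Q). \<forall>z\<in>lcarrier (double Q). jac Q x y z = 0)"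
  unfolding manin_quadruple_def Let_def lie_algebra_def quad_def jac_def
  by (intro iffI; elim conjE; intro conjI; assumption)

context quad
begin

sublocale V: vector_space s by (rule vs)

lemma br_closed: "x \<in> D \<Longrightarrow> y \<in> D \<Longrightarrow> br x y \<in> D"
  and br_self: "x \<in> D \<Longrightarrow> br x x = 0"
  and K_sym: "x \<in> D \<Longrightarrow> y \<in> D \<Longrightarrow> K x y = K y x"
  and K_nondeg: "x \<in> D \<Longrightarrow> (\<And>y. y \<in> D \<Longrightarrow> K x y = 0) \<Longrightarrow> x = 0"
  and K_inv: "x \<in> D \<Longrightarrow> y \<in> D \<Longrightarrow> z \<in> D \<Longrightarrow> K (br x y) z + K y (br x z) = 0"
  using br_closed_ball br_self_ball K_sym_ball K_nondeg_ball K_inv_ball by blast+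

lemma sub_A: "V.subspace A" and sub_B: "V.subspace B" and sub_C: "V.subspace C"
  using subalg_A subalg_B subalg_C by (auto simp: lie_subalgebra_def)

lemma A_D: "x \<in> A \<Longrightarrow> x \<in> D" and B_D: "x \<in> B \<Longrightarrow> x \<in> D" and C_D: "x \<in> C \<Longrightarrow> x \<in> D"
  using subalg_A subalg_B subalg_C by (auto simp: lie_subalgebra_def)

lemma br_AA: "x \<in> A \<Longrightarrow> y \<in> A \<Longrightarrow> br x y \<in> A"
  and br_BB: "x \<in> B \<Longrightarrow> y \<in> B \<Longrightarrow> br x y \<in> B"
  and br_CC: "x \<in> C \<Longrightarrow> y \<in> C \<Longrightarrow> br x y \<in> C"
  using subalg_A subalg_B subalg_C by (auto simp: lie_subalgebra_def)

lemmas mem = A_D B_D C_D br_AA br_BB br_CC br_closed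
  V.subspace_0[OF sub_D] V.subspace_add[OF sub_D] V.subspace_neg[OF sub_D] V.subspace_diff[OF sub_D] V.subspace_scale[OF sub_D]
  V.subspace_0[OF sub_A] V.subspace_add[OF sub_A] V.subspace_neg[OF sub_A] V.subspace_diff[OF sub_A] V.subspace_scale[OF sub_A]
  V.subspace_0[OF sub_B] V.subspace_add[OF sub_B] V.subspace_neg[OF sub_B] V.subspace_diff[OF sub_B] V.subspace_scale[OF sub_B]
  V.subspace_0[OF sub_C] V.subspace_add[OF sub_C] V.subspace_neg[OF sub_C] V.subspace_diff[OF sub_C] V.subspace_scale[OF sub_C]

lemma br_add_right: "x \<in> D \<Longrightarrow> y \<in> D \<Longrightarrow> z \<in> D \<Longrightarrow> br x (y + z) = br x y + br x z"
  and br_add_left: "x \<in> D \<Longrightarrow> y \<in> D \<Longrightarrow> z \<in> D \<Longrightarrow> br (y + z) x = br y x + br z x"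
  and br_scale_right: "x \<in> D \<Longrightarrow> y \<in> D \<Longrightarrow> br x (s c y) = s c (br x y)"
  and br_scale_left: "x \<in> D \<Longrightarrow> y \<in> D \<Longrightarrow> br (s c y) x = s c (br y x)"
  using br_linear_left br_linear_right by (auto simp: linear_on_def)

lemma br_0_right: "x \<in> D \<Longrightarrow> br x 0 = 0" and br_0_left: "x \<in> D \<Longrightarrow> br 0 x = 0"
  using br_scale_right[of x 0 0] br_scale_left[of x 0 0] mem by auto

lemma br_neg_right: "x \<in> D \<Longrightarrow> y \<in> D \<Longrightarrow> br x (- y) = - br x y"
  and br_neg_left: "x \<in> D \<Longrightarrow> y \<in> D \<Longrightarrow> br (- y) x = - br y x"
  using br_scale_right[of x y "-1"] br_scale_left[of x y "-1"] by auto

lemma br_diff_right: "x \<in> D \<Longrightarrow> y \<in> D \<Longrightarrow> z \<in> D \<Longrightarrow> br x (y - z) = br x y - br x z"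
  and br_diff_left: "x \<in> D \<Longrightarrow> y \<in> D \<Longrightarrow> z \<in> D \<Longrightarrow> br (y - z) x = br y x - br z x"
  using br_add_right[of x y "- z"] br_add_left[of x y "- z"] by (auto simp: mem br_neg_right br_neg_left)

lemma br_anti:
  assumes "x \<in> D" "y \<in> D"
  shows "br x y = - br y x"
proof -
  have "br (x + y) (x + y) = 0"
    using assms by (intro br_self) (simp add: mem)
  moreover have "br (x + y) (x + y) = br x x + br y x + (br x y + br y y)"
    using assms by (simp add: br_add_right br_add_left mem)
  ultimately show ?thesis
    using assms by (simp add: br_self eq_neg_iff_add_eq_0 add.commute)
qed

lemma K_add_right: "x \<in> D \<Longrightarrow> y \<in> D \<Longrightarrow> z \<in> D \<Longrightarrow> K x (y + z) = K x y + K x z"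
  and K_scale_right: "x \<in> D \<Longrightarrow> y \<in> D \<Longrightarrow> K x (s c y) = c * K x y"
  using K_linear by (auto simp: linear_on_def)

lemma K_add_left: "x \<in> D \<Longrightarrow> y \<in> D \<Longrightarrow> z \<in> D \<Longrightarrow> K (y + z) x = K y x + K z x"
  and K_scale_left: "x \<in> D \<Longrightarrow> y \<in> D \<Longrightarrow> K (s c y) x = c * K y x"
  using K_add_right K_scale_right K_sym by (simp_all add: mem)

lemma K_0_right: "x \<in> D \<Longrightarrow> K x 0 = 0" and K_0_left: "x \<in> D \<Longrightarrow> K 0 x = 0"
  using K_scale_right[of x 0 0] K_scale_left[of x 0 0] mem by auto

lemma K_neg_right: "x \<in> D \<Longrightarrow> y \<in> D \<Longrightarrow> K x (- y) = - K x y"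
  and K_neg_left: "x \<in> D \<Longrightarrow> y \<in> D \<Longrightarrow> K (- y) x = - K y x"
  using K_scale_right[of x y "-1"] K_scale_left[of x y "-1"] by auto

lemma K_diff_right: "x \<in> D \<Longrightarrow> y \<in> D \<Longrightarrow> z \<in> D \<Longrightarrow> K x (y - z) = K x y - K x z"
  and K_diff_left: "x \<in> D \<Longrightarrow> y \<in> D \<Longrightarrow> z \<in> D \<Longrightarrow> K (y - z) x = K y x - K z x"
  using K_add_right[of x y "- z"] K_add_left[of x y "- z"] by (auto simp: mem K_neg_right K_neg_left)

lemmas lin = br_add_right br_add_left br_scale_right br_scale_left br_0_right br_0_left
  br_neg_right br_neg_left br_diff_right br_diff_left
  K_add_right K_add_left K_scale_right K_scale_left K_0_right K_0_left
  K_neg_right K_neg_left K_diff_right K_diff_left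

lemma K_br: "x \<in> D \<Longrightarrow> y \<in> D \<Longrightarrow> z \<in> D \<Longrightarrow> K (br x y) z = K x (br y z)"
  using K_inv[of y x z] br_anti[of x y] by (simp add: lin mem add_eq_0_iff2)

lemma K_br_swap: "x \<in> D \<Longrightarrow> y \<in> D \<Longrightarrow> z \<in> D \<Longrightarrow> K (br x y) z = - K y (br x z)"
  using K_inv[of x y z] by (simp add: add_eq_0_iff2)

section \<open>Components, orthogonality and the inclusions between brackets\<close>

lemma decomp:
  assumes "x \<in> D"
  obtains a b c where "a \<in> A" "b \<in> B" "c \<in> C" "x = a + b + c"
  using assms bij unfolding bij_betw_def by fastforce

lemma K_AA: "x \<in> A \<Longrightarrow> y \<in> A \<Longrightarrow> K x y = 0"
  and K_BA: "x \<in> B \<Longrightarrow> y \<in> A \<Longrightarrow> K x y = 0"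
proof -
  assume "x \<in> A" "y \<in> A"
  then have "x \<in> orth Q A"
    unfolding orth_A using V.subspace_0[OF sub_B] by force
  then show "K x y = 0" using \<open>y \<in> A\<close> by (auto simp: orth_def)
next
  assume "x \<in> B" "y \<in> A"
  then have "x \<in> orth Q A"
    unfolding orth_A using V.subspace_0[OF sub_A] by force
  then show "K x y = 0" using \<open>y \<in> A\<close> by (auto simp: orth_def)
qed

lemma K_CC: "x \<in> C \<Longrightarrow> y \<in> C \<Longrightarrow> K x y = 0"
  and K_BC: "x \<in> B \<Longrightarrow> y \<in> C \<Longrightarrow> K x y = 0"
proof -
  assume "x \<in> C" "y \<in> C"
  then have "x \<in> orth Q C"
    unfolding orth_C using V.subspace_0[OF sub_B] by force
  then show "K x y = 0" using \<open>y \<in> C\<close> by (auto simp: orth_def)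
next
  assume "x \<in> B" "y \<in> C"
  then have "x \<in> orth Q C"
    unfolding orth_C using V.subspace_0[OF sub_C] by force
  then show "K x y = 0" using \<open>y \<in> C\<close> by (auto simp: orth_def)
qed

lemma K_AB: "x \<in> A \<Longrightarrow> y \<in> B \<Longrightarrow> K x y = 0" and K_CB: "x \<in> C \<Longrightarrow> y \<in> B \<Longrightarrow> K x y = 0"
  using K_sym[of x y] by (auto simp: K_BA K_BC mem)

lemmas isotropy = K_AA K_BA K_AB K_CC K_BC K_CB

text \<open>Orthogonality removes the pairings of A with A and with B, so the non-degeneracy of K on
  D is felt by A through C alone. In the same way B is tested by B, and C by A.\<close>

lemma nondeg_A:
  assumes "x \<in> A" "\<And>z. z \<in> C \<Longrightarrow> K x z = 0"
  shows "x = 0"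
proof (rule K_nondeg)
  fix y assume "y \<in> D"
  then obtain a b c where "a \<in> A" "b \<in> B" "c \<in> C" "y = a + b + c" by (rule decomp)
  then show "K x y = 0"
    using assms by (simp add: lin mem isotropy)
qed (use assms mem in auto)

lemma nondeg_B:
  assumes "x \<in> B" "\<And>z. z \<in> B \<Longrightarrow> K x z = 0"
  shows "x = 0"
proof (rule K_nondeg)
  fix y assume "y \<in> D"
  then obtain a b c where "a \<in> A" "b \<in> B" "c \<in> C" "y = a + b + c" by (rule decomp)
  then show "K x y = 0"
    using assms by (simp add: lin mem isotropy)
qed (use assms mem in auto)

lemma nondeg_C:
  assumes "x \<in> C" "\<And>z. z \<in> A \<Longrightarrow> K x z = 0"
  shows "x = 0"
proof (rule K_nondeg)
  fix y assume "y \<in> D"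
  then obtain a b c where "a \<in> A" "b \<in> B" "c \<in> C" "y = a + b + c" by (rule decomp)
  then show "K x y = 0"
    using assms by (simp add: lin mem isotropy)
qed (use assms mem in auto)

text \<open>Testing against A detects the C-component and testing against B detects the B-component;
  both must vanish.\<close>

lemma in_AI:
  assumes "x \<in> D" "\<And>y. y \<in> A \<Longrightarrow> K x y = 0" "\<And>y. y \<in> B \<Longrightarrow> K x y = 0"
  shows "x \<in> A"
proof -
  obtain a b c where x: "a \<in> A" "b \<in> B" "c \<in> C" "x = a + b + c"
    using assms(1) by (rule decomp)
  have "K c y = 0" if "y \<in> A" for y
    using assms(2)[OF that] that x by (simp add: lin mem isotropy)
  moreover have "K b y = 0" if "y \<in> B" for y
    using assms(3)[OF that] that x by (simp add: lin mem isotropy)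
  ultimately have "b = 0" "c = 0"
    using nondeg_B nondeg_C x by auto
  then show ?thesis using x by simp
qed

lemma in_CI:
  assumes "x \<in> D" "\<And>y. y \<in> C \<Longrightarrow> K x y = 0" "\<And>y. y \<in> B \<Longrightarrow> K x y = 0"
  shows "x \<in> C"
proof -
  obtain a b c where x: "a \<in> A" "b \<in> B" "c \<in> C" "x = a + b + c"
    using assms(1) by (rule decomp)
  have "K a y = 0" if "y \<in> C" for y
    using assms(2)[OF that] that x by (simp add: lin mem isotropy)
  moreover have "K b y = 0" if "y \<in> B" for y
    using assms(3)[OF that] that x by (simp add: lin mem isotropy)
  ultimately have "b = 0" "a = 0"
    using nondeg_B nondeg_A x by auto
  then show ?thesis using x by simp
qed

text \<open>This makes \<open>br\<close> an action of \<gg> on \<hh>. Invariance moves the bracket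
  to K(x, [y, z]) with [y, z] in A, or to -K(y, [x, z]) with [x, z] in B, and both vanish by
  orthogonality.\<close>

lemma br_BA: "x \<in> B \<Longrightarrow> y \<in> A \<Longrightarrow> br x y \<in> A"
proof (rule in_AI)
  fix z assume "x \<in> B" "y \<in> A" "z \<in> A" then show "K (br x y) z = 0"
    by (simp add: K_br mem isotropy)
next
  fix z assume "x \<in> B" "y \<in> A" "z \<in> B" then show "K (br x y) z = 0"
    by (simp add: K_br_swap mem isotropy)
qed (auto simp: mem)

lemma br_AB: "x \<in> A \<Longrightarrow> y \<in> B \<Longrightarrow> br x y \<in> A"
  using br_BA[of y x] br_anti[of x y] by (simp add: mem)

lemma br_BC: "x \<in> B \<Longrightarrow> y \<in> C \<Longrightarrow> br x y \<in> C"
proof (rule in_CI)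
  fix z assume "x \<in> B" "y \<in> C" "z \<in> C" then show "K (br x y) z = 0"
    by (simp add: K_br mem isotropy)
next
  fix z assume "x \<in> B" "y \<in> C" "z \<in> B" then show "K (br x y) z = 0"
    by (simp add: K_br_swap mem isotropy)
qed (auto simp: mem)

lemma br_CB: "x \<in> C \<Longrightarrow> y \<in> B \<Longrightarrow> br x y \<in> C"
  using br_BC[of y x] br_anti[of x y] by (simp add: mem)

lemmas mixed = br_BA br_AB br_BC br_CB

lemma additive_vanish:
  fixes f :: "'d \<Rightarrow> 'c::ab_group_add"
  assumes "\<And>x y. x \<in> D \<Longrightarrow> y \<in> D \<Longrightarrow> f (x + y) = f x + f y"
    "\<And>x. x \<in> A \<Longrightarrow> f x = 0" "\<And>x. x \<in> B \<Longrightarrow> f x = 0" "\<And>x. x \<in> C \<Longrightarrow> f x = 0" "x \<in> D"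
  shows "f x = 0"
proof -
  obtain a b c where x: "a \<in> A" "b \<in> B" "c \<in> C" "x = a + b + c"
    using assms(5) by (rule decomp)
  then have "f x = f a + f b + f c"
    by (simp add: assms(1) mem)
  then show ?thesis
    using assms(2-4) x by simp
qed

section \<open>The Jacobiator as a form in four arguments\<close>

lemma jac_closed: "x \<in> D \<Longrightarrow> y \<in> D \<Longrightarrow> z \<in> D \<Longrightarrow> jac Q x y z \<in> D"
  by (simp add: jac_def mem)

text \<open>The form \<open>K (jac Q x y z) w\<close> alternates in all four arguments, so that the Jacobi identity need
  only be tested on the 15 types of unordered quadruples of pure elements.\<close>

definition jac_vanish :: "'d set \<Rightarrow> 'd set \<Rightarrow> 'd set \<Rightarrow> 'd set \<Rightarrow> bool" where
  "jac_vanish P R S T \<longleftrightarrow> (\<forall>x\<in>P \<inter> D. \<forall>y\<in>R \<inter> D. \<forall>z\<in>S \<inter> D. \<forall>w\<in>T \<inter> D. K (jac Q x y z) w = 0)"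

text \<open>Invariance moves one outer bracket across the pairing. What remains is a sum over the
  three ways to split the four arguments into two pairs, and in it the skewness in z and w becomes
  visible.\<close>

lemma K_jac:
  assumes "x \<in> D" "y \<in> D" "z \<in> D" "w \<in> D"
  shows "K (jac Q x y z) w = - (K (br x y) (br z w) + K (br y z) (br x w) + K (br z x) (br y w))"
  using assms by (simp add: jac_def lin mem K_br_swap[of x "br y z"] K_br_swap[of y "br z x"] K_br_swap[of z "br x y"])

lemma jac_swap12: "x \<in> D \<Longrightarrow> y \<in> D \<Longrightarrow> z \<in> D \<Longrightarrow> jac Q y x z = - jac Q x y z"
  using br_anti[of y x] br_anti[of x z] br_anti[of z y]
  by (simp add: jac_def lin mem algebra_simps)

lemma jac_swap23: "x \<in> D \<Longrightarrow> y \<in> D \<Longrightarrow> z \<in> D \<Longrightarrow> jac Q x z y = - jac Q x y z"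
  using br_anti[of y x] br_anti[of x z] br_anti[of z y]
  by (simp add: jac_def lin mem algebra_simps)

lemma K_jac_swap34:
  assumes "x \<in> D" "y \<in> D" "z \<in> D" "w \<in> D"
  shows "K (jac Q x y w) z = - K (jac Q x y z) w"
  using assms br_anti[of w z] br_anti[of w x] br_anti[of z x] K_sym[of "br y w" "br x z"] K_sym[of "br x w" "br y z"]
  by (simp add: K_jac lin mem)

lemma jac_vanish_swap12: "jac_vanish P R S T = jac_vanish R P S T"
proof -
  have "jac_vanish R P S T" if "jac_vanish P R S T" for P R
    unfolding jac_vanish_def
  proof (intro ballI)
    fix x y z w assume m: "x \<in> R \<inter> D" "y \<in> P \<inter> D" "z \<in> S \<inter> D" "w \<in> T \<inter> D"
    then have "K (jac Q y x z) w = 0"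
      using that by (auto simp: jac_vanish_def)
    then show "K (jac Q x y z) w = 0"
      using m jac_swap12[of y x z] by (simp add: lin mem jac_closed)
  qed
  then show ?thesis by blast
qed

lemma jac_vanish_swap23: "jac_vanish P R S T = jac_vanish P S R T"
proof -
  have "jac_vanish P S R T" if "jac_vanish P R S T" for R S
    unfolding jac_vanish_def
  proof (intro ballI)
    fix x y z w assume m: "x \<in> P \<inter> D" "y \<in> S \<inter> D" "z \<in> R \<inter> D" "w \<in> T \<inter> D"
    then have "K (jac Q x z y) w = 0"
      using that by (auto simp: jac_vanish_def)
    then show "K (jac Q x y z) w = 0"
      using m jac_swap23[of x z y] by (simp add: lin mem jac_closed)
  qed
  then show ?thesis by blast
qed

lemma jac_vanish_swap34: "jac_vanish P R S T = jac_vanish P R T S"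
proof -
  have "jac_vanish P R T S" if "jac_vanish P R S T" for S T
    unfolding jac_vanish_def
  proof (intro ballI)
    fix x y z w assume m: "x \<in> P \<inter> D" "y \<in> R \<inter> D" "z \<in> T \<inter> D" "w \<in> S \<inter> D"
    then have "K (jac Q x y w) z = 0"
      using that by (auto simp: jac_vanish_def)
    then show "K (jac Q x y z) w = 0"
      using m K_jac_swap34[of x y w z] by simp
  qed
  then show ?thesis by blast
qed

lemmas jac_vanish_perm = jac_vanish_swap12 jac_vanish_swap23 jac_vanish_swap34

lemma jac_vanish_D4:
  assumes "jac_vanish P R S A" "jac_vanish P R S B" "jac_vanish P R S C"
  shows "jac_vanish P R S D"
  unfolding jac_vanish_def
proof (intro ballI)
  fix x y z w assume m: "x \<in> P \<inter> D" "y \<in> R \<inter> D" "z \<in> S \<inter> D" "w \<in> D \<inter> D"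
  show "K (jac Q x y z) w = 0"
    by (rule additive_vanish) (use m assms in \<open>auto simp: jac_vanish_def lin mem jac_closed\<close>)
qed

lemma jac_vanish_D3:
  "jac_vanish P R A S \<Longrightarrow> jac_vanish P R B S \<Longrightarrow> jac_vanish P R C S \<Longrightarrow> jac_vanish P R D S"
  using jac_vanish_D4[of P R S] jac_vanish_swap34[of P R S A] jac_vanish_swap34[of P R S B] jac_vanish_swap34[of P R S C] jac_vanish_swap34[of P R S D] by simp

lemma jac_vanish_D2:
  "jac_vanish P A R S \<Longrightarrow> jac_vanish P B R S \<Longrightarrow> jac_vanish P C R S \<Longrightarrow> jac_vanish P D R S"
  using jac_vanish_D3[of P R S] jac_vanish_swap23[of P R A S] jac_vanish_swap23[of P R B S] jac_vanish_swap23[of P R C S] jac_vanish_swap23[of P R D S] by simp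

lemma jac_vanish_D1:
  "jac_vanish A P R S \<Longrightarrow> jac_vanish B P R S \<Longrightarrow> jac_vanish C P R S \<Longrightarrow> jac_vanish D P R S"
  using jac_vanish_D2[of P R S] jac_vanish_swap12[of P A R S] jac_vanish_swap12[of P B R S] jac_vanish_swap12[of P C R S] jac_vanish_swap12[of P D R S] by simp

text \<open>By \<open>K_jac\<close> these types involve only pairings of A with A or B, or of C with
  C or B. They are eight of the 15; the other seven are the hypotheses of
  \<open>jacobi_from_types\<close>.\<close>

lemma jac_vanish_trivial:
  "jac_vanish A A A A" "jac_vanish A A A B" "jac_vanish A A B B" "jac_vanish A B B B"
  "jac_vanish B B B C" "jac_vanish B B C C" "jac_vanish B C C C" "jac_vanish C C C C"
  by (auto simp: jac_vanish_def K_jac mem mixed isotropy)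

theorem jacobi_from_types:
  assumes "jac_vanish A A A C" "jac_vanish A A B C" "jac_vanish A B B C" "jac_vanish A B C C"
    "jac_vanish A C C C" "jac_vanish B B B B" "jac_vanish A A C C"
  assumes "x \<in> D" "y \<in> D" "z \<in> D"
  shows "jac Q x y z = 0"
proof (rule K_nondeg)
  \<comment> \<open>Splitting every D leaves 81 goals. The transpositions act as ordered rewrite
    rules that sort the four types, which brings each goal to one of the 15 cases.\<close>
  have "jac_vanish D D D D"
    by (intro jac_vanish_D1 jac_vanish_D2 jac_vanish_D3 jac_vanish_D4;
        insert assms(1-7) jac_vanish_trivial; simp add: jac_vanish_perm)
  then show "K (jac Q x y z) w = 0" if "w \<in> D" for w
    using that assms by (simp add: jac_vanish_def)
qed (use assms jac_closed in auto)

lemma K_decomp: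
  assumes "a \<in> A" "b \<in> B" "c \<in> C" "a' \<in> A" "b' \<in> B" "c' \<in> C"
  shows "K (a + b + c) (a' + b' + c') = K a c' + K b b' + K c a'"
  using assms by (simp add: lin mem isotropy)

text \<open>The Jacobi identity on \<open>\<hh> \<times> \<hh> \<times> \<hh>\<^sup>* \<times> \<hh>\<^sup>*\<close> is the compatibility condition between bracket and
  cobracket; its \<open>\<gg>\<close>-components contribute the term in \<open>t\<close>.\<close>

lemma K_jac_AACC:
  assumes "X \<in> A" "Y \<in> A" "P \<in> C" "R \<in> C"
    and 1: "a1 \<in> A" "b1 \<in> B" "c1 \<in> C" "br P X = a1 + b1 + c1"
    and 2: "a2 \<in> A" "b2 \<in> B" "c2 \<in> C" "br P Y = a2 + b2 + c2"
    and 3: "a3 \<in> A" "b3 \<in> B" "c3 \<in> C" "br R X = a3 + b3 + c3"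
    and 4: "a4 \<in> A" "b4 \<in> B" "c4 \<in> C" "br R Y = a4 + b4 + c4"
  shows "- K (jac Q X Y P) R = K Y (br R c1) + K Y (br c3 P) - K X (br R c2) - K X (br c4 P)
    - K (br X Y) (br R P) - (K b1 b4 - K b2 b3)"
proof -
  have "- K (jac Q X Y P) R = K (br P Y) (br R X) - K (br P X) (br R Y) - K (br X Y) (br R P)"
    using assms(1-4) br_anti[of Y P] br_anti[of X R] br_anti[of Y R] br_anti[of P R]
    by (simp add: K_jac lin mem del: 1 2 3 4)
  moreover have "K (br P Y) (br R X) = K a2 c3 + K b2 b3 + K c2 a3"
    unfolding 2(4) 3(4) using 2 3 by (intro K_decomp)
  moreover have "K (br P X) (br R Y) = K a1 c4 + K b1 b4 + K c1 a4"
    unfolding 1(4) 4(4) using 1 4 by (intro K_decomp)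
  \<comment> \<open>The products of an A-component with a C-component are traded for brackets inside
    C, the form in which the cobracket of X and Y produces them. Only the products of B-components
    stay as they are.\<close>
  moreover have "K Y (br c3 P) = K a2 c3"
  proof -
    have "K Y (br c3 P) = K c3 (br P Y)"
      using assms(1-4) 3 K_sym[of Y "br c3 P"] by (simp add: K_br mem)
    also have "\<dots> = K a2 c3"
      unfolding 2(4) using 2 3 K_sym[of c3 a2] by (simp add: lin mem isotropy)
    finally show ?thesis .
  qed
  moreover have "K X (br c4 P) = K a1 c4"
  proof -
    have "K X (br c4 P) = K c4 (br P X)"
      using assms(1-4) 4 K_sym[of X "br c4 P"] by (simp add: K_br mem)
    also have "\<dots> = K a1 c4"
      unfolding 1(4) using 1 4 K_sym[of c4 a1] by (simp add: lin mem isotropy)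
    finally show ?thesis .
  qed
  moreover have "K X (br R c2) = - K c2 a3"
  proof -
    have "K X (br R c2) = - K c2 (br R X)"
      using assms(1-4) 2 K_sym[of X "br R c2"] by (simp add: K_br_swap mem)
    also have "\<dots> = - K c2 a3"
      unfolding 3(4) using 2 3 by (simp add: lin mem isotropy)
    finally show ?thesis .
  qed
  moreover have "K Y (br R c1) = - K c1 a4"
  proof -
    have "K Y (br R c1) = - K c1 (br R Y)"
      using assms(1-4) 1 K_sym[of Y "br R c1"] by (simp add: K_br_swap mem)
    also have "\<dots> = - K c1 a4"
      unfolding 4(4) using 1 4 by (simp add: lin mem isotropy)
    finally show ?thesis .
  qed
  ultimately show ?thesis
    by simp
qed

end

section \<open>The quasi-bialgebra of a Manin quadruple\<close>

lemma alg_of_simps [simp]: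
  "lscale (alg_of Q) = lscale (double Q)" "lcarrier (alg_of Q) = part_a Q"
  "lbracket (alg_of Q) = lbracket (double Q)"
  by (simp_all add: alg_of_def)

lemma base_of_simps [simp]:
  "lscale (base_of Q) = lscale (double Q)" "lcarrier (base_of Q) = part_b Q"
  "lbracket (base_of Q) = lbracket (double Q)"
  by (simp_all add: base_of_def)

context quad
begin

lemma finite_span_subspace:
  assumes "V.subspace P" "P \<subseteq> D"
  shows "\<exists>E. finite E \<and> P = V.span E"
  using fin_D V.subspace_finite_span[OF assms(1)] assms(2) unfolding finite_dim_def by metis

sublocale H: fd_struct "alg_of Q"
  using finite_span_subspace[OF sub_A] vs sub_A A_D
  by unfold_locales (auto simp: finite_dim_def V.scale_right_distrib V.scale_left_distrib)

sublocale G: fd_struct "base_of Q"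
  using finite_span_subspace[OF sub_B] vs sub_B B_D
  by unfold_locales (auto simp: finite_dim_def V.scale_right_distrib V.scale_left_distrib)

section \<open>Functionals represented by elements of the quadruple\<close>

abbreviation "fn \<equiv> functional_of Q"
abbreviation "fb \<equiv> flat (base_of Q) K"
abbreviation "t \<equiv> inverse_form (base_of Q) K"
abbreviation "\<delta> \<equiv> induced_cobr Q"

lemma fn_apply: "X \<in> A \<Longrightarrow> fn P X = K P X" and fn_outside: "X \<notin> A \<Longrightarrow> fn P X = 0"
  by (auto simp: functional_of_def flat_def)

lemma fb_apply: "v \<in> B \<Longrightarrow> fb u v = K u v" and fb_outside: "v \<notin> B \<Longrightarrow> fb u v = 0"
  by (auto simp: flat_def)

lemma bij_fn: "bij_betw fn C (dual (alg_of Q))"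
  unfolding functional_of_def
proof (rule H.bij_betw_flat[OF _ V.module_axioms])
  show "x = 0" if "x \<in> lcarrier (alg_of Q)" "\<And>w. w \<in> C \<Longrightarrow> K w x = 0" for x
    using that nondeg_A[of x] K_sym[of x] mem by auto
qed (use sub_C nondeg_C in \<open>auto simp: linear_on_def lin mem\<close>)

lemma bij_fb: "bij_betw fb B (dual (base_of Q))"
proof (rule G.bij_betw_flat[OF _ V.module_axioms])
  show "x = 0" if "x \<in> lcarrier (base_of Q)" "\<And>w. w \<in> B \<Longrightarrow> K w x = 0" for x
    using that nondeg_B[of x] K_sym[of x] mem by auto
qed (use sub_B nondeg_B in \<open>auto simp: linear_on_def lin mem\<close>)

lemma fn_dual: "P \<in> C \<Longrightarrow> fn P \<in> dual (alg_of Q)"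
  and fb_dual: "u \<in> B \<Longrightarrow> fb u \<in> dual (base_of Q)"
  using bij_fn bij_fb by (auto simp: bij_betw_def)

lemma dual_fn: "\<alpha> \<in> dual (alg_of Q) \<Longrightarrow> (\<And>P. P \<in> C \<Longrightarrow> \<alpha> = fn P \<Longrightarrow> thesis) \<Longrightarrow> thesis"
  using bij_betw_imp_surj_on[OF bij_fn] by blast

lemma dual_fb: "\<beta> \<in> dual (base_of Q) \<Longrightarrow> (\<And>u. u \<in> B \<Longrightarrow> \<beta> = fb u \<Longrightarrow> thesis) \<Longrightarrow> thesis"
  using bij_betw_imp_surj_on[OF bij_fb] by blast

lemma fb_inj: "u \<in> B \<Longrightarrow> v \<in> B \<Longrightarrow> fb u = fb v \<Longrightarrow> u = v"
  using bij_fb by (auto simp: bij_betw_def inj_on_def)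

lemma element_of_fn: "P \<in> C \<Longrightarrow> element_of Q (fn P) = P"
  unfolding element_of_def using bij_fn by (intro the_inv_into_f_f) (auto simp: bij_betw_def)

lemma cobr_fn: "P \<in> C \<Longrightarrow> R \<in> C \<Longrightarrow> \<delta> X (fn P) (fn R) = K X (br R P)"
  by (simp add: induced_cobr_def fn_dual element_of_fn)

lemma cobr_outside: "\<alpha> \<notin> dual (alg_of Q) \<or> \<beta> \<notin> dual (alg_of Q) \<Longrightarrow> \<delta> X \<alpha> \<beta> = 0"
  by (auto simp: induced_cobr_def)

lemma form_fb:
  assumes "u \<in> B" "\<alpha> \<in> dual (base_of Q)"
  shows "t \<alpha> (fb u) = \<alpha> u" "t (fb u) \<alpha> = \<alpha> u"
proof -
  have inv: "the_inv_into B fb (fb v) = v" if "v \<in> B" for v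
    using that bij_fb by (intro the_inv_into_f_f) (auto simp: bij_betw_def)
  show "t \<alpha> (fb u) = \<alpha> u"
    using assms by (simp add: inverse_form_def fb_dual inv)
  obtain v where "v \<in> B" "\<alpha> = fb v"
    using assms(2) by (rule dual_fb)
  then show "t (fb u) \<alpha> = \<alpha> u"
    using assms K_sym[of u v] by (simp add: inverse_form_def fb_dual inv fb_apply mem)
qed

lemma form_outside: "\<alpha> \<notin> dual (base_of Q) \<or> \<beta> \<notin> dual (base_of Q) \<Longrightarrow> t \<alpha> \<beta> = 0"
  by (auto simp: inverse_form_def)

text \<open>K(P, [X, Y]) = K([P, X], Y), and for Y in A this sees only the C-component of
  [P, X].\<close>

lemma pullback_fn:
  assumes "P \<in> C" "X \<in> D" "c \<in> C" "a \<in> A" "b \<in> B" "br P X = a + b + c" "\<And>Y. Y \<in> A \<Longrightarrow> br X Y \<in> A"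
  shows "pullback (alg_of Q) (br X) (fn P) = fn c"
proof
  fix Y show "pullback (alg_of Q) (br X) (fn P) Y = fn c Y"
  proof (cases "Y \<in> A")
    case True
    have "K P (br X Y) = K (a + b + c) Y"
      using True assms by (simp add: K_br mem flip: assms(6))
    then show ?thesis
      using True assms by (simp add: pullback_def fn_apply lin mem isotropy)
  qed (simp add: pullback_def fn_outside)
qed

lemma pullback_fn_base: "P \<in> C \<Longrightarrow> v \<in> B \<Longrightarrow> pullback (alg_of Q) (br v) (fn P) = fn (br P v)"
  using pullback_fn[of P v "br P v" 0 0] by (simp add: mem mixed)

lemma pullback_fb:
  assumes "u \<in> B" "v \<in> B"
  shows "pullback (base_of Q) (br v) (fb u) = fb (br u v)"
  using assms by (auto simp: pullback_def fun_eq_iff flat_def mem K_br)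

text \<open>K(P, [v, X]) = -K([P, X], v), and for v in B this sees only the B-component of [P, X];
  hence the sign.\<close>

lemma pullback_act:
  assumes "P \<in> C" "X \<in> A" "a \<in> A" "b \<in> B" "c \<in> C" "br P X = a + b + c"
  shows "pullback (base_of Q) (\<lambda>v. br v X) (fn P) = fb (- b)"
proof
  fix v show "pullback (base_of Q) (\<lambda>v. br v X) (fn P) v = fb (- b) v"
  proof (cases "v \<in> B")
    case True
    have "K P (br v X) = - K (a + b + c) v"
      using True assms br_anti[of v X] by (simp add: K_br lin mem flip: assms(6))
    then show ?thesis
      using True assms by (simp add: pullback_def fn_apply fb_apply lin mem isotropy mixed)
  qed (simp add: pullback_def fb_outside)
qed

lemma pullback_act_dual:
  assumes "X \<in> A" "\<alpha> \<in> dual (alg_of Q)"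
  shows "pullback (base_of Q) (\<lambda>v. br v X) \<alpha> \<in> dual (base_of Q)"
proof -
  obtain P where P: "P \<in> C" "\<alpha> = fn P" using assms(2) by (rule dual_fn)
  have "br P X \<in> D" using P assms by (simp add: mem)
  then obtain a b c where "a \<in> A" "b \<in> B" "c \<in> C" "br P X = a + b + c" by (rule decomp)
  then show ?thesis
    using P assms pullback_act fb_dual[of "- b"] by (simp add: mem)
qed

text \<open>The C-components of the four mixed brackets represent the pullbacks in the cobracket
  terms, and the B-components produce the term in \<open>t\<close> through
  \<open>pullback_act\<close>, their signs cancelling in pairs. The rest is
  \<open>K_jac_AACC\<close>.\<close>

lemma compat_eq_jac:
  assumes XY: "X \<in> A" "Y \<in> A" and PR: "P \<in> C" "R \<in> C" and coeffs: "tensor_coeffs (base_of Q) t E c"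
  shows "(tensor_deriv (alg_of Q) (br X) (\<delta> Y) - tensor_deriv (alg_of Q) (br Y) (\<delta> X) - \<delta> (br X Y)
      - (\<Sum>e\<in>E. \<Sum>e'\<in>E. tensor_scale (c e e') (wedge (alg_of Q) (br e X) (br e' Y)))) (fn P) (fn R)
    = - K (jac Q X Y P) R"
proof -
  have D: "br P X \<in> D" "br P Y \<in> D" "br R X \<in> D" "br R Y \<in> D"
    using assms by (auto simp: mem)
  obtain a1 b1 c1 where 1: "a1 \<in> A" "b1 \<in> B" "c1 \<in> C" "br P X = a1 + b1 + c1"
    using D(1) by (rule decomp)
  obtain a2 b2 c2 where 2: "a2 \<in> A" "b2 \<in> B" "c2 \<in> C" "br P Y = a2 + b2 + c2"
    using D(2) by (rule decomp)
  obtain a3 b3 c3 where 3: "a3 \<in> A" "b3 \<in> B" "c3 \<in> C" "br R X = a3 + b3 + c3"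
    using D(3) by (rule decomp)
  obtain a4 b4 c4 where 4: "a4 \<in> A" "b4 \<in> B" "c4 \<in> C" "br R Y = a4 + b4 + c4"
    using D(4) by (rule decomp)
  have pb: "pullback (alg_of Q) (br X) (fn P) = fn c1" "pullback (alg_of Q) (br Y) (fn P) = fn c2"
    "pullback (alg_of Q) (br X) (fn R) = fn c3" "pullback (alg_of Q) (br Y) (fn R) = fn c4"
    using pullback_fn[OF _ _ 1(3,1,2,4)] pullback_fn[OF _ _ 2(3,1,2,4)]
      pullback_fn[OF _ _ 3(3,1,2,4)] pullback_fn[OF _ _ 4(3,1,2,4)] XY PR by (auto simp: mem)
  have pa: "pullback (base_of Q) (\<lambda>v. br v X) (fn P) = fb (- b1)"
    "pullback (base_of Q) (\<lambda>v. br v Y) (fn P) = fb (- b2)"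
    "pullback (base_of Q) (\<lambda>v. br v X) (fn R) = fb (- b3)"
    "pullback (base_of Q) (\<lambda>v. br v Y) (fn R) = fb (- b4)"
    using pullback_act[OF _ _ 1] pullback_act[OF _ _ 2] pullback_act[OF _ _ 3] pullback_act[OF _ _ 4]
      XY PR by auto
  have "(\<Sum>e\<in>E. \<Sum>e'\<in>E. tensor_scale (c e e') (wedge (alg_of Q) (br e X) (br e' Y))) (fn P) (fn R)
      = K b1 b4 - K b2 b3"
    using G.wedge_sum_apply[OF coeffs fn_dual[OF PR(1)] fn_dual[OF PR(2)], of br X Y]
      pullback_act_dual XY 1 2 3 4 K_sym[of b2 b3] K_sym[of b4 b1]
    by (simp add: pa form_fb fb_dual fb_apply lin mem)
  then show ?thesis
    using K_jac_AACC[OF XY PR 1 2 3 4] PR 1(3) 2(3) 3(3) 4(3)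
    by (simp add: H.tensor_deriv_apply fn_dual pb cobr_fn)
qed

lemma fn_add: "P \<in> C \<Longrightarrow> R \<in> C \<Longrightarrow> fn P + fn R = fn (P + R)"
  and fn_scale: "P \<in> C \<Longrightarrow> fun_scale c (fn P) = fn (s c P)"
  and fn_0: "fn 0 = 0"
  by (auto simp: fun_eq_iff functional_of_def flat_def fun_scale_def lin mem)

text \<open>The reversed order on the right shows that the transpose of the cobracket is the
  opposite of the bracket of C.\<close>

lemma transpose_fn:
  assumes "P \<in> C" "R \<in> C"
  shows "lbracket (transpose_struct (alg_of Q) \<delta>) (fn P) (fn R) = fn (br R P)"
proof
  fix X show "lbracket (transpose_struct (alg_of Q) \<delta>) (fn P) (fn R) X = fn (br R P) X"
    using assms K_sym[of X "br R P"]
    by (cases "X \<in> A") (auto simp: transpose_struct_def cobr_fn fn_apply fn_outside mem)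
qed

lemma cobr_ext_square:
  assumes X: "X \<in> A"
  shows "\<delta> X \<in> ext_square (alg_of Q)"
proof (rule H.alternating_ext_square)
  \<comment> \<open>The witness is the A-component of [X, R], because K(X, [R, P]) = K([X, R], P)
    and P in C pairs only with that component.\<close>
  have *: "\<exists>a\<in>A. \<forall>P\<in>C. K X (br R P) = fn P a" if R: "R \<in> C" for R
  proof -
    have "br X R \<in> D" using X R by (simp add: mem)
    then obtain a b c where abc: "a \<in> A" "b \<in> B" "c \<in> C" "br X R = a + b + c" by (rule decomp)
    have "K X (br R P) = fn P a" if "P \<in> C" for P
    proof -
      have "K X (br R P) = K (a + b + c) P"
        using that X R by (simp add: K_br mem flip: abc(4))
      then show ?thesis
        using that abc K_sym[of a P] by (simp add: fn_apply lin mem isotropy)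
    qed
    then show ?thesis using abc(1) by blast
  qed
  show "H.bilinear_tensor (\<delta> X)"
  proof (rule H.bilinear_tensorI)
    fix \<beta> assume "\<beta> \<in> dual (alg_of Q)"
    then obtain R where R: "R \<in> C" "\<beta> = fn R" by (rule dual_fn)
    obtain a where a: "a \<in> A" "\<forall>P\<in>C. K X (br R P) = fn P a"
      using *[OF R(1)] by blast
    have "\<delta> X \<alpha> \<beta> = \<alpha> a" if "\<alpha> \<in> dual (alg_of Q)" for \<alpha>
      using that by (rule dual_fn) (use R a in \<open>auto simp: cobr_fn\<close>)
    then show "\<exists>v\<in>lcarrier (alg_of Q). \<forall>\<alpha>\<in>dual (alg_of Q). \<delta> X \<alpha> \<beta> = \<alpha> v"
      using a by auto
    have "\<delta> X \<beta> \<alpha> = \<alpha> (- a)" if "\<alpha> \<in> dual (alg_of Q)" for \<alpha>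
      using that
    proof (rule dual_fn)
      fix P assume P: "P \<in> C" "\<alpha> = fn P"
      then have "\<alpha> (- a) = - K X (br R P)"
        using a by (simp add: fn_apply lin mem)
      also have "\<dots> = K X (br P R)"
        using br_anti[of P R] P R X by (simp add: lin mem)
      finally show ?thesis
        using P R by (simp add: cobr_fn)
    qed
    then show "\<exists>v\<in>lcarrier (alg_of Q). \<forall>\<alpha>\<in>dual (alg_of Q). \<delta> X \<beta> \<alpha> = \<alpha> v"
      using a mem by (intro bexI[of _ "- a"]) auto
  qed (rule cobr_outside)
next
  fix \<alpha> assume "\<alpha> \<in> dual (alg_of Q)"
  then show "\<delta> X \<alpha> \<alpha> = 0"
    by (rule dual_fn) (use X in \<open>simp add: cobr_fn br_self lin mem\<close>)
qed

lemma form_nondegenerate_invariant: "nondegenerate_invariant (base_of Q) t"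
  unfolding nondegenerate_invariant_def sym_square_def
proof (intro conjI ballI impI CollectI)
  have "G.bilinear_tensor t"
  proof (rule G.bilinear_tensorI)
    fix \<beta> assume "\<beta> \<in> dual (base_of Q)"
    then obtain u where "u \<in> B" "\<beta> = fb u" by (rule dual_fb)
    then show "\<exists>v\<in>lcarrier (base_of Q). \<forall>\<alpha>\<in>dual (base_of Q). t \<alpha> \<beta> = \<alpha> v"
      "\<exists>v\<in>lcarrier (base_of Q). \<forall>\<alpha>\<in>dual (base_of Q). t \<beta> \<alpha> = \<alpha> v"
      by (auto simp: form_fb)
  qed (rule form_outside)
  then show "t \<in> tensor_square (base_of Q)"
    by (rule G.bilinear_tensor_square)
  show "\<forall>\<alpha> \<beta>. t \<alpha> \<beta> = t \<beta> \<alpha>"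
  proof (intro allI)
    fix \<alpha> \<beta> show "t \<alpha> \<beta> = t \<beta> \<alpha>"
    proof (cases "\<alpha> \<in> dual (base_of Q) \<and> \<beta> \<in> dual (base_of Q)")
      case True
      then obtain u where "u \<in> B" "\<alpha> = fb u" using dual_fb by blast
      then show ?thesis using True by (simp add: form_fb)
    next
      case False
      then show ?thesis using form_outside by metis
    qed
  qed
next
  fix v assume "v \<in> lcarrier (base_of Q)"
  then have v: "v \<in> B" by simp
  show "tensor_deriv (base_of Q) (lbracket (base_of Q) v) t = 0"
  proof (intro ext)
    fix \<alpha> \<beta> show "tensor_deriv (base_of Q) (lbracket (base_of Q) v) t \<alpha> \<beta> = 0 \<alpha> \<beta>"
    proof (cases "\<alpha> \<in> dual (base_of Q) \<and> \<beta> \<in> dual (base_of Q)")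
      case True
      then obtain u w where "u \<in> B" "\<alpha> = fb u" "w \<in> B" "\<beta> = fb w" using dual_fb by metis
      \<comment> \<open>On the functionals represented by u and w, invariance of the inverse form is
        the skewness of the adjoint action of v with respect to K.\<close>
      moreover from this have "K (br u v) w = - K (br w v) u"
        using v br_anti[of v w] K_sym[of u "br w v"] by (simp add: K_br[of u] lin mem)
      ultimately show ?thesis
        using True v K_sym[of u "br w v"] by (simp add: G.tensor_deriv_apply pullback_fb form_fb fb_dual fb_apply mem)
    next
      case False
      then show ?thesis by (subst G.tensor_deriv_outside) auto
    qed
  qed
next
  fix \<alpha> assume \<alpha>: "\<alpha> \<in> dual (base_of Q)" "\<forall>\<beta>\<in>dual (base_of Q). t \<alpha> \<beta> = 0"
  then obtain u where u: "u \<in> B" "\<alpha> = fb u" using dual_fb by blast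
  have "K u w = 0" if "w \<in> B" for w
    using \<alpha> fb_dual[OF that] that u form_fb(1)[OF that] by (auto simp: fb_apply)
  then have "u = 0" using nondeg_B u by blast
  then show "\<alpha> = 0" using u by (auto simp: flat_def fun_eq_iff lin mem)
qed

lemma lie_algebra_restrict:
  assumes "V.subspace P" "P \<subseteq> D" "\<And>x y. x \<in> P \<Longrightarrow> y \<in> P \<Longrightarrow> br x y \<in> P"
    "\<And>x y z. x \<in> D \<Longrightarrow> y \<in> D \<Longrightarrow> z \<in> D \<Longrightarrow> jac Q x y z = 0"
  shows "lie_algebra ((double Q)\<lparr>lcarrier := P\<rparr>)"
  using assms vs by (auto simp: lie_algebra_def linear_on_def lin mem br_self jac_def subset_iff)

section \<open>Axioms that depend on the Jacobi identity\<close>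

context
  assumes jacobi: "\<And>x y z. x \<in> D \<Longrightarrow> y \<in> D \<Longrightarrow> z \<in> D \<Longrightarrow> jac Q x y z = 0"
begin

text \<open>This is the form ad [x, y] = [ad x, ad y]. With x and y in \<gg> it is the action
  property; with x in \<gg>, and y and z in \<hh>, it rearranges to the derivation property.\<close>

lemma jacobi_bracket:
  assumes "x \<in> D" "y \<in> D" "z \<in> D"
  shows "br (br x y) z = br x (br y z) - br y (br x z)"
proof -
  have "br z (br x y) = - (br x (br y z) + br y (br z x))"
    using jacobi[OF assms] unfolding jac_def by (simp only: eq_neg_iff_add_eq_0 add.commute)
  moreover have "br (br x y) z = - br z (br x y)" "br y (br z x) = - br y (br x z)"
    using assms br_anti[of "br x y" z] br_anti[of z x] by (simp_all add: lin mem)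
  ultimately show ?thesis
    by simp
qed

lemma action: "lie_action_by_derivations (base_of Q) (alg_of Q) br"
  unfolding lie_action_by_derivations_def
proof (intro conjI ballI)
  fix v X Y assume "v \<in> lcarrier (base_of Q)" "X \<in> lcarrier (alg_of Q)" "Y \<in> lcarrier (alg_of Q)"
  then show "br v (lbracket (alg_of Q) X Y) = lbracket (alg_of Q) (br v X) Y + lbracket (alg_of Q) X (br v Y)"
    using jacobi_bracket[of v X Y] by (simp add: mem)
qed (auto simp: linear_on_def lin mem mixed jacobi_bracket)

lemma cobracket: "lie_cobracket (alg_of Q) \<delta>"
proof -
  let ?T = "transpose_struct (alg_of Q) \<delta>"
  have T [simp]: "lscale ?T = fun_scale" "lcarrier ?T = dual (alg_of Q)"
    by (simp_all add: transpose_struct_def)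
  have "lie_algebra ?T"
    unfolding lie_algebra_def
  proof (intro conjI ballI)
    show "vector_space (lscale ?T)" by (simp add: vector_space_fun_scale)
    show "module.subspace (lscale ?T) (lcarrier ?T)" by (simp add: H.subspace_dual)
  next
    fix \<alpha> \<beta> assume "\<alpha> \<in> lcarrier ?T" "\<beta> \<in> lcarrier ?T"
    then show "lbracket ?T \<alpha> \<beta> \<in> lcarrier ?T"
      by (metis T(2) dual_fn transpose_fn fn_dual br_CC)
  next
    fix \<alpha> assume "\<alpha> \<in> lcarrier ?T"
    then obtain P where P: "P \<in> C" "\<alpha> = fn P" by (auto elim: dual_fn)
    have im: "dual (alg_of Q) = fn ` C"
      using bij_fn by (simp add: bij_betw_def)
    show "linear_on (lscale ?T) (lscale ?T) (lcarrier ?T) (lbracket ?T \<alpha>)"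
      unfolding linear_on_def T im
      by (simp add: P transpose_fn fn_add fn_scale mem lin)
    show "linear_on (lscale ?T) (lscale ?T) (lcarrier ?T) (\<lambda>\<beta>. lbracket ?T \<beta> \<alpha>)"
      unfolding linear_on_def T im
      by (simp add: P transpose_fn fn_add fn_scale mem lin)
    show "lbracket ?T \<alpha> \<alpha> = 0"
      by (simp add: P transpose_fn br_self mem fn_0)
  next
    fix \<alpha> \<beta> \<gamma> assume "\<alpha> \<in> lcarrier ?T" "\<beta> \<in> lcarrier ?T" "\<gamma> \<in> lcarrier ?T"
    then obtain x y z where xyz: "x \<in> C" "\<alpha> = fn x" "y \<in> C" "\<beta> = fn y" "z \<in> C" "\<gamma> = fn z"
      by (metis T(2) dual_fn)
    \<comment> \<open>Each nested bracket is reversed twice, so the two signs cancel and the cyclic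
      sum is that of C itself.\<close>
    have "br (br z y) x + br (br x z) y + br (br y x) z = jac Q x y z"
      using xyz br_anti[of "br z y" x] br_anti[of "br x z" y] br_anti[of "br y x" z]
        br_anti[of z y] br_anti[of x z] br_anti[of y x]
      by (simp add: jac_def lin mem)
    then show "lbracket ?T \<alpha> (lbracket ?T \<beta> \<gamma>) + lbracket ?T \<beta> (lbracket ?T \<gamma> \<alpha>)
        + lbracket ?T \<gamma> (lbracket ?T \<alpha> \<beta>) = 0"
      using xyz jacobi[of x y z] by (simp add: transpose_fn fn_add mem fn_0)
  qed
  moreover have "linear_on (lscale (alg_of Q)) tensor_scale (lcarrier (alg_of Q)) \<delta>"
  proof -
    have im: "dual (alg_of Q) = fn ` C"
      using bij_fn by (simp add: bij_betw_def)
    have "\<delta> (X + Y) = \<delta> X + \<delta> Y" "\<delta> (s c X) = tensor_scale c (\<delta> X)" if "X \<in> A" "Y \<in> A" for X Y c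
    proof -
      show "\<delta> (X + Y) = \<delta> X + \<delta> Y"
      proof (intro ext)
        fix \<alpha> \<beta> show "\<delta> (X + Y) \<alpha> \<beta> = (\<delta> X + \<delta> Y) \<alpha> \<beta>"
          using that cobr_outside
          by (cases "\<alpha> \<in> fn ` C \<and> \<beta> \<in> fn ` C") (auto simp: im cobr_fn lin mem)
      qed
      show "\<delta> (s c X) = tensor_scale c (\<delta> X)"
      proof (intro ext)
        fix \<alpha> \<beta> show "\<delta> (s c X) \<alpha> \<beta> = tensor_scale c (\<delta> X) \<alpha> \<beta>"
          using that cobr_outside
          by (cases "\<alpha> \<in> fn ` C \<and> \<beta> \<in> fn ` C") (auto simp: im cobr_fn tensor_scale_def lin mem)
      qed
    qed
    then show ?thesis by (simp add: linear_on_def)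
  qed
  ultimately show ?thesis
    using cobr_ext_square by (simp add: lie_cobracket_def)
qed

lemma cobr_invariant:
  assumes v: "v \<in> B" and X: "X \<in> A"
  shows "\<delta> (br v X) = tensor_deriv (alg_of Q) (br v) (\<delta> X)"
proof (intro ext)
  fix \<alpha> \<beta> show "\<delta> (br v X) \<alpha> \<beta> = tensor_deriv (alg_of Q) (br v) (\<delta> X) \<alpha> \<beta>"
  proof (cases "\<alpha> \<in> dual (alg_of Q) \<and> \<beta> \<in> dual (alg_of Q)")
    case True
    then obtain P R where PR: "P \<in> C" "\<alpha> = fn P" "R \<in> C" "\<beta> = fn R" using dual_fn by metis
    have "K (br v X) (br R P) = K X (br (br R P) v)"
      using PR v X br_anti[of "br R P" v] by (simp add: K_br_swap lin mem)
    \<comment> \<open>Bracketing with v on the right is a derivation of C and represents the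
      pullback along \<open>br v\<close>; the two summands are thus the two terms of
      \<open>tensor_deriv\<close>.\<close>
    also have "br (br R P) v = br R (br P v) + br (br R v) P"
      using PR v jacobi_bracket[of R P v] br_anti[of "br R v" P] by (simp add: mem)
    finally show ?thesis
      using PR v X by (simp add: H.tensor_deriv_apply fn_dual pullback_fn_base cobr_fn lin mem mixed)
  next
    case False
    then show ?thesis by (simp add: H.tensor_deriv_outside cobr_outside)
  qed
qed

theorem induced_quasi_bialgebra: "lie_quasi_bialgebra (induced_qbialg Q)"
proof -
  have "lie_algebra (base_of Q)" "lie_algebra (alg_of Q)"
    unfolding base_of_def alg_of_def
    by (auto intro!: lie_algebra_restrict jacobi sub_A sub_B br_AA br_BB intro: A_D B_D)
  moreover have "tensor_deriv (alg_of Q) (br X) (\<delta> Y) - tensor_deriv (alg_of Q) (br Y) (\<delta> X) - \<delta> (br X Y)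
      - (\<Sum>e\<in>E. \<Sum>e'\<in>E. tensor_scale (c e e') (wedge (alg_of Q) (br e X) (br e' Y))) = 0"
    if E: "tensor_coeffs (base_of Q) t E c" and XY: "X \<in> A" "Y \<in> A" for E c X Y
  proof (intro ext)
    fix \<alpha> \<beta> show "(tensor_deriv (alg_of Q) (br X) (\<delta> Y) - tensor_deriv (alg_of Q) (br Y) (\<delta> X) - \<delta> (br X Y)
      - (\<Sum>e\<in>E. \<Sum>e'\<in>E. tensor_scale (c e e') (wedge (alg_of Q) (br e X) (br e' Y)))) \<alpha> \<beta> = 0 \<alpha> \<beta>"
    proof (cases "\<alpha> \<in> dual (alg_of Q) \<and> \<beta> \<in> dual (alg_of Q)")
      case True
      then obtain P R where PR: "P \<in> C" "\<alpha> = fn P" "R \<in> C" "\<beta> = fn R" using dual_fn by metis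
      show ?thesis
        using PR XY jacobi[of X Y P] compat_eq_jac[OF XY PR(1,3) E] by (simp add: mem lin)
    next
      case False
      then have "wedge (alg_of Q) a b \<alpha> \<beta> = 0" for a b
        by (auto simp: wedge_def pure_tensor_def)
      then show ?thesis
        using False by (simp add: H.tensor_deriv_outside cobr_outside sum_fun_apply tensor_scale_def)
    qed
  qed
  ultimately show ?thesis
    using G.finite_dim H.finite_dim form_nondegenerate_invariant action cobracket cobr_invariant
    by (simp add: lie_quasi_bialgebra_def induced_qbialg_def)
qed

end

end

section \<open>Isomorphisms of Manin quadruples\<close>

lemma induced_qbialg_simps [simp]:
  "base (induced_qbialg Q) = base_of Q" "tens (induced_qbialg Q) = inverse_form (base_of Q) (pairing Q)"
  "alg (induced_qbialg Q) = alg_of Q" "act (induced_qbialg Q) = lbracket (double Q)"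
  "cobr (induced_qbialg Q) = induced_cobr Q"
  by (simp_all add: induced_qbialg_def)

locale quad_pair = M: quad Q + N: quad Q'
  for Q :: "('k::field, 'd::ab_group_add) quadruple" and Q' :: "('k, 'e::ab_group_add) quadruple"
begin

lemma induced_iso_mem:
  assumes "F \<in> quadruple_isos Q Q'"
  shows "induced_iso Q F \<in> qbialg_isos (induced_qbialg Q) (induced_qbialg Q')"
proof -
  have bij: "bij_betw F M.D N.D"
    and add: "\<And>x y. x \<in> M.D \<Longrightarrow> y \<in> M.D \<Longrightarrow> F (x + y) = F x + F y"
    and scale: "\<And>c x. x \<in> M.D \<Longrightarrow> F (M.s c x) = N.s c (F x)"
    and br: "\<And>x y. x \<in> M.D \<Longrightarrow> y \<in> M.D \<Longrightarrow> F (M.br x y) = N.br (F x) (F y)"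
    and K: "\<And>x y. x \<in> M.D \<Longrightarrow> y \<in> M.D \<Longrightarrow> N.K (F x) (F y) = M.K x y"
    and im: "F ` M.A = N.A" "F ` M.B = N.B" "F ` M.C = N.C"
    using assms by (auto simp: quadruple_isos_def lie_iso_def linear_on_def)
  have F: "x \<in> M.A \<Longrightarrow> F x \<in> N.A" "x \<in> M.B \<Longrightarrow> F x \<in> N.B" "x \<in> M.C \<Longrightarrow> F x \<in> N.C" for x
    using im by auto
  have inj: "inj_on F M.A" "inj_on F M.B"
    using bij M.A_D M.B_D by (auto simp: bij_betw_def intro: inj_on_subset)
  define \<phi> where "\<phi> = restrict F M.B"
  define \<psi> where "\<psi> = restrict F M.A"
  have \<phi>: "\<phi> x = F x" if "x \<in> M.B" for x using that by (simp add: \<phi>_def)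
  have \<psi>: "\<psi> x = F x" if "x \<in> M.A" for x using that by (simp add: \<psi>_def)
  \<comment> \<open>F is isometric, so the functional of F u pulls back to that of u. The tensors
    and the cobrackets can then be compared by evaluation on represented functionals.\<close>
  have pb: "pullback (base_of Q) \<phi> (N.fb (F u)) = M.fb u" if "u \<in> M.B" for u
    using that by (auto simp: pullback_def flat_def fun_eq_iff \<phi> F K M.mem)
  have pa: "pullback (alg_of Q) \<psi> (N.fn (F P)) = M.fn P" if "P \<in> M.C" for P
    using that by (auto simp: pullback_def functional_of_def flat_def fun_eq_iff \<psi> F K M.mem)
  have "lie_iso (base_of Q) (base_of Q') \<phi>"
    using inj im by (auto simp: lie_iso_def \<phi>_def bij_betw_def linear_on_def add scale br M.mem inj_on_def)
  moreover have "lie_iso (alg_of Q) (alg_of Q') \<psi>"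
    using inj im by (auto simp: lie_iso_def \<psi>_def bij_betw_def linear_on_def add scale br M.mem inj_on_def)
  moreover have "tensor_map (base_of Q) (base_of Q') \<phi> \<phi> M.t = N.t"
  proof (intro ext)
    fix \<alpha> \<beta> show "tensor_map (base_of Q) (base_of Q') \<phi> \<phi> M.t \<alpha> \<beta> = N.t \<alpha> \<beta>"
    proof (cases "\<alpha> \<in> dual (base_of Q') \<and> \<beta> \<in> dual (base_of Q')")
      case True
      then obtain u' v' where uv': "u' \<in> N.B" "\<alpha> = N.fb u'" "v' \<in> N.B" "\<beta> = N.fb v'"
        using N.dual_fb by metis
      then obtain u v where "u \<in> M.B" "u' = F u" "v \<in> M.B" "v' = F v"
        using im(2) by blast
      then show ?thesis
        using uv' by (simp add: tensor_map_def N.fb_dual pb M.form_fb M.fb_dual N.form_fb M.fb_apply N.fb_apply F K M.mem)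
    next
      case False
      then show ?thesis by (auto simp: tensor_map_def N.form_outside)
    qed
  qed
  moreover have "\<psi> (M.br v X) = N.br (\<phi> v) (\<psi> X)" if "v \<in> M.B" "X \<in> M.A" for v X
    using that by (simp add: \<phi> \<psi> br M.mem M.mixed)
  moreover have "N.\<delta> (\<psi> X) = tensor_map (alg_of Q) (alg_of Q') \<psi> \<psi> (M.\<delta> X)" if X: "X \<in> M.A" for X
  proof (intro ext)
    fix \<alpha> \<beta> show "N.\<delta> (\<psi> X) \<alpha> \<beta> = tensor_map (alg_of Q) (alg_of Q') \<psi> \<psi> (M.\<delta> X) \<alpha> \<beta>"
    proof (cases "\<alpha> \<in> dual (alg_of Q') \<and> \<beta> \<in> dual (alg_of Q')")
      case True
      then obtain P' R' where PR': "P' \<in> N.C" "\<alpha> = N.fn P'" "R' \<in> N.C" "\<beta> = N.fn R'"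
        using N.dual_fn by metis
      then obtain P R where "P \<in> M.C" "P' = F P" "R \<in> M.C" "R' = F R"
        using im(3) by blast
      then show ?thesis
        using PR' X by (simp add: tensor_map_def N.fn_dual pa N.cobr_fn M.cobr_fn \<psi> K M.mem flip: br)
    next
      case False
      then show ?thesis by (auto simp: tensor_map_def N.cobr_outside)
    qed
  qed
  ultimately show ?thesis
    unfolding \<phi>_def \<psi>_def by (simp add: qbialg_isos_def induced_iso_def)
qed

text \<open>An isometry is determined on C by its values on A, since elements of \<open>N.C\<close>
  are separated by pairing with \<open>N.A\<close>.\<close>

lemma inj_on_induced_iso: "inj_on (induced_iso Q) (quadruple_isos Q Q')"
proof (rule inj_onI)
  fix F G assume FG: "F \<in> quadruple_isos Q Q'" "G \<in> quadruple_isos Q Q'" "induced_iso Q F = induced_iso Q G"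
  have ext: "F \<in> extensional M.D" "G \<in> extensional M.D"
    and add: "\<And>x y. x \<in> M.D \<Longrightarrow> y \<in> M.D \<Longrightarrow> F (x + y) = F x + F y"
      "\<And>x y. x \<in> M.D \<Longrightarrow> y \<in> M.D \<Longrightarrow> G (x + y) = G x + G y"
    and K: "\<And>x y. x \<in> M.D \<Longrightarrow> y \<in> M.D \<Longrightarrow> N.K (F x) (F y) = M.K x y"
      "\<And>x y. x \<in> M.D \<Longrightarrow> y \<in> M.D \<Longrightarrow> N.K (G x) (G y) = M.K x y"
    and im: "F ` M.A = N.A" "F ` M.C = N.C" "G ` M.C = N.C"
    using FG(1,2) by (auto simp: quadruple_isos_def lie_iso_def linear_on_def)
  have eq: "F x = G x" if "x \<in> M.A \<or> x \<in> M.B" for x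
    using FG(3) that by (auto simp: induced_iso_def fun_eq_iff restrict_def split: if_splits)
  have C: "F P = G P" if P: "P \<in> M.C" for P
  proof -
    have FP: "F P \<in> N.C" "G P \<in> N.C" using P im by auto
    have "F P - G P = 0"
    proof (rule N.nondeg_C)
      fix z assume "z \<in> N.A"
      then obtain X where X: "X \<in> M.A" "z = F X" using im(1) by blast
      have "N.K (F P) (F X) = N.K (G P) (G X)"
        using X P by (simp add: K M.mem)
      then show "N.K (F P - G P) z = 0"
        using X FP \<open>z \<in> N.A\<close> eq by (simp add: N.lin N.mem)
    qed (use FP N.mem in auto)
    then show ?thesis by simp
  qed
  show "F = G"
  proof
    fix x show "F x = G x"
    proof (cases "x \<in> M.D")
      case True
      then obtain a b c where "a \<in> M.A" "b \<in> M.B" "c \<in> M.C" "x = a + b + c" by (rule M.decomp)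
      then show ?thesis by (simp add: add M.mem eq C)
    next
      case False
      then show ?thesis using ext by (simp add: extensional_def)
    qed
  qed
qed

section \<open>Extending an isomorphism of quasi-bialgebras to the quadruples\<close>

context
  fixes \<phi> \<psi>
  assumes iso: "(\<phi>, \<psi>) \<in> qbialg_isos (induced_qbialg Q) (induced_qbialg Q')"
begin

lemma bij_\<phi>: "bij_betw \<phi> M.B N.B" and bij_\<psi>: "bij_betw \<psi> M.A N.A"
  and ext_\<phi>: "\<phi> \<in> extensional M.B" and ext_\<psi>: "\<psi> \<in> extensional M.A"
  and tens_\<phi>: "tensor_map (base_of Q) (base_of Q') \<phi> \<phi> M.t = N.t"
  using iso by (auto simp: qbialg_isos_def lie_iso_def)

lemma hom_\<phi>: "u \<in> M.B \<Longrightarrow> v \<in> M.B \<Longrightarrow> \<phi> (u + v) = \<phi> u + \<phi> v"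
    "u \<in> M.B \<Longrightarrow> \<phi> (M.s c u) = N.s c (\<phi> u)"
    "u \<in> M.B \<Longrightarrow> v \<in> M.B \<Longrightarrow> \<phi> (M.br u v) = N.br (\<phi> u) (\<phi> v)"
  and hom_\<psi>: "X \<in> M.A \<Longrightarrow> Y \<in> M.A \<Longrightarrow> \<psi> (X + Y) = \<psi> X + \<psi> Y"
    "X \<in> M.A \<Longrightarrow> \<psi> (M.s c X) = N.s c (\<psi> X)"
    "X \<in> M.A \<Longrightarrow> Y \<in> M.A \<Longrightarrow> \<psi> (M.br X Y) = N.br (\<psi> X) (\<psi> Y)"
    "v \<in> M.B \<Longrightarrow> X \<in> M.A \<Longrightarrow> \<psi> (M.br v X) = N.br (\<phi> v) (\<psi> X)"
  and cobr_\<psi>: "X \<in> M.A \<Longrightarrow> N.\<delta> (\<psi> X) = tensor_map (alg_of Q) (alg_of Q') \<psi> \<psi> (M.\<delta> X)"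
  using iso by (auto simp: qbialg_isos_def lie_iso_def linear_on_def)

lemma \<phi>_mem: "u \<in> M.B \<Longrightarrow> \<phi> u \<in> N.B" and \<psi>_mem: "X \<in> M.A \<Longrightarrow> \<psi> X \<in> N.A"
  using bij_\<phi> bij_\<psi> by (auto simp: bij_betw_def)

lemma \<phi>_0: "\<phi> 0 = 0" and \<psi>_0: "\<psi> 0 = 0"
  using hom_\<phi>(2)[of 0 0] hom_\<psi>(2)[of 0 0] M.mem by auto

text \<open>Let \<open>\<theta>\<close> be the adjoint of \<open>\<phi>\<close> composed with \<open>\<phi>\<close>. That \<open>\<phi>\<close> preserves the tensors says
  \<open>K (\<theta> u) (\<theta> v) = K (\<theta> u) v\<close>; as \<open>\<theta>\<close> is onto, it is the identity.\<close>

lemma K_\<phi>: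
  assumes "u \<in> M.B" "v \<in> M.B"
  shows "N.K (\<phi> u) (\<phi> v) = M.K u v"
proof -
  have pb: "\<exists>w\<in>M.B. pullback (base_of Q) \<phi> (N.fb (\<phi> u)) = M.fb w" if "u \<in> M.B" for u
  proof -
    have "pullback (base_of Q) \<phi> (N.fb (\<phi> u)) \<in> dual (base_of Q)"
      using that by (auto simp: dual_def pullback_def linear_on_def N.fb_apply hom_\<phi> \<phi>_mem M.mem N.mem N.lin)
    then show ?thesis by (rule M.dual_fb) auto
  qed
  then obtain \<theta> where \<theta>: "\<And>u. u \<in> M.B \<Longrightarrow> \<theta> u \<in> M.B"
    "\<And>u. u \<in> M.B \<Longrightarrow> pullback (base_of Q) \<phi> (N.fb (\<phi> u)) = M.fb (\<theta> u)"
    by metis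
  have \<theta>K: "M.K (\<theta> u) v = N.K (\<phi> u) (\<phi> v)" if "u \<in> M.B" "v \<in> M.B" for u v
    using fun_cong[OF \<theta>(2)[OF that(1)], of v] that by (simp add: pullback_def M.fb_apply N.fb_apply \<phi>_mem)
  have \<theta>\<theta>: "M.K (\<theta> u) (\<theta> v) = N.K (\<phi> u) (\<phi> v)" if "u \<in> M.B" "v \<in> M.B" for u v
  proof -
    have "N.K (\<phi> u) (\<phi> v) = N.t (N.fb (\<phi> u)) (N.fb (\<phi> v))"
      using that N.K_sym[of "\<phi> u" "\<phi> v"] by (simp add: N.form_fb N.fb_dual N.fb_apply \<phi>_mem N.mem)
    also have "\<dots> = tensor_map (base_of Q) (base_of Q') \<phi> \<phi> M.t (N.fb (\<phi> u)) (N.fb (\<phi> v))"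
      by (simp add: tens_\<phi>)
    also have "\<dots> = M.t (M.fb (\<theta> u)) (M.fb (\<theta> v))"
      using that by (simp add: tensor_map_def N.fb_dual \<phi>_mem \<theta>)
    also have "\<dots> = M.K (\<theta> u) (\<theta> v)"
      using that \<theta>(1) by (simp add: M.form_fb M.fb_dual M.fb_apply)
    finally show ?thesis ..
  qed
  \<comment> \<open>The functional of w composed with the inverse of \<phi> is represented by an
    element of \<open>N.B\<close>, hence by some \<phi> u; this u is mapped to w.\<close>
  have surj: "\<exists>u\<in>M.B. \<theta> u = w" if w: "w \<in> M.B" for w
  proof -
    let ?i = "inv_into M.B \<phi>"
    have i: "?i (\<phi> x) = x" if "x \<in> M.B" for x
      using bij_\<phi> that by (simp add: bij_betw_def inv_into_f_f)
    have im: "N.B = \<phi> ` M.B"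
      using bij_\<phi> by (simp add: bij_betw_def)
    have "pullback (base_of Q') ?i (M.fb w) \<in> dual (base_of Q')"
      using w by (auto simp: dual_def pullback_def linear_on_def im i M.fb_apply M.lin M.mem N.mem \<phi>_mem
          simp flip: hom_\<phi>)
    then obtain u' where u': "u' \<in> N.B" "pullback (base_of Q') ?i (M.fb w) = N.fb u'"
      by (rule N.dual_fb)
    then obtain u where u: "u \<in> M.B" "u' = \<phi> u" using im by blast
    have "M.fb (\<theta> u) = M.fb w"
    proof
      fix v show "M.fb (\<theta> u) v = M.fb w v"
      proof (cases "v \<in> M.B")
        case True
        have "N.K (\<phi> u) (\<phi> v) = M.fb w v"
          using fun_cong[OF u'(2), of "\<phi> v"] u True by (simp add: pullback_def i \<phi>_mem N.fb_apply)
        then show ?thesis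
          using True \<theta>K u by (simp add: M.fb_apply)
      qed (simp add: M.fb_outside)
    qed
    then show ?thesis
      using M.fb_inj \<theta>(1) u(1) w by blast
  qed
  have "\<theta> v - v = 0"
  proof (rule M.nondeg_B)
    fix z assume z: "z \<in> M.B"
    then obtain u where "u \<in> M.B" "\<theta> u = z" using surj by blast
    then have "M.K z (\<theta> v - v) = 0"
      using assms \<theta>\<theta>[of u v] \<theta>K[of u v] \<theta>(1) z by (simp add: M.lin M.mem)
    then show "M.K (\<theta> v - v) z = 0"
      using M.K_sym[of z "\<theta> v - v"] assms \<theta>(1) z by (simp add: M.mem)
  qed (use assms \<theta> M.mem in auto)
  then show ?thesis
    using \<theta>K[OF assms(2,1)] assms M.K_sym[of u v] N.K_sym[of "\<phi> u" "\<phi> v"] \<phi>_mem by (simp add: M.mem N.mem)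
qed

text \<open>The contragredient of \<psi>, the only map between the third summands that is compatible
  with the pairings.\<close>

definition \<chi> :: "'d \<Rightarrow> 'e" where
  "\<chi> P = (SOME P'. P' \<in> N.C \<and> (\<forall>X\<in>M.A. N.K P' (\<psi> X) = M.K P X))"

lemma \<chi>:
  assumes P: "P \<in> M.C"
  shows "\<chi> P \<in> N.C" "\<And>X. X \<in> M.A \<Longrightarrow> N.K (\<chi> P) (\<psi> X) = M.K P X"
proof -
  let ?i = "inv_into M.A \<psi>"
  have i: "?i (\<psi> x) = x" if "x \<in> M.A" for x
    using bij_\<psi> that by (simp add: bij_betw_def inv_into_f_f)
  have im: "N.A = \<psi> ` M.A"
    using bij_\<psi> by (simp add: bij_betw_def)
  have "pullback (alg_of Q') ?i (M.fn P) \<in> dual (alg_of Q')"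
    using P by (auto simp: dual_def pullback_def linear_on_def im i M.fn_apply M.lin M.mem N.mem \<psi>_mem
        simp flip: hom_\<psi>)
  then obtain P' where P': "P' \<in> N.C" "pullback (alg_of Q') ?i (M.fn P) = N.fn P'"
    by (rule N.dual_fn)
  have "N.K P' (\<psi> X) = M.K P X" if "X \<in> M.A" for X
    using fun_cong[OF P'(2), of "\<psi> X"] that by (simp add: pullback_def i \<psi>_mem N.fn_apply M.fn_apply)
  then have "\<exists>P'. P' \<in> N.C \<and> (\<forall>X\<in>M.A. N.K P' (\<psi> X) = M.K P X)"
    using P' by blast
  from someI_ex[OF this] show "\<chi> P \<in> N.C" "\<And>X. X \<in> M.A \<Longrightarrow> N.K (\<chi> P) (\<psi> X) = M.K P X"
    unfolding \<chi>_def by blast+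
qed

lemma \<chi>_eqI:
  assumes "P \<in> M.C" "P' \<in> N.C" "\<And>X. X \<in> M.A \<Longrightarrow> N.K P' (\<psi> X) = M.K P X"
  shows "\<chi> P = P'"
proof -
  have "\<chi> P - P' = 0"
  proof (rule N.nondeg_C)
    fix z assume z: "z \<in> N.A"
    then obtain X where "X \<in> M.A" "z = \<psi> X" using bij_\<psi> by (auto simp: bij_betw_def)
    then show "N.K (\<chi> P - P') z = 0"
      using assms \<chi> z by (simp add: N.lin N.mem)
  qed (use assms \<chi> N.mem in auto)
  then show ?thesis by simp
qed

lemma \<chi>_surj:
  assumes P': "P' \<in> N.C"
  shows "\<exists>P\<in>M.C. \<chi> P = P'"
proof -
  have "pullback (alg_of Q) \<psi> (N.fn P') \<in> dual (alg_of Q)"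
    using P' by (auto simp: dual_def pullback_def linear_on_def N.fn_apply hom_\<psi> \<psi>_mem M.mem N.mem N.lin)
  then obtain P where P: "P \<in> M.C" "pullback (alg_of Q) \<psi> (N.fn P') = M.fn P"
    by (rule M.dual_fn)
  have "N.K P' (\<psi> X) = M.K P X" if "X \<in> M.A" for X
    using fun_cong[OF P(2), of X] that by (simp add: pullback_def \<psi>_mem N.fn_apply M.fn_apply)
  then show ?thesis using \<chi>_eqI P P' by blast
qed

lemma \<chi>_add: "P \<in> M.C \<Longrightarrow> R \<in> M.C \<Longrightarrow> \<chi> (P + R) = \<chi> P + \<chi> R"
  and \<chi>_scale: "P \<in> M.C \<Longrightarrow> \<chi> (M.s c P) = N.s c (\<chi> P)"
  by (rule \<chi>_eqI; simp add: M.lin N.lin M.mem N.mem \<chi> \<psi>_mem)+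

lemma \<chi>_0: "\<chi> 0 = 0"
  using \<chi>_scale[of 0 0] M.mem by auto

text \<open>The value \<open>undefined\<close> outside the carrier is what the extensionality clause
  of \<open>lie_iso\<close> asks for.\<close>

definition glue :: "'d \<Rightarrow> 'e" where
  "glue x = (if x \<in> M.D then
     (\<lambda>(a, b, c). \<psi> a + \<phi> b + \<chi> c) (the_inv_into (M.A \<times> M.B \<times> M.C) (\<lambda>(a, b, c). a + b + c) x)
   else undefined)"

lemma glue:
  assumes "a \<in> M.A" "b \<in> M.B" "c \<in> M.C"
  shows "glue (a + b + c) = \<psi> a + \<phi> b + \<chi> c"
proof -
  have "the_inv_into (M.A \<times> M.B \<times> M.C) (\<lambda>(a, b, c). a + b + c) (a + b + c) = (a, b, c)"
    using the_inv_into_f_f[OF bij_betw_imp_inj_on[OF M.bij], of "(a, b, c)"] assms by simp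
  then show ?thesis
    using assms by (simp add: glue_def M.mem)
qed

lemma glue_A: "a \<in> M.A \<Longrightarrow> glue a = \<psi> a"
  and glue_B: "b \<in> M.B \<Longrightarrow> glue b = \<phi> b"
  and glue_C: "c \<in> M.C \<Longrightarrow> glue c = \<chi> c"
  using glue[of a 0 0] glue[of 0 b 0] glue[of 0 0 c] M.mem by (auto simp: \<phi>_0 \<psi>_0 \<chi>_0)

lemma glue_mem: "x \<in> M.D \<Longrightarrow> glue x \<in> N.D"
  by (erule M.decomp) (simp add: glue N.mem \<psi>_mem \<phi>_mem \<chi>)

lemma glue_add:
  assumes "x \<in> M.D" "y \<in> M.D"
  shows "glue (x + y) = glue x + glue y"
proof -
  obtain a b c where x: "a \<in> M.A" "b \<in> M.B" "c \<in> M.C" "x = a + b + c" using assms(1) by (rule M.decomp)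
  obtain a' b' c' where y: "a' \<in> M.A" "b' \<in> M.B" "c' \<in> M.C" "y = a' + b' + c'" using assms(2) by (rule M.decomp)
  have "x + y = (a + a') + (b + b') + (c + c')"
    by (simp add: x y algebra_simps)
  then have "glue (x + y) = \<psi> (a + a') + \<phi> (b + b') + \<chi> (c + c')"
    using x y by (simp only: glue M.mem)
  moreover have "glue x = \<psi> a + \<phi> b + \<chi> c" "glue y = \<psi> a' + \<phi> b' + \<chi> c'"
    using x y by (simp_all add: glue)
  ultimately show ?thesis
    using x y by (simp add: hom_\<phi> hom_\<psi> \<chi>_add algebra_simps)
qed

lemma glue_scale:
  assumes "x \<in> M.D"
  shows "glue (M.s k x) = N.s k (glue x)"
proof -
  obtain a b c where x: "a \<in> M.A" "b \<in> M.B" "c \<in> M.C" "x = a + b + c" using assms(1) by (rule M.decomp)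
  have "M.s k x = M.s k a + M.s k b + M.s k c"
    by (simp add: x M.V.scale_right_distrib)
  then have "glue (M.s k x) = \<psi> (M.s k a) + \<phi> (M.s k b) + \<chi> (M.s k c)"
    using x by (simp only: glue M.mem)
  then show ?thesis
    using x by (simp add: glue hom_\<phi> hom_\<psi> \<chi>_scale N.V.scale_right_distrib)
qed

lemma glue_K:
  assumes "x \<in> M.D" "y \<in> M.D"
  shows "N.K (glue x) (glue y) = M.K x y"
proof -
  obtain a b c where x: "a \<in> M.A" "b \<in> M.B" "c \<in> M.C" "x = a + b + c" using assms(1) by (rule M.decomp)
  obtain a' b' c' where y: "a' \<in> M.A" "b' \<in> M.B" "c' \<in> M.C" "y = a' + b' + c'" using assms(2) by (rule M.decomp)
  have "N.K (\<psi> a) (\<chi> c') = M.K a c'"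
    using x y \<chi>[of c'] M.K_sym[of a c'] N.K_sym[of "\<psi> a" "\<chi> c'"] by (simp add: M.mem N.mem \<psi>_mem)
  then show ?thesis
    using x y by (simp add: glue M.K_decomp N.K_decomp \<psi>_mem \<phi>_mem \<chi> K_\<phi>)
qed

lemma glue_image: "glue ` M.A = N.A" "glue ` M.B = N.B" "glue ` M.C = N.C"
proof -
  have "glue ` M.A = \<psi> ` M.A" "glue ` M.B = \<phi> ` M.B" "glue ` M.C = \<chi> ` M.C"
    by (simp_all add: glue_A glue_B glue_C cong: image_cong)
  moreover have "\<chi> ` M.C = N.C"
    using \<chi> \<chi>_surj by blast
  ultimately show "glue ` M.A = N.A" "glue ` M.B = N.B" "glue ` M.C = N.C"
    using bij_\<phi> bij_\<psi> by (auto simp: bij_betw_def)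
qed

lemma bij_glue: "bij_betw glue M.D N.D"
  unfolding bij_betw_def
proof
  show "inj_on glue M.D"
  proof (rule inj_onI)
    fix x y assume xy: "x \<in> M.D" "y \<in> M.D" "glue x = glue y"
    have "x - y = 0"
    proof (rule M.K_nondeg)
      fix z assume "z \<in> M.D"
      then show "M.K (x - y) z = 0"
        using xy glue_K[of x z] glue_K[of y z] by (simp add: M.lin)
    qed (use xy M.mem in auto)
    then show "x = y" by simp
  qed
  have "y \<in> glue ` M.D" if "y \<in> N.D" for y
  proof -
    obtain a' b' c' where y: "a' \<in> N.A" "b' \<in> N.B" "c' \<in> N.C" "y = a' + b' + c'" using \<open>y \<in> N.D\<close> by (rule N.decomp)
    then obtain a b c where abc: "a \<in> M.A" "a' = glue a" "b \<in> M.B" "b' = glue b" "c \<in> M.C" "c' = glue c"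
      unfolding glue_image[symmetric] by (elim imageE)
    then have "y = glue (a + b + c)"
      using y by (simp add: glue_add M.mem)
    moreover have "a + b + c \<in> M.D" using abc by (simp add: M.mem)
    ultimately show ?thesis by simp
  qed
  then show "glue ` M.D = N.D"
    using glue_mem by blast
qed

text \<open>A difference in place of an equation is additive in z, as \<open>additive_vanish\<close>
  requires. The intersections with \<open>M.D\<close> let the symmetries hold for arbitrary
  sets.\<close>

definition preserved :: "'d set \<Rightarrow> 'd set \<Rightarrow> 'd set \<Rightarrow> bool" where
  "preserved P R S \<longleftrightarrow> (\<forall>x\<in>P \<inter> M.D. \<forall>y\<in>R \<inter> M.D. \<forall>z\<in>S \<inter> M.D.
     N.K (N.br (glue x) (glue y)) (glue z) - M.K (M.br x y) z = 0)"

lemma preserved_swap12: "preserved P R S = preserved R P S"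
proof -
  have "preserved R P S" if "preserved P R S" for P R
    unfolding preserved_def
  proof (intro ballI)
    fix x y z assume m: "x \<in> R \<inter> M.D" "y \<in> P \<inter> M.D" "z \<in> S \<inter> M.D"
    then have "N.K (N.br (glue y) (glue x)) (glue z) - M.K (M.br y x) z = 0"
      using that by (auto simp: preserved_def)
    then show "N.K (N.br (glue x) (glue y)) (glue z) - M.K (M.br x y) z = 0"
      using m M.br_anti[of x y] N.br_anti[of "glue x" "glue y"] by (simp add: M.lin N.lin glue_mem M.mem N.mem)
  qed
  then show ?thesis by blast
qed

lemma preserved_swap23: "preserved P R S = preserved P S R"
proof -
  have "preserved P S R" if "preserved P R S" for R S
    unfolding preserved_def
  proof (intro ballI)
    fix x y z assume m: "x \<in> P \<inter> M.D" "y \<in> S \<inter> M.D" "z \<in> R \<inter> M.D"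
    then have "N.K (N.br (glue x) (glue z)) (glue y) - M.K (M.br x z) y = 0"
      using that by (auto simp: preserved_def)
    then show "N.K (N.br (glue x) (glue y)) (glue z) - M.K (M.br x y) z = 0"
      using m M.K_br_swap[of x y z] N.K_br_swap[of "glue x" "glue y" "glue z"]
        M.K_sym[of y "M.br x z"] N.K_sym[of "glue y" "N.br (glue x) (glue z)"]
      by (simp add: glue_mem M.mem N.mem)
  qed
  then show ?thesis by blast
qed

lemma preserved_D3:
  assumes "preserved P R M.A" "preserved P R M.B" "preserved P R M.C"
  shows "preserved P R M.D"
  unfolding preserved_def
proof (intro ballI)
  fix x y z assume m: "x \<in> P \<inter> M.D" "y \<in> R \<inter> M.D" "z \<in> M.D \<inter> M.D"
  show "N.K (N.br (glue x) (glue y)) (glue z) - M.K (M.br x y) z = 0"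
    by (rule M.additive_vanish) (use m assms in \<open>auto simp: preserved_def M.lin N.lin M.mem N.mem glue_mem glue_add\<close>)
qed

lemma preserved_D2: "preserved P M.A R \<Longrightarrow> preserved P M.B R \<Longrightarrow> preserved P M.C R \<Longrightarrow> preserved P M.D R"
  using preserved_D3[of P R] preserved_swap23[of P R M.A] preserved_swap23[of P R M.B]
    preserved_swap23[of P R M.C] preserved_swap23[of P R M.D] by simp

lemma preserved_D1: "preserved M.A P R \<Longrightarrow> preserved M.B P R \<Longrightarrow> preserved M.C P R \<Longrightarrow> preserved M.D P R"
  using preserved_D2[of P R] preserved_swap12[of P M.A R] preserved_swap12[of P M.B R]
    preserved_swap12[of P M.C R] preserved_swap12[of P M.D R] by simp

text \<open>Of the ten unordered types, six vanish on both sides by orthogonality. The other four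
  come from the bracket of \<hh>, the action, the cobracket, and the bracket of \<gg> together with
  \<open>K_\<phi>\<close>.\<close>

lemma preserved_types:
  "preserved M.A M.A M.A" "preserved M.A M.A M.B" "preserved M.A M.B M.B"
  "preserved M.B M.B M.C" "preserved M.B M.C M.C" "preserved M.C M.C M.C"
  "preserved M.A M.A M.C" "preserved M.B M.A M.C" "preserved M.C M.C M.A" "preserved M.B M.B M.B"
proof -
  show "preserved M.A M.A M.A" "preserved M.A M.A M.B" "preserved M.A M.B M.B"
    "preserved M.B M.B M.C" "preserved M.B M.C M.C" "preserved M.C M.C M.C"
    by (auto simp: preserved_def glue_A glue_B glue_C \<phi>_mem \<psi>_mem \<chi> M.mem N.mem M.mixed N.mixed M.isotropy N.isotropy)
  have AC: "N.K (\<psi> X) (\<chi> P) = M.K X P" if "X \<in> M.A" "P \<in> M.C" for X P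
    using that glue_K[of X P] by (simp add: glue_A glue_C M.mem)
  show "preserved M.A M.A M.C" "preserved M.B M.A M.C"
    by (auto simp: preserved_def glue_A glue_B glue_C AC M.mem M.mixed simp flip: hom_\<psi>)
  show "preserved M.B M.B M.B"
    by (auto simp: preserved_def glue_B K_\<phi> M.mem simp flip: hom_\<phi>)
  have pa: "pullback (alg_of Q) \<psi> (N.fn (\<chi> P)) = M.fn P" if "P \<in> M.C" for P
    using that by (auto simp: pullback_def functional_of_def flat_def fun_eq_iff \<psi>_mem \<chi>)
  have "N.K (N.br (\<chi> P) (\<chi> R)) (\<psi> X) = M.K (M.br P R) X" if "P \<in> M.C" "R \<in> M.C" "X \<in> M.A" for P R X
  proof -
    have "N.\<delta> (\<psi> X) (N.fn (\<chi> R)) (N.fn (\<chi> P)) = M.\<delta> X (M.fn R) (M.fn P)"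
      using that by (simp add: cobr_\<psi> tensor_map_def N.fn_dual \<chi> pa)
    then show ?thesis
      using that M.K_sym[of X "M.br P R"] N.K_sym[of "\<psi> X" "N.br (\<chi> P) (\<chi> R)"]
      by (simp add: N.cobr_fn M.cobr_fn \<chi> \<psi>_mem M.mem N.mem)
  qed
  then show "preserved M.C M.C M.A"
    by (auto simp: preserved_def glue_A glue_C)
qed

lemma glue_br:
  assumes "x \<in> M.D" "y \<in> M.D"
  shows "glue (M.br x y) = N.br (glue x) (glue y)"
proof -
  have "preserved M.D M.D M.D"
    by (intro preserved_D1 preserved_D2 preserved_D3; insert preserved_types; simp add: preserved_swap12 preserved_swap23)
  then have *: "N.K (N.br (glue x) (glue y)) (glue z) = M.K (M.br x y) z" if "z \<in> M.D" for z
    using that assms by (simp add: preserved_def)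
  have "glue (M.br x y) - N.br (glue x) (glue y) = 0"
  proof (rule N.K_nondeg)
    fix z assume "z \<in> N.D"
    then obtain w where "w \<in> M.D" "z = glue w" using bij_glue by (auto simp: bij_betw_def)
    then show "N.K (glue (M.br x y) - N.br (glue x) (glue y)) z = 0"
      using assms * by (simp add: N.lin M.mem N.mem glue_mem glue_K)
  qed (use assms in \<open>simp add: M.mem N.mem glue_mem\<close>)
  then show ?thesis by simp
qed

lemma glue_iso: "glue \<in> quadruple_isos Q Q'"
proof -
  have "glue \<in> extensional M.D"
    by (simp add: extensional_def glue_def)
  then show ?thesis
    using bij_glue glue_image
    by (simp add: quadruple_isos_def lie_iso_def linear_on_def glue_add glue_scale glue_br glue_K)
qed

lemma induced_iso_glue: "induced_iso Q glue = (\<phi>, \<psi>)"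
proof -
  have "restrict glue M.B = \<phi>"
    by (rule extensionalityI[OF _ ext_\<phi>]) (simp_all add: glue_B)
  moreover have "restrict glue M.A = \<psi>"
    by (rule extensionalityI[OF _ ext_\<psi>]) (simp_all add: glue_A)
  ultimately show ?thesis by (simp add: induced_iso_def)
qed

end

theorem bij_induced_iso:
  "bij_betw (induced_iso Q) (quadruple_isos Q Q') (qbialg_isos (induced_qbialg Q) (induced_qbialg Q'))"
proof -
  have "p \<in> induced_iso Q ` quadruple_isos Q Q'"
    if "p \<in> qbialg_isos (induced_qbialg Q) (induced_qbialg Q')" for p
    using that induced_iso_glue[of "fst p" "snd p"] glue_iso[of "fst p" "snd p"]
    by (metis image_eqI prod.collapse)
  then show ?thesis
    using inj_on_induced_iso induced_iso_mem by (auto simp: bij_betw_def)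
qed

end

section \<open>The double of a quasi-bialgebra\<close>

locale quasi_bialgebra =
  fixes S :: "('k::field, 'g::ab_group_add, 'h::ab_group_add) qbialg"
  assumes quasi_bialgebra: "lie_quasi_bialgebra S"
begin

abbreviation "\<GG> \<equiv> lcarrier (base S)"
abbreviation "\<HH> \<equiv> lcarrier (alg S)"
abbreviation "sG \<equiv> lscale (base S)"
abbreviation "sH \<equiv> lscale (alg S)"
abbreviation "bG \<equiv> lbracket (base S)"
abbreviation "bH \<equiv> lbracket (alg S)"
abbreviation "\<tau> \<equiv> tens S"
abbreviation "\<rho> \<equiv> act S"
abbreviation "\<delta> \<equiv> cobr S"

section \<open>The axioms, evaluated on vectors and functionals\<close>

lemma lie_base: "lie_algebra (base S)" and lie_alg: "lie_algebra (alg S)"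
  and form: "nondegenerate_invariant (base S) \<tau>"
  and action: "lie_action_by_derivations (base S) (alg S) \<rho>"
  and cobracket: "lie_cobracket (alg S) \<delta>"
  and cobr_invariant: "v \<in> \<GG> \<Longrightarrow> X \<in> \<HH> \<Longrightarrow> \<delta> (\<rho> v X) = tensor_deriv (alg S) (\<rho> v) (\<delta> X)"
  and compat: "tensor_coeffs (base S) \<tau> E c \<Longrightarrow> X \<in> \<HH> \<Longrightarrow> Y \<in> \<HH> \<Longrightarrow>
      tensor_deriv (alg S) (bH X) (\<delta> Y) - tensor_deriv (alg S) (bH Y) (\<delta> X) - \<delta> (bH X Y)
        - (\<Sum>e\<in>E. \<Sum>e'\<in>E. tensor_scale (c e e') (wedge (alg S) (\<rho> e X) (\<rho> e' Y))) = 0"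
  using quasi_bialgebra by (simp_all add: lie_quasi_bialgebra_def Let_def)

sublocale G: fd_struct "base S"
  by (rule fd_struct.intro)
    (use quasi_bialgebra in \<open>simp_all add: lie_quasi_bialgebra_def Let_def lie_algebra_def\<close>)

sublocale H: fd_struct "alg S"
  by (rule fd_struct.intro)
    (use quasi_bialgebra in \<open>simp_all add: lie_quasi_bialgebra_def Let_def lie_algebra_def\<close>)

sublocale F: vector_space "fun_scale :: 'k \<Rightarrow> ('h \<Rightarrow> 'k) \<Rightarrow> _"
  by (rule vector_space_fun_scale)

lemma bG_closed: "u \<in> \<GG> \<Longrightarrow> v \<in> \<GG> \<Longrightarrow> bG u v \<in> \<GG>"
  and bH_closed: "X \<in> \<HH> \<Longrightarrow> Y \<in> \<HH> \<Longrightarrow> bH X Y \<in> \<HH>"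
  and \<rho>_closed: "u \<in> \<GG> \<Longrightarrow> X \<in> \<HH> \<Longrightarrow> \<rho> u X \<in> \<HH>"
  using lie_base lie_alg action by (simp_all add: lie_algebra_def lie_action_by_derivations_def)

lemmas clos = bG_closed bH_closed \<rho>_closed
  G.subspace_0[OF G.subspace_carrier] G.subspace_add[OF G.subspace_carrier] G.subspace_neg[OF G.subspace_carrier]
  G.subspace_diff[OF G.subspace_carrier] G.subspace_scale[OF G.subspace_carrier]
  H.subspace_0[OF H.subspace_carrier] H.subspace_add[OF H.subspace_carrier] H.subspace_neg[OF H.subspace_carrier]
  H.subspace_diff[OF H.subspace_carrier] H.subspace_scale[OF H.subspace_carrier]
  F.subspace_0[OF H.subspace_dual] F.subspace_add[OF H.subspace_dual] F.subspace_neg[OF H.subspace_dual]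
  F.subspace_diff[OF H.subspace_dual] F.subspace_scale[OF H.subspace_dual]

lemma bG_lin: "u \<in> \<GG> \<Longrightarrow> v \<in> \<GG> \<Longrightarrow> w \<in> \<GG> \<Longrightarrow> bG (u + v) w = bG u w + bG v w"
    "u \<in> \<GG> \<Longrightarrow> w \<in> \<GG> \<Longrightarrow> bG (sG c u) w = sG c (bG u w)"
    "u \<in> \<GG> \<Longrightarrow> v \<in> \<GG> \<Longrightarrow> w \<in> \<GG> \<Longrightarrow> bG w (u + v) = bG w u + bG w v"
    "u \<in> \<GG> \<Longrightarrow> w \<in> \<GG> \<Longrightarrow> bG w (sG c u) = sG c (bG w u)"
  and bG_self: "u \<in> \<GG> \<Longrightarrow> bG u u = 0"
  and bG_jacobi: "u \<in> \<GG> \<Longrightarrow> v \<in> \<GG> \<Longrightarrow> w \<in> \<GG> \<Longrightarrow> bG u (bG v w) + bG v (bG w u) + bG w (bG u v) = 0"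
  using lie_base by (simp_all add: lie_algebra_def linear_on_def)

lemma bH_lin: "X \<in> \<HH> \<Longrightarrow> Y \<in> \<HH> \<Longrightarrow> Z \<in> \<HH> \<Longrightarrow> bH (X + Y) Z = bH X Z + bH Y Z"
    "X \<in> \<HH> \<Longrightarrow> Z \<in> \<HH> \<Longrightarrow> bH (sH c X) Z = sH c (bH X Z)"
    "X \<in> \<HH> \<Longrightarrow> Y \<in> \<HH> \<Longrightarrow> Z \<in> \<HH> \<Longrightarrow> bH Z (X + Y) = bH Z X + bH Z Y"
    "X \<in> \<HH> \<Longrightarrow> Z \<in> \<HH> \<Longrightarrow> bH Z (sH c X) = sH c (bH Z X)"
  and bH_self: "X \<in> \<HH> \<Longrightarrow> bH X X = 0"
  and bH_jacobi: "X \<in> \<HH> \<Longrightarrow> Y \<in> \<HH> \<Longrightarrow> Z \<in> \<HH> \<Longrightarrow> bH X (bH Y Z) + bH Y (bH Z X) + bH Z (bH X Y) = 0"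
  using lie_alg by (simp_all add: lie_algebra_def linear_on_def)

lemma \<rho>_lin: "u \<in> \<GG> \<Longrightarrow> v \<in> \<GG> \<Longrightarrow> X \<in> \<HH> \<Longrightarrow> \<rho> (u + v) X = \<rho> u X + \<rho> v X"
    "u \<in> \<GG> \<Longrightarrow> X \<in> \<HH> \<Longrightarrow> \<rho> (sG c u) X = sH c (\<rho> u X)"
    "X \<in> \<HH> \<Longrightarrow> Y \<in> \<HH> \<Longrightarrow> u \<in> \<GG> \<Longrightarrow> \<rho> u (X + Y) = \<rho> u X + \<rho> u Y"
    "X \<in> \<HH> \<Longrightarrow> u \<in> \<GG> \<Longrightarrow> \<rho> u (sH c X) = sH c (\<rho> u X)"
  and \<rho>_bG: "u \<in> \<GG> \<Longrightarrow> v \<in> \<GG> \<Longrightarrow> X \<in> \<HH> \<Longrightarrow> \<rho> (bG u v) X = \<rho> u (\<rho> v X) - \<rho> v (\<rho> u X)"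
  and \<rho>_bH: "u \<in> \<GG> \<Longrightarrow> X \<in> \<HH> \<Longrightarrow> Y \<in> \<HH> \<Longrightarrow> \<rho> u (bH X Y) = bH (\<rho> u X) Y + bH X (\<rho> u Y)"
  using action by (simp_all add: lie_action_by_derivations_def linear_on_def)

lemma zero_lin: "u \<in> \<GG> \<Longrightarrow> bG 0 u = 0" "u \<in> \<GG> \<Longrightarrow> bG u 0 = 0"
    "X \<in> \<HH> \<Longrightarrow> bH 0 X = 0" "X \<in> \<HH> \<Longrightarrow> bH X 0 = 0" "X \<in> \<HH> \<Longrightarrow> \<rho> 0 X = 0" "u \<in> \<GG> \<Longrightarrow> \<rho> u 0 = 0"
  using bG_lin(2)[of 0 u 0] bG_lin(4)[of 0 u 0] bH_lin(2)[of 0 X 0] bH_lin(4)[of 0 X 0]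
    \<rho>_lin(2)[of 0 X 0] \<rho>_lin(4)[of 0 u 0] clos by simp_all

lemma neg_lin: "u \<in> \<GG> \<Longrightarrow> v \<in> \<GG> \<Longrightarrow> bG (- u) v = - bG u v" "u \<in> \<GG> \<Longrightarrow> v \<in> \<GG> \<Longrightarrow> bG v (- u) = - bG v u"
    "X \<in> \<HH> \<Longrightarrow> Y \<in> \<HH> \<Longrightarrow> bH (- X) Y = - bH X Y" "X \<in> \<HH> \<Longrightarrow> Y \<in> \<HH> \<Longrightarrow> bH Y (- X) = - bH Y X"
    "u \<in> \<GG> \<Longrightarrow> X \<in> \<HH> \<Longrightarrow> \<rho> (- u) X = - \<rho> u X" "u \<in> \<GG> \<Longrightarrow> X \<in> \<HH> \<Longrightarrow> \<rho> u (- X) = - \<rho> u X"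
  using bG_lin(2)[of u v "-1"] bG_lin(4)[of u v "-1"] bH_lin(2)[of X Y "-1"] bH_lin(4)[of X Y "-1"]
    \<rho>_lin(2)[of u X "-1"] \<rho>_lin(4)[of X u "-1"] by simp_all

lemma bG_anti:
  assumes "u \<in> \<GG>" "v \<in> \<GG>"
  shows "bG u v = - bG v u"
proof -
  have "bG (u + v) (u + v) = 0"
    using assms by (intro bG_self) (simp add: clos)
  moreover have "bG (u + v) (u + v) = bG u u + bG v u + (bG u v + bG v v)"
    using assms by (simp add: bG_lin clos)
  ultimately show ?thesis
    using assms by (simp add: bG_self eq_neg_iff_add_eq_0 add.commute)
qed

lemma bH_anti:
  assumes "X \<in> \<HH>" "Y \<in> \<HH>"
  shows "bH X Y = - bH Y X"
proof -
  have "bH (X + Y) (X + Y) = 0"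
    using assms by (intro bH_self) (simp add: clos)
  moreover have "bH (X + Y) (X + Y) = bH X X + bH Y X + (bH X Y + bH Y Y)"
    using assms by (simp add: bH_lin clos)
  ultimately show ?thesis
    using assms by (simp add: bH_self eq_neg_iff_add_eq_0 add.commute)
qed

lemma \<delta>_lin: "X \<in> \<HH> \<Longrightarrow> Y \<in> \<HH> \<Longrightarrow> \<delta> (X + Y) \<alpha> \<beta> = \<delta> X \<alpha> \<beta> + \<delta> Y \<alpha> \<beta>"
    "X \<in> \<HH> \<Longrightarrow> \<delta> (sH c X) \<alpha> \<beta> = c * \<delta> X \<alpha> \<beta>"
  using cobracket by (simp_all add: lie_cobracket_def linear_on_def tensor_scale_def)

lemma \<delta>_bilinear: "X \<in> \<HH> \<Longrightarrow> H.bilinear_tensor (\<delta> X)"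
  using cobracket by (simp add: lie_cobracket_def H.ext_square_bilinear)

lemma \<delta>_lin2: "X \<in> \<HH> \<Longrightarrow> \<alpha> \<in> dual (alg S) \<Longrightarrow> \<alpha>' \<in> dual (alg S) \<Longrightarrow> \<beta> \<in> dual (alg S) \<Longrightarrow>
      \<delta> X (\<alpha> + \<alpha>') \<beta> = \<delta> X \<alpha> \<beta> + \<delta> X \<alpha>' \<beta>"
    "X \<in> \<HH> \<Longrightarrow> \<alpha> \<in> dual (alg S) \<Longrightarrow> \<beta> \<in> dual (alg S) \<Longrightarrow> \<delta> X (fun_scale c \<alpha>) \<beta> = c * \<delta> X \<alpha> \<beta>"
    "X \<in> \<HH> \<Longrightarrow> \<alpha> \<in> dual (alg S) \<Longrightarrow> \<alpha>' \<in> dual (alg S) \<Longrightarrow> \<beta> \<in> dual (alg S) \<Longrightarrow>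
      \<delta> X \<beta> (\<alpha> + \<alpha>') = \<delta> X \<beta> \<alpha> + \<delta> X \<beta> \<alpha>'"
    "X \<in> \<HH> \<Longrightarrow> \<alpha> \<in> dual (alg S) \<Longrightarrow> \<beta> \<in> dual (alg S) \<Longrightarrow> \<delta> X \<beta> (fun_scale c \<alpha>) = c * \<delta> X \<beta> \<alpha>"
  using \<delta>_bilinear[of X] by (simp_all add: H.bilinear_tensor_def linear_on_def)

lemma \<delta>_outside: "X \<in> \<HH> \<Longrightarrow> \<alpha> \<notin> dual (alg S) \<or> \<beta> \<notin> dual (alg S) \<Longrightarrow> \<delta> X \<alpha> \<beta> = 0"
  using \<delta>_bilinear[of X] unfolding H.bilinear_tensor_def by blast

lemma \<delta>_zero: "\<delta> 0 \<alpha> \<beta> = 0" "X \<in> \<HH> \<Longrightarrow> \<alpha> \<in> dual (alg S) \<Longrightarrow> \<delta> X 0 \<alpha> = 0"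
    "X \<in> \<HH> \<Longrightarrow> \<alpha> \<in> dual (alg S) \<Longrightarrow> \<delta> X \<alpha> 0 = 0"
  using \<delta>_lin(2)[of 0 0 \<alpha> \<beta>] \<delta>_lin2(2)[of X 0 \<alpha> 0] \<delta>_lin2(4)[of X 0 \<alpha> 0] clos by simp_all

abbreviation "tb \<equiv> lbracket (transpose_struct (alg S) \<delta>)"

lemma tb_apply: "X \<in> \<HH> \<Longrightarrow> tb \<alpha> \<beta> X = \<delta> X \<alpha> \<beta>" and tb_outside: "X \<notin> \<HH> \<Longrightarrow> tb \<alpha> \<beta> X = 0"
  by (auto simp: transpose_struct_def)

lemma tb_closed: "\<alpha> \<in> dual (alg S) \<Longrightarrow> \<beta> \<in> dual (alg S) \<Longrightarrow> tb \<alpha> \<beta> \<in> dual (alg S)"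
  and tb_self: "\<alpha> \<in> dual (alg S) \<Longrightarrow> tb \<alpha> \<alpha> = 0"
  and tb_jacobi: "\<alpha> \<in> dual (alg S) \<Longrightarrow> \<beta> \<in> dual (alg S) \<Longrightarrow> \<gamma> \<in> dual (alg S) \<Longrightarrow>
    tb \<alpha> (tb \<beta> \<gamma>) + tb \<beta> (tb \<gamma> \<alpha>) + tb \<gamma> (tb \<alpha> \<beta>) = 0"
proof -
  have c: "lcarrier (transpose_struct (alg S) \<delta>) = dual (alg S)" by (simp add: transpose_struct_def)
  have "lie_algebra (transpose_struct (alg S) \<delta>)"
    using cobracket by (simp add: lie_cobracket_def)
  then show "\<alpha> \<in> dual (alg S) \<Longrightarrow> \<beta> \<in> dual (alg S) \<Longrightarrow> tb \<alpha> \<beta> \<in> dual (alg S)"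
    "\<alpha> \<in> dual (alg S) \<Longrightarrow> tb \<alpha> \<alpha> = 0"
    "\<alpha> \<in> dual (alg S) \<Longrightarrow> \<beta> \<in> dual (alg S) \<Longrightarrow> \<gamma> \<in> dual (alg S) \<Longrightarrow>
    tb \<alpha> (tb \<beta> \<gamma>) + tb \<beta> (tb \<gamma> \<alpha>) + tb \<gamma> (tb \<alpha> \<beta>) = 0"
    unfolding lie_algebra_def c by blast+
qed

lemma \<delta>_self: "X \<in> \<HH> \<Longrightarrow> \<alpha> \<in> dual (alg S) \<Longrightarrow> \<delta> X \<alpha> \<alpha> = 0"
  using fun_cong[OF tb_self, of \<alpha> X] by (simp add: tb_apply)

lemma \<delta>_anti:
  assumes "X \<in> \<HH>" "\<alpha> \<in> dual (alg S)" "\<beta> \<in> dual (alg S)"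
  shows "\<delta> X \<alpha> \<beta> = - \<delta> X \<beta> \<alpha>"
proof -
  have "\<delta> X (\<alpha> + \<beta>) (\<alpha> + \<beta>) = 0"
    using assms by (intro \<delta>_self) (simp_all add: clos)
  moreover have "\<delta> X (\<alpha> + \<beta>) (\<alpha> + \<beta>) = \<delta> X \<alpha> \<alpha> + \<delta> X \<beta> \<alpha> + (\<delta> X \<alpha> \<beta> + \<delta> X \<beta> \<beta>)"
    using assms by (simp add: \<delta>_lin2 clos)
  ultimately show ?thesis
    using assms by (simp add: \<delta>_self eq_neg_iff_add_eq_0 add.commute)
qed

lemma pullback_dual:
  assumes "\<alpha> \<in> dual (alg S)"
  shows "X \<in> \<HH> \<Longrightarrow> pullback (alg S) (bH X) \<alpha> \<in> dual (alg S)"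
    "v \<in> \<GG> \<Longrightarrow> pullback (alg S) (\<rho> v) \<alpha> \<in> dual (alg S)"
    "X \<in> \<HH> \<Longrightarrow> pullback (base S) (\<lambda>v. \<rho> v X) \<alpha> \<in> dual (base S)"
  using assms
  by (simp_all add: dual_def[of "alg S"] dual_def[of "base S"] linear_on_def pullback_def bH_lin \<rho>_lin clos)

lemma \<delta>_invariant:
  assumes "v \<in> \<GG>" "X \<in> \<HH>" "\<alpha> \<in> dual (alg S)" "\<beta> \<in> dual (alg S)"
  shows "\<delta> (\<rho> v X) \<alpha> \<beta> =
    \<delta> X (pullback (alg S) (\<rho> v) \<alpha>) \<beta> + \<delta> X \<alpha> (pullback (alg S) (\<rho> v) \<beta>)"
  using assms by (simp add: cobr_invariant H.tensor_deriv_apply)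

text \<open>Any presentation of \<tau> serves to enter the axiom, and \<open>wedge_sum_apply\<close>
  removes it again. The result mentions no basis and matches \<open>K_jac_AACC\<close> term by
  term.\<close>

lemma compat_apply:
  assumes XY: "X \<in> \<HH>" "Y \<in> \<HH>" and ab: "\<alpha> \<in> dual (alg S)" "\<beta> \<in> dual (alg S)"
  shows "\<delta> Y (pullback (alg S) (bH X) \<alpha>) \<beta> + \<delta> Y \<alpha> (pullback (alg S) (bH X) \<beta>)
    - \<delta> X (pullback (alg S) (bH Y) \<alpha>) \<beta> - \<delta> X \<alpha> (pullback (alg S) (bH Y) \<beta>) - \<delta> (bH X Y) \<alpha> \<beta>
    = \<tau> (pullback (base S) (\<lambda>v. \<rho> v X) \<alpha>) (pullback (base S) (\<lambda>v. \<rho> v Y) \<beta>)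
      - \<tau> (pullback (base S) (\<lambda>v. \<rho> v X) \<beta>) (pullback (base S) (\<lambda>v. \<rho> v Y) \<alpha>)"
proof -
  have "\<tau> \<in> tensor_square (base S)"
    using form by (simp add: nondegenerate_invariant_def sym_square_def)
  then obtain E c where E: "tensor_coeffs (base S) \<tau> E c"
    by (rule G.tensor_coeffs_ex)
  have "(\<Sum>e\<in>E. \<Sum>e'\<in>E. tensor_scale (c e e') (wedge (alg S) (\<rho> e X) (\<rho> e' Y))) \<alpha> \<beta> =
      \<tau> (pullback (base S) (\<lambda>v. \<rho> v X) \<alpha>) (pullback (base S) (\<lambda>v. \<rho> v Y) \<beta>)
      - \<tau> (pullback (base S) (\<lambda>v. \<rho> v X) \<beta>) (pullback (base S) (\<lambda>v. \<rho> v Y) \<alpha>)"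
    by (rule G.wedge_sum_apply[OF E ab pullback_dual(3) XY])
  then show ?thesis
    using fun_cong[OF fun_cong[OF compat[OF E XY], of \<alpha>], of \<beta>] ab
    by (simp add: H.tensor_deriv_apply diff_diff_eq)
qed

section \<open>The invariant form on \<gg> recovered from its inverse\<close>

lemma \<tau>_sym: "\<tau> \<alpha> \<beta> = \<tau> \<beta> \<alpha>"
  and \<tau>_bilinear: "G.bilinear_tensor \<tau>"
  and \<tau>_nondeg: "\<alpha> \<in> dual (base S) \<Longrightarrow> (\<And>\<beta>. \<beta> \<in> dual (base S) \<Longrightarrow> \<tau> \<alpha> \<beta> = 0) \<Longrightarrow> \<alpha> = 0"
  and \<tau>_deriv: "v \<in> \<GG> \<Longrightarrow> tensor_deriv (base S) (bG v) \<tau> = 0"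
  using form G.tensor_square_bilinear by (simp_all add: nondegenerate_invariant_def sym_square_def)

lemma \<tau>_outside: "\<alpha> \<notin> dual (base S) \<or> \<beta> \<notin> dual (base S) \<Longrightarrow> \<tau> \<alpha> \<beta> = 0"
  using \<tau>_bilinear unfolding G.bilinear_tensor_def by blast

lemma \<tau>_raise:
  assumes "\<alpha> \<in> dual (base S)"
  shows "\<exists>u\<in>\<GG>. \<forall>\<beta>\<in>dual (base S). \<tau> \<beta> \<alpha> = \<beta> u"
proof -
  have "linear_on fun_scale (*) (dual (base S)) (\<lambda>\<beta>. \<tau> \<beta> \<alpha>)"
    using \<tau>_bilinear assms by (simp add: G.bilinear_tensor_def)
  then obtain u where "u \<in> \<GG>" "\<And>\<beta>. \<beta> \<in> dual (base S) \<Longrightarrow> \<beta> u = \<tau> \<beta> \<alpha>"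
    by (rule G.bidual) blast
  then show ?thesis by auto
qed

text \<open>The vectors obtained by contracting \<tau> with a functional form a subspace. A
  functional that vanishes on this subspace is in the radical of \<tau>, hence zero, so by
  separation the subspace contains x.\<close>

lemma lower_ex:
  assumes x: "x \<in> \<GG>"
  shows "\<exists>\<alpha>\<in>dual (base S). \<forall>\<beta>\<in>dual (base S). \<tau> \<beta> \<alpha> = \<beta> x"
proof (rule ccontr)
  interpret FG: vector_space "fun_scale :: 'k \<Rightarrow> ('g \<Rightarrow> 'k) \<Rightarrow> _" by (rule vector_space_fun_scale)
  let ?I = "{u \<in> \<GG>. \<exists>\<alpha>\<in>dual (base S). \<forall>\<beta>\<in>dual (base S). \<tau> \<beta> \<alpha> = \<beta> u}"
  assume "\<not> ?thesis"
  then have "x \<notin> ?I" by simp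
  moreover have "G.subspace ?I"
    unfolding G.subspace_def
  proof (intro conjI ballI allI)
    have "0 \<in> dual (base S)" by (rule FG.subspace_0[OF G.subspace_dual])
    moreover have "\<tau> \<beta> 0 = 0" if "\<beta> \<in> dual (base S)" for \<beta>
      using that \<tau>_bilinear G.subspace_dual
      by (intro linear_on_zero[OF FG.module_axioms module_mult]) (auto simp: G.bilinear_tensor_def)
    ultimately show "0 \<in> ?I"
      by (auto simp: G.dual_0 clos)
  next
    fix u v assume "u \<in> ?I" "v \<in> ?I"
    then obtain \<alpha> \<beta> where *: "\<alpha> \<in> dual (base S)" "\<forall>\<gamma>\<in>dual (base S). \<tau> \<gamma> \<alpha> = \<gamma> u"
      "\<beta> \<in> dual (base S)" "\<forall>\<gamma>\<in>dual (base S). \<tau> \<gamma> \<beta> = \<gamma> v" "u \<in> \<GG>" "v \<in> \<GG>" by auto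
    have "\<alpha> + \<beta> \<in> dual (base S)" "\<forall>\<gamma>\<in>dual (base S). \<tau> \<gamma> (\<alpha> + \<beta>) = \<gamma> (u + v)"
      using * \<tau>_bilinear FG.subspace_add[OF G.subspace_dual]
      by (simp_all add: G.bilinear_tensor_def linear_on_def G.dual_add)
    moreover have "u + v \<in> \<GG>" using * by (simp add: clos)
    ultimately show "u + v \<in> ?I" by blast
  next
    fix c u assume "u \<in> ?I"
    then obtain \<alpha> where *: "\<alpha> \<in> dual (base S)" "\<forall>\<gamma>\<in>dual (base S). \<tau> \<gamma> \<alpha> = \<gamma> u" "u \<in> \<GG>" by auto
    have "fun_scale c \<alpha> \<in> dual (base S)" "\<forall>\<gamma>\<in>dual (base S). \<tau> \<gamma> (fun_scale c \<alpha>) = \<gamma> (sG c u)"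
      using * \<tau>_bilinear FG.subspace_scale[OF G.subspace_dual]
      by (simp_all add: G.bilinear_tensor_def linear_on_def G.dual_scale)
    moreover have "sG c u \<in> \<GG>" using * by (simp add: clos)
    ultimately show "sG c u \<in> ?I" by blast
  qed
  ultimately obtain \<gamma> where \<gamma>: "\<gamma> \<in> dual (base S)" "\<And>u. u \<in> ?I \<Longrightarrow> \<gamma> u = 0" "\<gamma> x = 1"
    using G.dual_separating[OF x] by blast
  have "\<tau> \<gamma> \<alpha> = 0" if \<alpha>: "\<alpha> \<in> dual (base S)" for \<alpha>
  proof -
    obtain u where u: "u \<in> \<GG>" "\<forall>\<beta>\<in>dual (base S). \<tau> \<beta> \<alpha> = \<beta> u"
      using \<tau>_raise[OF \<alpha>] by blast
    then have "u \<in> ?I" using \<alpha> by blast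
    then show ?thesis using \<gamma> u by simp
  qed
  then have "\<gamma> = 0" by (rule \<tau>_nondeg[OF \<gamma>(1)])
  then show False using \<gamma>(3) by simp
qed

definition lower :: "'g \<Rightarrow> 'g \<Rightarrow> 'k" where
  "lower u = (SOME \<alpha>. \<alpha> \<in> dual (base S) \<and> (\<forall>\<beta>\<in>dual (base S). \<tau> \<beta> \<alpha> = \<beta> u))"

lemma lower: "u \<in> \<GG> \<Longrightarrow> lower u \<in> dual (base S)"
    "u \<in> \<GG> \<Longrightarrow> \<beta> \<in> dual (base S) \<Longrightarrow> \<tau> \<beta> (lower u) = \<beta> u"
proof -
  assume "u \<in> \<GG>"
  then have "\<exists>\<alpha>. \<alpha> \<in> dual (base S) \<and> (\<forall>\<beta>\<in>dual (base S). \<tau> \<beta> \<alpha> = \<beta> u)"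
    using lower_ex by blast
  from someI_ex[OF this] show "lower u \<in> dual (base S)" "\<beta> \<in> dual (base S) \<Longrightarrow> \<tau> \<beta> (lower u) = \<beta> u"
    unfolding lower_def by blast+
qed

lemma lower_surj:
  assumes "\<alpha> \<in> dual (base S)"
  obtains u where "u \<in> \<GG>" "\<alpha> = lower u"
proof -
  interpret FG: vector_space "fun_scale :: 'k \<Rightarrow> ('g \<Rightarrow> 'k) \<Rightarrow> _" by (rule vector_space_fun_scale)
  obtain u where u: "u \<in> \<GG>" "\<forall>\<beta>\<in>dual (base S). \<tau> \<beta> \<alpha> = \<beta> u"
    using \<tau>_raise[OF assms] by blast
  have d: "fun_scale (-1) (lower u) \<in> dual (base S)" "\<alpha> + fun_scale (-1) (lower u) \<in> dual (base S)"
    using assms lower(1)[OF u(1)] FG.subspace_scale[OF G.subspace_dual] FG.subspace_add[OF G.subspace_dual]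
    by blast+
  have "\<alpha> + fun_scale (-1) (lower u) = 0"
  proof (rule \<tau>_nondeg)
    fix \<beta> assume \<beta>: "\<beta> \<in> dual (base S)"
    have "\<tau> \<beta> (\<alpha> + fun_scale (-1) (lower u)) = \<tau> \<beta> \<alpha> + (-1) * \<tau> \<beta> (lower u)"
      using \<tau>_bilinear \<beta> assms lower(1)[OF u(1)] d
      unfolding G.bilinear_tensor_def linear_on_def by (simp del: FG.scale_minus_left)
    then show "\<tau> (\<alpha> + fun_scale (-1) (lower u)) \<beta> = 0"
      using u lower(2)[OF u(1) \<beta>] \<beta> by (subst \<tau>_sym) simp
  qed (rule d(2))
  then have "\<alpha> = lower u"
    by (simp add: FG.scale_minus_left)
  then show thesis using u(1) that by blast
qed

text \<open>The same function in two readings: \<open>lower u\<close> is a functional on \<gg>, and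
  \<kappa> is the bilinear form whose inverse is \<tau>.\<close>

abbreviation "\<kappa> \<equiv> lower"

lemma \<kappa>_sym: "u \<in> \<GG> \<Longrightarrow> v \<in> \<GG> \<Longrightarrow> \<kappa> u v = \<kappa> v u"
  using lower \<tau>_sym[of "lower u" "lower v"] by simp

lemma \<tau>_lower: "u \<in> \<GG> \<Longrightarrow> v \<in> \<GG> \<Longrightarrow> \<tau> (lower u) (lower v) = \<kappa> u v"
  using lower by simp

lemma \<kappa>_lin: "u \<in> \<GG> \<Longrightarrow> v \<in> \<GG> \<Longrightarrow> w \<in> \<GG> \<Longrightarrow> \<kappa> u (v + w) = \<kappa> u v + \<kappa> u w"
    "u \<in> \<GG> \<Longrightarrow> v \<in> \<GG> \<Longrightarrow> w \<in> \<GG> \<Longrightarrow> \<kappa> (v + w) u = \<kappa> v u + \<kappa> w u"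
    "u \<in> \<GG> \<Longrightarrow> v \<in> \<GG> \<Longrightarrow> \<kappa> u (sG c v) = c * \<kappa> u v"
    "u \<in> \<GG> \<Longrightarrow> v \<in> \<GG> \<Longrightarrow> \<kappa> (sG c v) u = c * \<kappa> v u"
    "u \<in> \<GG> \<Longrightarrow> \<kappa> u 0 = 0" "u \<in> \<GG> \<Longrightarrow> \<kappa> 0 u = 0"
    "u \<in> \<GG> \<Longrightarrow> v \<in> \<GG> \<Longrightarrow> \<kappa> u (- v) = - \<kappa> u v" "u \<in> \<GG> \<Longrightarrow> v \<in> \<GG> \<Longrightarrow> \<kappa> (- v) u = - \<kappa> v u"
proof -
  show 1: "u \<in> \<GG> \<Longrightarrow> v \<in> \<GG> \<Longrightarrow> w \<in> \<GG> \<Longrightarrow> \<kappa> u (v + w) = \<kappa> u v + \<kappa> u w"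
    "u \<in> \<GG> \<Longrightarrow> v \<in> \<GG> \<Longrightarrow> \<kappa> u (sG c v) = c * \<kappa> u v"
    "u \<in> \<GG> \<Longrightarrow> \<kappa> u 0 = 0" "u \<in> \<GG> \<Longrightarrow> v \<in> \<GG> \<Longrightarrow> \<kappa> u (- v) = - \<kappa> u v" for u v w
    using lower by (simp_all add: G.dual_add G.dual_scale G.dual_0 G.dual_minus)
  show "u \<in> \<GG> \<Longrightarrow> v \<in> \<GG> \<Longrightarrow> w \<in> \<GG> \<Longrightarrow> \<kappa> (v + w) u = \<kappa> v u + \<kappa> w u"
    "u \<in> \<GG> \<Longrightarrow> v \<in> \<GG> \<Longrightarrow> \<kappa> (sG c v) u = c * \<kappa> v u"
    "u \<in> \<GG> \<Longrightarrow> \<kappa> 0 u = 0" "u \<in> \<GG> \<Longrightarrow> v \<in> \<GG> \<Longrightarrow> \<kappa> (- v) u = - \<kappa> v u"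
    by (simp_all add: \<kappa>_sym[of _ u] 1 clos)
qed

lemma \<kappa>_nondeg:
  assumes "u \<in> \<GG>" "\<And>v. v \<in> \<GG> \<Longrightarrow> \<kappa> u v = 0"
  shows "u = 0"
proof (rule G.dual_zero_imp[OF assms(1)])
  fix \<alpha> assume "\<alpha> \<in> dual (base S)"
  then obtain v where "v \<in> \<GG>" "\<alpha> = lower v" by (rule lower_surj)
  then show "\<alpha> u = 0" using assms(1) assms(2)[of v] \<kappa>_sym[of u v] by simp
qed

lemma \<kappa>_inv:
  assumes "u \<in> \<GG>" "v \<in> \<GG>" "w \<in> \<GG>"
  shows "\<kappa> (bG u v) w + \<kappa> v (bG u w) = 0"
proof -
  have pb: "pullback (base S) (bG u) (lower x) \<in> dual (base S)" if "x \<in> \<GG>" for x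
    using lower(1)[OF that] assms(1)
    by (simp add: dual_def linear_on_def pullback_def bG_lin clos)
  have "tensor_deriv (base S) (bG u) \<tau> (lower v) (lower w) = 0"
    using assms by (simp add: \<tau>_deriv)
  then have "\<tau> (pullback (base S) (bG u) (lower v)) (lower w) + \<tau> (pullback (base S) (bG u) (lower w)) (lower v) = 0"
    using assms \<tau>_sym[of "lower v"] by (simp add: G.tensor_deriv_apply lower)
  then show ?thesis
    using assms pb \<kappa>_sym[of w "bG u v"] by (simp add: lower pullback_def clos add.commute)
qed

section \<open>Underlying space and pairing of the double\<close>

definition carr :: "('h \<times> 'g \<times> ('h \<Rightarrow> 'k)) set" where
  "carr = \<HH> \<times> \<GG> \<times> dual (alg S)"

definition sc :: "'k \<Rightarrow> 'h \<times> 'g \<times> ('h \<Rightarrow> 'k) \<Rightarrow> 'h \<times> 'g \<times> ('h \<Rightarrow> 'k)" where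
  "sc c = (\<lambda>(X, u, \<alpha>). (sH c X, sG c u, fun_scale c \<alpha>))"

definition pair :: "'h \<times> 'g \<times> ('h \<Rightarrow> 'k) \<Rightarrow> 'h \<times> 'g \<times> ('h \<Rightarrow> 'k) \<Rightarrow> 'k" where
  "pair = (\<lambda>(X, u, \<alpha>) (Y, v, \<beta>). \<alpha> Y + \<beta> X + \<kappa> u v)"

text \<open>The form \<open>\<langle>[x, y], z\<rangle>\<close> is dictated by the structure of \<open>\<hh>\<close>, \<open>\<gg>\<close> and \<open>\<hh>\<^sup>*\<close> together with
  invariance; the bracket is then recovered from it by non-degeneracy of the pairing.\<close>

definition triple_form ::
  "'h \<times> 'g \<times> ('h \<Rightarrow> 'k) \<Rightarrow> 'h \<times> 'g \<times> ('h \<Rightarrow> 'k) \<Rightarrow> 'h \<times> 'g \<times> ('h \<Rightarrow> 'k) \<Rightarrow> 'k" where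
  "triple_form = (\<lambda>(X, u, \<alpha>) (Y, v, \<beta>) (Z, w, \<gamma>).
     \<gamma> (bH X Y) + \<alpha> (bH Y Z) + \<beta> (bH Z X)
     + \<gamma> (\<rho> u Y) - \<gamma> (\<rho> v X) + \<beta> (\<rho> w X) - \<beta> (\<rho> u Z) + \<alpha> (\<rho> v Z) - \<alpha> (\<rho> w Y)
     + \<kappa> (bG u v) w + \<delta> X \<gamma> \<beta> + \<delta> Y \<alpha> \<gamma> + \<delta> Z \<beta> \<alpha>)"

definition brd :: "'h \<times> 'g \<times> ('h \<Rightarrow> 'k) \<Rightarrow> 'h \<times> 'g \<times> ('h \<Rightarrow> 'k) \<Rightarrow> 'h \<times> 'g \<times> ('h \<Rightarrow> 'k)" where
  "brd x y = (SOME w. w \<in> carr \<and> (\<forall>z\<in>carr. pair w z = triple_form x y z))"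

definition Qd :: "('k, 'h \<times> 'g \<times> ('h \<Rightarrow> 'k)) quadruple" where
  "Qd = \<lparr>double = \<lparr>lscale = sc, lcarrier = carr, lbracket = brd\<rparr>, pairing = pair,
     part_a = \<HH> \<times> {0} \<times> {0}, part_b = {0} \<times> \<GG> \<times> {0}, part_c = {0} \<times> {0} \<times> dual (alg S)\<rparr>"

lemma Qd_simps [simp]:
  "lscale (double Qd) = sc" "lcarrier (double Qd) = carr" "lbracket (double Qd) = brd" "pairing Qd = pair"
  "part_a Qd = \<HH> \<times> {0} \<times> {0}" "part_b Qd = {0} \<times> \<GG> \<times> {0}" "part_c Qd = {0} \<times> {0} \<times> dual (alg S)"
  by (simp_all add: Qd_def)

lemma vector_space_sc: "vector_space sc"
  by unfold_locales
    (auto simp: sc_def G.scale_right_distrib G.scale_left_distrib H.scale_right_distrib H.scale_left_distrib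
      F.scale_right_distrib F.scale_left_distrib)

sublocale P: vector_space sc
  by (rule vector_space_sc)

lemma subspace_carr: "P.subspace carr"
  by (auto simp: P.subspace_def carr_def sc_def clos zero_prod_def)

lemma finite_span_carr: "\<exists>E. finite E \<and> carr = P.span E"
proof -
  obtain E1 where E1: "finite E1" "\<HH> = H.span E1"
    using H.finite_dim by (auto simp: finite_dim_def)
  obtain E2 where E2: "finite E2" "\<GG> = G.span E2"
    using G.finite_dim by (auto simp: finite_dim_def)
  obtain E3 where E3: "finite E3" "dual (alg S) = F.span E3"
    using H.finite_span_dual by auto
  let ?E = "(\<lambda>X. (X, 0, 0)) ` E1 \<union> (\<lambda>u. (0, u, 0)) ` E2 \<union> (\<lambda>\<alpha>. (0, 0, \<alpha>)) ` E3"
  have h1: "module_hom sH sc (\<lambda>X. (X, 0, 0))" and h2: "module_hom sG sc (\<lambda>u. (0, u, 0))"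
    and h3: "module_hom fun_scale sc (\<lambda>\<alpha>. (0, 0, \<alpha>))"
    by (auto simp: module_hom_iff H.module_axioms G.module_axioms F.module_axioms P.module_axioms sc_def)
  have "carr \<subseteq> P.span ?E"
  proof
    fix x assume "x \<in> carr"
    then obtain X u \<alpha> where x: "x = (X, u, \<alpha>)" "X \<in> \<HH>" "u \<in> \<GG>" "\<alpha> \<in> dual (alg S)"
      by (auto simp: carr_def)
    have "(X, 0, 0) \<in> P.span ((\<lambda>X. (X, 0, 0)) ` E1)" "(0, u, 0) \<in> P.span ((\<lambda>u. (0, u, 0)) ` E2)"
      "(0, 0, \<alpha>) \<in> P.span ((\<lambda>\<alpha>. (0, 0, \<alpha>)) ` E3)"
      unfolding module_hom.span_image[OF h1] module_hom.span_image[OF h2] module_hom.span_image[OF h3]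
      using x E1 E2 E3 by simp_all
    moreover have "P.span ((\<lambda>X. (X, 0, 0)) ` E1) \<subseteq> P.span ?E" "P.span ((\<lambda>u. (0, u, 0)) ` E2) \<subseteq> P.span ?E"
      "P.span ((\<lambda>\<alpha>. (0, 0, \<alpha>)) ` E3) \<subseteq> P.span ?E"
      by (rule P.span_mono; auto)+
    ultimately have "(X, 0, 0) + (0, u, 0) + (0, 0, \<alpha>) \<in> P.span ?E"
      by (intro P.span_add) blast+
    then show "x \<in> P.span ?E" by (simp add: x)
  qed
  moreover have "finite ?E"
    using E1 E2 E3 by simp
  ultimately show ?thesis
    using P.subspace_finite_span[OF subspace_carr, of ?E] by metis
qed

sublocale D: fd_struct "double Qd"
  by (rule fd_struct.intro) (use subspace_carr finite_span_carr in \<open>simp_all add: vector_space_sc finite_dim_def\<close>)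

lemma carr_add: "x \<in> carr \<Longrightarrow> y \<in> carr \<Longrightarrow> x + y \<in> carr"
  and carr_scale: "x \<in> carr \<Longrightarrow> sc c x \<in> carr"
  using subspace_carr by (auto simp: P.subspace_def)

lemma pair_sym: "x \<in> carr \<Longrightarrow> y \<in> carr \<Longrightarrow> pair x y = pair y x"
  by (auto simp: pair_def carr_def \<kappa>_sym)

lemma pair_linear: "x \<in> carr \<Longrightarrow> linear_on sc (*) carr (pair x)"
  by (auto simp: linear_on_def pair_def carr_def sc_def \<kappa>_lin H.dual_add H.dual_scale fun_scale_apply
      distrib_left)

lemma pair_linear_left: "x \<in> carr \<Longrightarrow> linear_on sc (*) carr (\<lambda>y. pair y x)"
  using pair_linear[of x] by (simp add: linear_on_def pair_sym[of _ x] carr_add carr_scale)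

lemma pair_nondeg:
  assumes x: "x \<in> carr" and 0: "\<And>y. y \<in> carr \<Longrightarrow> pair x y = 0"
  shows "x = 0"
proof -
  obtain X u \<alpha> where x: "x = (X, u, \<alpha>)" "X \<in> \<HH>" "u \<in> \<GG>" "\<alpha> \<in> dual (alg S)"
    using x by (auto simp: carr_def)
  have "X = 0"
  proof (rule H.dual_zero_imp)
    fix \<beta> assume "\<beta> \<in> dual (alg S)"
    then show "\<beta> X = 0"
      using 0[of "(0, 0, \<beta>)"] x by (simp add: carr_def pair_def clos H.dual_0 \<kappa>_lin)
  qed (rule x(2))
  moreover have "u = 0"
  proof (rule \<kappa>_nondeg)
    fix v assume "v \<in> \<GG>"
    then show "\<kappa> u v = 0"
      using 0[of "(0, v, 0)"] x by (simp add: carr_def pair_def clos H.dual_0)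
  qed (rule x(3))
  moreover have "\<alpha> = 0"
  proof (rule H.dual_eqI)
    fix Y assume "Y \<in> \<HH>"
    then show "\<alpha> Y = 0 Y"
      using 0[of "(Y, 0, 0)"] x by (simp add: carr_def pair_def clos \<kappa>_lin)
  qed (use x clos in simp_all)
  ultimately show ?thesis
    by (simp add: x zero_prod_def)
qed

lemma pair_eqI:
  assumes "x \<in> carr" "y \<in> carr" "\<And>z. z \<in> carr \<Longrightarrow> pair x z = pair y z"
  shows "x = y"
proof -
  have "x - y = 0"
  proof (rule pair_nondeg)
    fix z assume z: "z \<in> carr"
    have "pair (x + sc (-1) y) z = pair x z + (-1) * pair y z"
      using pair_linear_left[OF z] assms by (simp add: linear_on_def carr_scale del: P.scale_minus_left)
    then show "pair (x - y) z = 0"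
      using assms(3)[OF z] by simp
  qed (use assms P.subspace_diff[OF subspace_carr] in auto)
  then show ?thesis by simp
qed

text \<open>This gives \<open>brd\<close> its values: on the finite-dimensional double the
  non-degenerate pairing represents every functional, in particular
  \<open>triple_form x y\<close>.\<close>

lemma pair_represent:
  assumes "linear_on sc (*) carr f"
  shows "\<exists>w. w \<in> carr \<and> (\<forall>z\<in>carr. pair w z = f z)"
proof -
  have bij: "bij_betw (flat (double Qd) pair) carr (dual (double Qd))"
  proof (rule D.bij_betw_flat[OF _ P.module_axioms])
    show "P.subspace carr" by (rule subspace_carr)
    show "x = 0" if "x \<in> lcarrier (double Qd)" "\<And>w. w \<in> carr \<Longrightarrow> pair w x = 0" for x
      using that pair_nondeg[of x] pair_sym[of x] by simp
  qed (use pair_linear pair_linear_left pair_nondeg in simp_all)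
  have "(\<lambda>x. if x \<in> carr then f x else 0) \<in> dual (double Qd)"
    using assms by (simp add: dual_def linear_on_def carr_add carr_scale)
  then have "(\<lambda>x. if x \<in> carr then f x else 0) \<in> flat (double Qd) pair ` carr"
    by (simp add: bij_betw_imp_surj_on[OF bij])
  then obtain w where w: "w \<in> carr" "(\<lambda>x. if x \<in> carr then f x else 0) = flat (double Qd) pair w"
    by (elim imageE)
  have "pair w z = f z" if "z \<in> carr" for z
    using fun_cong[OF w(2), of z] that by (simp add: flat_def)
  then show ?thesis using w(1) by blast
qed

section \<open>The bracket of the double\<close>

lemma triple_form_linear:
  assumes "x \<in> carr" "y \<in> carr"
  shows "linear_on sc (*) carr (triple_form x y)"
  using assms
  by (auto simp: linear_on_def triple_form_def carr_def sc_def clos bH_lin bG_lin \<rho>_lin \<kappa>_lin \<delta>_lin \<delta>_lin2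
      H.dual_add H.dual_scale fun_scale_apply algebra_simps)

text \<open>The cyclic symmetry is visible term by term, except for the summand from \<gg>, which
  needs invariance of \<kappa>. It carries linearity from the last argument to the others and, with
  skewness in the first two, yields the invariance of the pairing.\<close>

lemma triple_form_cyc:
  assumes "x \<in> carr" "y \<in> carr" "z \<in> carr"
  shows "triple_form x y z = triple_form y z x"
proof -
  have "\<kappa> (bG u v) w = \<kappa> (bG v w) u" if "u \<in> \<GG>" "v \<in> \<GG>" "w \<in> \<GG>" for u v w
    using that \<kappa>_inv[of v u w] bG_anti[of u v] \<kappa>_sym[of "bG v w" u]
    by (simp add: \<kappa>_lin clos add_eq_0_iff2)
  then show ?thesis
    using assms by (auto simp: triple_form_def carr_def)
qed

lemma triple_form_self:
  assumes "x \<in> carr" "z \<in> carr"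
  shows "triple_form x x z = 0"
proof -
  obtain X u \<alpha> Z w \<gamma> where x: "x = (X, u, \<alpha>)" "X \<in> \<HH>" "u \<in> \<GG>" "\<alpha> \<in> dual (alg S)"
    and z: "z = (Z, w, \<gamma>)" "Z \<in> \<HH>" "w \<in> \<GG>" "\<gamma> \<in> dual (alg S)"
    using assms by (auto simp: carr_def)
  then show ?thesis
    using bH_anti[of X Z] \<delta>_anti[of X \<alpha> \<gamma>]
    by (simp add: triple_form_def bH_self bG_self \<delta>_self \<kappa>_lin H.dual_0 H.dual_minus clos)
qed

lemma brd_closed: "x \<in> carr \<Longrightarrow> y \<in> carr \<Longrightarrow> brd x y \<in> carr"
  and pair_brd: "x \<in> carr \<Longrightarrow> y \<in> carr \<Longrightarrow> z \<in> carr \<Longrightarrow> pair (brd x y) z = triple_form x y z"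
  using someI_ex[OF pair_represent[OF triple_form_linear, of x y]] unfolding brd_def by blast+

lemma brd_eqI:
  assumes "x \<in> carr" "y \<in> carr" "w \<in> carr" "\<And>z. z \<in> carr \<Longrightarrow> pair w z = triple_form x y z"
  shows "brd x y = w"
  using assms by (intro pair_eqI) (simp_all add: brd_closed pair_brd)

lemma triple_form_lin2:
  assumes "x \<in> carr" "z \<in> carr"
  shows "linear_on sc (*) carr (\<lambda>y. triple_form x y z)" "linear_on sc (*) carr (\<lambda>y. triple_form y x z)"
proof -
  have "triple_form x y z = triple_form z x y" if "y \<in> carr" for y
    using that assms triple_form_cyc[of z x y] by simp
  then show "linear_on sc (*) carr (\<lambda>y. triple_form x y z)"
    using triple_form_linear[of z x] assms by (simp add: linear_on_def carr_add carr_scale)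
  have "triple_form y x z = triple_form x z y" if "y \<in> carr" for y
    using that assms triple_form_cyc[of y x z] by simp
  then show "linear_on sc (*) carr (\<lambda>y. triple_form y x z)"
    using triple_form_linear[of x z] assms by (simp add: linear_on_def carr_add carr_scale)
qed

lemma triple_form_swap:
  assumes "x \<in> carr" "y \<in> carr" "z \<in> carr"
  shows "triple_form x y z = - triple_form y x z"
proof -
  have "triple_form (x + y) (x + y) z = 0"
    using assms by (intro triple_form_self carr_add)
  moreover have "triple_form (x + y) (x + y) z =
      triple_form x x z + triple_form y x z + (triple_form x y z + triple_form y y z)"
    using triple_form_lin2(1)[of "x + y" z] triple_form_lin2(2)[of x z] triple_form_lin2(2)[of y z] assms
    by (simp add: linear_on_def carr_add)
  ultimately show ?thesis
    using assms by (simp add: triple_form_self eq_neg_iff_add_eq_0 add.commute)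
qed

lemma brd_linear:
  assumes "x \<in> carr"
  shows "linear_on sc sc carr (\<lambda>y. brd x y)" "linear_on sc sc carr (\<lambda>y. brd y x)"
proof -
  have K: "pair (a + b) z = pair a z + pair b z" "pair (sc c a) z = c * pair a z"
    if "a \<in> carr" "b \<in> carr" "z \<in> carr" for a b c z
    using pair_linear_left[of z] that by (simp_all add: linear_on_def)
  show "linear_on sc sc carr (\<lambda>y. brd x y)"
    unfolding linear_on_def
  proof (intro conjI ballI allI)
    fix y z assume yz: "y \<in> carr" "z \<in> carr"
    show "brd x (y + z) = brd x y + brd x z"
      using yz assms triple_form_lin2(1)[OF assms]
      by (intro brd_eqI) (simp_all add: carr_add brd_closed K pair_brd linear_on_def)
  next
    fix c y assume "y \<in> carr"
    then show "brd x (sc c y) = sc c (brd x y)"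
      using assms triple_form_lin2(1)[OF assms]
      by (intro brd_eqI) (simp_all add: carr_scale brd_closed K[of _ 0] K(2) pair_brd linear_on_def)
  qed
  show "linear_on sc sc carr (\<lambda>y. brd y x)"
    unfolding linear_on_def
  proof (intro conjI ballI allI)
    fix y z assume yz: "y \<in> carr" "z \<in> carr"
    show "brd (y + z) x = brd y x + brd z x"
      using yz assms triple_form_lin2(2)[OF assms]
      by (intro brd_eqI) (simp_all add: carr_add brd_closed K pair_brd linear_on_def)
  next
    fix c y assume "y \<in> carr"
    then show "brd (sc c y) x = sc c (brd y x)"
      using assms triple_form_lin2(2)[OF assms]
      by (intro brd_eqI) (simp_all add: carr_scale brd_closed K(2) pair_brd linear_on_def)
  qed
qed

lemmas eval = pair_def triple_form_def carr_def clos zero_lin \<kappa>_lin \<delta>_zero H.dual_0 H.dual_minus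

lemma brd_AA: "X \<in> \<HH> \<Longrightarrow> Y \<in> \<HH> \<Longrightarrow> brd (X, 0, 0) (Y, 0, 0) = (bH X Y, 0, 0)"
  and brd_BA: "v \<in> \<GG> \<Longrightarrow> X \<in> \<HH> \<Longrightarrow> brd (0, v, 0) (X, 0, 0) = (\<rho> v X, 0, 0)"
  and brd_AB: "v \<in> \<GG> \<Longrightarrow> X \<in> \<HH> \<Longrightarrow> brd (X, 0, 0) (0, v, 0) = (- \<rho> v X, 0, 0)"
  and brd_BB: "u \<in> \<GG> \<Longrightarrow> v \<in> \<GG> \<Longrightarrow> brd (0, u, 0) (0, v, 0) = (0, bG u v, 0)"
  by (rule brd_eqI; auto simp: eval)+

text \<open>The arguments are reversed for the same reason as in
  \<open>transpose_fn\<close>.\<close>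

lemma brd_CC: "\<alpha> \<in> dual (alg S) \<Longrightarrow> \<beta> \<in> dual (alg S) \<Longrightarrow> brd (0, 0, \<alpha>) (0, 0, \<beta>) = (0, 0, tb \<beta> \<alpha>)"
  by (rule brd_eqI; auto simp: eval tb_closed tb_apply)

lemma brd_CB: "v \<in> \<GG> \<Longrightarrow> \<alpha> \<in> dual (alg S) \<Longrightarrow> brd (0, 0, \<alpha>) (0, v, 0) = (0, 0, pullback (alg S) (\<rho> v) \<alpha>)"
  and brd_BC: "v \<in> \<GG> \<Longrightarrow> \<alpha> \<in> dual (alg S) \<Longrightarrow> brd (0, v, 0) (0, 0, \<alpha>) = (0, 0, - pullback (alg S) (\<rho> v) \<alpha>)"
  by (rule brd_eqI; auto simp: eval pullback_dual; simp add: pullback_def)+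

text \<open>Up to order, this is the only type of bracket of pure elements that need not be pure.
  The \<hh>-component Y is left unnamed because the conclusion of \<open>K_jac_AACC\<close> involves
  only the other two components.\<close>

lemma brd_CA:
  assumes "X \<in> \<HH>" "\<alpha> \<in> dual (alg S)"
  obtains Y u where "Y \<in> \<HH>" "u \<in> \<GG>" "brd (0, 0, \<alpha>) (X, 0, 0) = (Y, u, pullback (alg S) (bH X) \<alpha>)"
    "lower u = fun_scale (-1) (pullback (base S) (\<lambda>v. \<rho> v X) \<alpha>)"
proof -
  have c: "(0, 0, \<alpha>) \<in> carr" "(X, 0, 0) \<in> carr"
    using assms by (simp_all add: carr_def clos)
  obtain Y u \<gamma> where Y: "brd (0, 0, \<alpha>) (X, 0, 0) = (Y, u, \<gamma>)" "Y \<in> \<HH>" "u \<in> \<GG>" "\<gamma> \<in> dual (alg S)"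
    using brd_closed[OF c] by (auto simp: carr_def)
  have "\<gamma> = pullback (alg S) (bH X) \<alpha>"
  proof (rule H.dual_eqI)
    fix Z assume "Z \<in> \<HH>"
    then show "\<gamma> Z = pullback (alg S) (bH X) \<alpha> Z"
      using pair_brd[OF c, of "(Z, 0, 0)"] Y assms by (simp add: eval pullback_def)
  qed (use Y assms pullback_dual in simp_all)
  moreover have "lower u v = fun_scale (-1) (pullback (base S) (\<lambda>v. \<rho> v X) \<alpha>) v" for v
  proof (cases "v \<in> \<GG>")
    case True
    then show ?thesis
      using pair_brd[OF c, of "(0, v, 0)"] Y assms by (simp add: eval pullback_def fun_scale_def)
  next
    case False
    then show ?thesis
      using G.dual_outside[OF lower(1)[OF Y(3)]] by (simp add: pullback_def fun_scale_def)
  qed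
  then have "lower u = fun_scale (-1) (pullback (base S) (\<lambda>v. \<rho> v X) \<alpha>)" by blast
  ultimately show thesis
    using that Y by blast
qed

lemma quad_Qd: "quad Qd"
proof (rule quad.intro)
  show "bij_betw (\<lambda>(x, y, z). x + y + z) (part_a Qd \<times> part_b Qd \<times> part_c Qd) (lcarrier (double Qd))"
    by (auto simp: bij_betw_def inj_on_def carr_def image_iff clos Bex_def)
  show "orth Qd (part_a Qd) = {x + y |x y. x \<in> part_a Qd \<and> y \<in> part_b Qd}"
  proof (intro subset_antisym subsetI)
    fix x assume "x \<in> orth Qd (part_a Qd)"
    then have x: "x \<in> carr" "\<And>Y. Y \<in> \<HH> \<Longrightarrow> pair x (Y, 0, 0) = 0" by (auto simp: orth_def)
    obtain X u \<alpha> where X: "x = (X, u, \<alpha>)" "X \<in> \<HH>" "u \<in> \<GG>" "\<alpha> \<in> dual (alg S)"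
      using x(1) by (auto simp: carr_def)
    have "\<alpha> = 0"
      by (rule H.dual_eqI) (use X x(2) in \<open>auto simp: eval\<close>)
    then have "x = (X, 0, 0) + (0, u, 0)" by (simp add: X)
    then show "x \<in> {x + y |x y. x \<in> part_a Qd \<and> y \<in> part_b Qd}"
      using X by auto
  qed (auto simp: orth_def eval)
  show "orth Qd (part_c Qd) = {x + y |x y. x \<in> part_b Qd \<and> y \<in> part_c Qd}"
  proof (intro subset_antisym subsetI)
    fix x assume "x \<in> orth Qd (part_c Qd)"
    then have x: "x \<in> carr" "\<And>\<beta>. \<beta> \<in> dual (alg S) \<Longrightarrow> pair x (0, 0, \<beta>) = 0" by (auto simp: orth_def)
    obtain X u \<alpha> where X: "x = (X, u, \<alpha>)" "X \<in> \<HH>" "u \<in> \<GG>" "\<alpha> \<in> dual (alg S)"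
      using x(1) by (auto simp: carr_def)
    have "X = 0"
      by (rule H.dual_zero_imp) (use X x(2) in \<open>auto simp: eval\<close>)
    then have "x = (0, u, 0) + (0, 0, \<alpha>)" by (simp add: X)
    then show "x \<in> {x + y |x y. x \<in> part_b Qd \<and> y \<in> part_c Qd}"
      using X by auto
  qed (auto simp: orth_def eval)
  show "lie_subalgebra (double Qd) (part_a Qd)"
    by (auto simp: lie_subalgebra_def P.subspace_def sc_def carr_def clos zero_prod_def brd_AA)
  show "lie_subalgebra (double Qd) (part_b Qd)"
    by (auto simp: lie_subalgebra_def P.subspace_def sc_def carr_def clos zero_prod_def brd_BB)
  show "lie_subalgebra (double Qd) (part_c Qd)"
    by (auto simp: lie_subalgebra_def P.subspace_def sc_def carr_def clos zero_prod_def brd_CC tb_closed)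
  show "\<forall>x\<in>lcarrier (double Qd). \<forall>y\<in>lcarrier (double Qd). \<forall>z\<in>lcarrier (double Qd).
      pairing Qd (lbracket (double Qd) x y) z + pairing Qd y (lbracket (double Qd) x z) = 0"
  proof (simp, intro ballI)
    fix x y z assume c: "x \<in> carr" "y \<in> carr" "z \<in> carr"
    have "pair y (brd x z) = triple_form x z y"
      using c pair_sym[of y "brd x z"] by (simp add: brd_closed pair_brd)
    also have "\<dots> = - triple_form x y z"
      using c triple_form_cyc[of x z y] triple_form_cyc[of z y x] triple_form_swap[of y x z] by simp
    finally show "pair (brd x y) z + pair y (brd x z) = 0"
      using c by (simp add: pair_brd)
  qed
  show "\<forall>x\<in>lcarrier (double Qd). lbracket (double Qd) x x = 0"
  proof (simp, intro ballI)
    fix x assume "x \<in> carr"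
    then show "brd x x = 0"
      using pair_linear_left P.subspace_0[OF subspace_carr]
      by (intro brd_eqI) (auto simp: triple_form_self intro: linear_on_zero[OF P.module_axioms module_mult subspace_carr])
  qed
  show "vector_space (lscale (double Qd))" by (simp add: vector_space_sc)
  show "module.subspace (lscale (double Qd)) (lcarrier (double Qd))" by (simp add: subspace_carr)
  show "finite_dim (double Qd)" by (rule D.finite_dim)
  show "\<forall>x\<in>lcarrier (double Qd). (\<forall>y\<in>lcarrier (double Qd). pairing Qd x y = 0) \<longrightarrow> x = 0"
    using pair_nondeg unfolding Qd_simps by blast
  show "\<forall>x\<in>lcarrier (double Qd). \<forall>y\<in>lcarrier (double Qd). pairing Qd x y = pairing Qd y x"
    using pair_sym unfolding Qd_simps by blast
qed (simp_all add: brd_closed brd_linear pair_linear)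

sublocale N: quad Qd
  by (rule quad_Qd)

lemma Qd_pair_0: "x \<in> carr \<Longrightarrow> pair 0 x = 0"
  using N.K_0_left by simp

section \<open>The Jacobi identity of the double, type by type\<close>

lemma jac_vanishI:
  assumes "\<And>x y z. x \<in> A \<Longrightarrow> y \<in> B \<Longrightarrow> z \<in> C \<Longrightarrow> jac Qd x y z = 0"
  shows "N.jac_vanish A B C R"
  using assms by (auto simp: N.jac_vanish_def Qd_pair_0)

lemma jac_AAA: "N.jac_vanish (part_a Qd) (part_a Qd) (part_a Qd) (part_c Qd)"
  by (rule jac_vanishI) (auto simp: jac_def brd_AA clos bH_jacobi zero_prod_def)

lemma jac_AAB: "N.jac_vanish (part_a Qd) (part_a Qd) (part_b Qd) (part_c Qd)"
proof (rule jac_vanishI)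
  fix x y z assume "x \<in> part_a Qd" "y \<in> part_a Qd" "z \<in> part_b Qd"
  then obtain X Y v where "x = (X, 0, 0)" "y = (Y, 0, 0)" "z = (0, v, 0)" "X \<in> \<HH>" "Y \<in> \<HH>" "v \<in> \<GG>" by auto
  then show "jac Qd x y z = 0"
    using bH_anti[of Y "\<rho> v X"]
    by (simp add: jac_def brd_AA brd_AB brd_BA clos neg_lin \<rho>_bH zero_prod_def)
qed

lemma jac_ABB: "N.jac_vanish (part_a Qd) (part_b Qd) (part_b Qd) (part_c Qd)"
proof (rule jac_vanishI)
  fix x y z assume "x \<in> part_a Qd" "y \<in> part_b Qd" "z \<in> part_b Qd"
  then obtain X u v where "x = (X, 0, 0)" "y = (0, u, 0)" "z = (0, v, 0)" "X \<in> \<HH>" "u \<in> \<GG>" "v \<in> \<GG>" by auto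
  then show "jac Qd x y z = 0"
    by (simp add: jac_def brd_AB brd_BA brd_BB clos neg_lin \<rho>_bG zero_prod_def)
qed

lemma jac_BBB: "N.jac_vanish (part_b Qd) (part_b Qd) (part_b Qd) (part_b Qd)"
  by (rule jac_vanishI) (auto simp: jac_def brd_BB clos bG_jacobi zero_prod_def)

lemma tb_anti:
  assumes "\<alpha> \<in> dual (alg S)" "\<beta> \<in> dual (alg S)"
  shows "tb \<alpha> \<beta> = - tb \<beta> \<alpha>"
proof
  fix X show "tb \<alpha> \<beta> X = (- tb \<beta> \<alpha>) X"
    using \<delta>_anti[OF _ assms, of X] by (cases "X \<in> \<HH>") (simp_all add: tb_apply tb_outside)
qed

lemma jac_CCC: "N.jac_vanish (part_c Qd) (part_c Qd) (part_c Qd) (part_a Qd)"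
proof (rule jac_vanishI)
  fix x y z assume "x \<in> part_c Qd" "y \<in> part_c Qd" "z \<in> part_c Qd"
  then obtain \<alpha> \<beta> \<gamma> where *: "x = (0, 0, \<alpha>)" "y = (0, 0, \<beta>)" "z = (0, 0, \<gamma>)"
    "\<alpha> \<in> dual (alg S)" "\<beta> \<in> dual (alg S)" "\<gamma> \<in> dual (alg S)" by auto
  have "tb (tb \<gamma> \<beta>) \<alpha> + tb (tb \<alpha> \<gamma>) \<beta> + tb (tb \<beta> \<alpha>) \<gamma> = - (tb \<alpha> (tb \<gamma> \<beta>) + tb \<gamma> (tb \<beta> \<alpha>) + tb \<beta> (tb \<alpha> \<gamma>))"
    using * tb_anti[of "tb \<gamma> \<beta>" \<alpha>] tb_anti[of "tb \<alpha> \<gamma>" \<beta>] tb_anti[of "tb \<beta> \<alpha>" \<gamma>]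
    by (simp add: tb_closed)
  then show "jac Qd x y z = 0"
    using * tb_jacobi[of \<alpha> \<gamma> \<beta>] by (simp add: jac_def brd_CC tb_closed zero_prod_def)
qed

lemma jac_CCB: "N.jac_vanish (part_c Qd) (part_c Qd) (part_b Qd) (part_a Qd)"
proof (rule jac_vanishI)
  fix x y z assume "x \<in> part_c Qd" "y \<in> part_c Qd" "z \<in> part_b Qd"
  then obtain \<alpha> \<beta> v where *: "x = (0, 0, \<alpha>)" "y = (0, 0, \<beta>)" "z = (0, v, 0)"
    "\<alpha> \<in> dual (alg S)" "\<beta> \<in> dual (alg S)" "v \<in> \<GG>" by auto
  let ?p = "pullback (alg S) (\<rho> v)"
  \<comment> \<open>The pullback along \<open>\<rho> v\<close> is a derivation of the transposed
    bracket; evaluated at X, this is \<open>\<delta>_invariant\<close>.\<close>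
  have "tb (?p \<beta>) \<alpha> + tb (- ?p \<alpha>) \<beta> + - ?p (tb \<beta> \<alpha>) = 0"
  proof
    fix X show "(tb (?p \<beta>) \<alpha> + tb (- ?p \<alpha>) \<beta> + - ?p (tb \<beta> \<alpha>)) X = 0 X"
    proof (cases "X \<in> \<HH>")
      case True
      have "\<delta> X (- ?p \<alpha>) \<beta> = - \<delta> X (?p \<alpha>) \<beta>"
        using True * \<delta>_lin2(2)[of X "?p \<alpha>" \<beta> "-1"] by (simp add: pullback_dual)
      moreover have "\<delta> X \<beta> (?p \<alpha>) = - \<delta> X (?p \<alpha>) \<beta>"
        using True * by (intro \<delta>_anti) (simp_all add: pullback_dual)
      ultimately show ?thesis
        using True * \<delta>_invariant[of v X \<beta> \<alpha>]
        by (simp add: tb_apply pullback_def[of _ _ "tb \<beta> \<alpha>"] clos)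
    qed (simp add: tb_outside pullback_def)
  qed
  then show "jac Qd x y z = 0"
    using * by (simp add: jac_def brd_CC brd_CB brd_BC tb_closed pullback_dual clos zero_prod_def)
qed

lemma \<tau>_neg_neg:
  assumes "\<alpha> \<in> dual (base S)" "\<beta> \<in> dual (base S)"
  shows "\<tau> (fun_scale (-1) \<alpha>) (fun_scale (-1) \<beta>) = \<tau> \<alpha> \<beta>"
proof -
  interpret FG: vector_space "fun_scale :: 'k \<Rightarrow> ('g \<Rightarrow> 'k) \<Rightarrow> _" by (rule vector_space_fun_scale)
  have "fun_scale (-1) \<beta> \<in> dual (base S)"
    using assms FG.subspace_scale[OF G.subspace_dual] by blast
  then have "\<tau> (fun_scale (-1) \<alpha>) (fun_scale (-1) \<beta>) = (-1) * ((-1) * \<tau> \<alpha> \<beta>)"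
    using \<tau>_bilinear assms unfolding G.bilinear_tensor_def linear_on_def
    by (simp del: FG.scale_minus_left)
  then show ?thesis by simp
qed

text \<open>\<open>K_jac_AACC\<close> is available in the double because it does not presuppose the
  Jacobi identity. By \<open>brd_CA\<close> the C-components are the pullbacks along the adjoint
  maps and the \<gg>-components lower to pullbacks along the action, so the Jacobiator becomes the
  defect in \<open>compat_apply\<close>.\<close>

lemma jac_AAC: "N.jac_vanish (part_a Qd) (part_a Qd) (part_c Qd) (part_c Qd)"
  unfolding N.jac_vanish_def
proof (intro ballI)
  fix x y p r assume "x \<in> part_a Qd \<inter> lcarrier (double Qd)" "y \<in> part_a Qd \<inter> lcarrier (double Qd)"
    "p \<in> part_c Qd \<inter> lcarrier (double Qd)" "r \<in> part_c Qd \<inter> lcarrier (double Qd)"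
  then obtain X Y \<alpha> \<beta> where *: "x = (X, 0, 0)" "y = (Y, 0, 0)" "p = (0, 0, \<alpha>)" "r = (0, 0, \<beta>)"
    and XY: "X \<in> \<HH>" "Y \<in> \<HH>" and ab: "\<alpha> \<in> dual (alg S)" "\<beta> \<in> dual (alg S)" by auto
  let ?f = "\<lambda>X. pullback (alg S) (bH X)" and ?g = "\<lambda>X. pullback (base S) (\<lambda>v. \<rho> v X)"
  obtain a1 u1 where 1: "a1 \<in> \<HH>" "u1 \<in> \<GG>" "brd p x = (a1, u1, ?f X \<alpha>)" "lower u1 = fun_scale (-1) (?g X \<alpha>)"
    using brd_CA[OF XY(1) ab(1)] * by metis
  obtain a2 u2 where 2: "a2 \<in> \<HH>" "u2 \<in> \<GG>" "brd p y = (a2, u2, ?f Y \<alpha>)" "lower u2 = fun_scale (-1) (?g Y \<alpha>)"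
    using brd_CA[OF XY(2) ab(1)] * by metis
  obtain a3 u3 where 3: "a3 \<in> \<HH>" "u3 \<in> \<GG>" "brd r x = (a3, u3, ?f X \<beta>)" "lower u3 = fun_scale (-1) (?g X \<beta>)"
    using brd_CA[OF XY(1) ab(2)] * by metis
  obtain a4 u4 where 4: "a4 \<in> \<HH>" "u4 \<in> \<GG>" "brd r y = (a4, u4, ?f Y \<beta>)" "lower u4 = fun_scale (-1) (?g Y \<beta>)"
    using brd_CA[OF XY(2) ab(2)] * by metis
  have f: "?f Z \<gamma> \<in> dual (alg S)" if "Z \<in> \<HH>" "\<gamma> \<in> dual (alg S)" for Z \<gamma>
    using that by (rule pullback_dual(1)[rotated])
  have "- pair (jac Qd x y p) r =
      pair y (brd r (0, 0, ?f X \<alpha>)) + pair y (brd (0, 0, ?f X \<beta>) p)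
      - pair x (brd r (0, 0, ?f Y \<alpha>)) - pair x (brd (0, 0, ?f Y \<beta>) p) - pair (brd x y) (brd r p)
      - (pair (0, u1, 0) (0, u4, 0) - pair (0, u2, 0) (0, u3, 0))"
    using N.K_jac_AACC[of x y p r "(a1, 0, 0)" "(0, u1, 0)" "(0, 0, ?f X \<alpha>)"
        "(a2, 0, 0)" "(0, u2, 0)" "(0, 0, ?f Y \<alpha>)" "(a3, 0, 0)" "(0, u3, 0)" "(0, 0, ?f X \<beta>)"
        "(a4, 0, 0)" "(0, u4, 0)" "(0, 0, ?f Y \<beta>)"]
      1(1-3) 2(1-3) 3(1-3) 4(1-3) XY ab f * by simp
  also have "\<dots> = \<delta> Y (?f X \<alpha>) \<beta> + \<delta> Y \<alpha> (?f X \<beta>) - \<delta> X (?f Y \<alpha>) \<beta> - \<delta> X \<alpha> (?f Y \<beta>) - \<delta> (bH X Y) \<alpha> \<beta>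
      - (\<kappa> u1 u4 - \<kappa> u2 u3)"
    using XY ab f * 1 2 3 4
    by (simp add: brd_CC brd_AA pair_def tb_apply \<kappa>_lin clos)
  \<comment> \<open>The two minus signs of the lowered \<gg>-components cancel.\<close>
  also have "\<kappa> u1 u4 = \<tau> (?g X \<alpha>) (?g Y \<beta>)"
    using \<tau>_lower[OF 1(2) 4(2)] 1(4) 4(4) \<tau>_neg_neg pullback_dual(3) XY ab by simp
  also have "\<kappa> u2 u3 = \<tau> (?g X \<beta>) (?g Y \<alpha>)"
    using \<tau>_lower[OF 2(2) 3(2)] 2(4) 3(4) \<tau>_neg_neg pullback_dual(3) XY ab \<tau>_sym[of "?g X \<beta>" "?g Y \<alpha>"] by simp
  finally show "pairing Qd (jac Qd x y p) r = 0"
    using compat_apply[OF XY ab] by simp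
qed

theorem manin_quadruple_double: "manin_quadruple Qd"
proof -
  have "jac Qd x y z = 0" if "x \<in> carr" "y \<in> carr" "z \<in> carr" for x y z
  proof (rule N.jacobi_from_types[OF jac_AAA jac_AAB jac_ABB _ _ jac_BBB jac_AAC])
    show "N.jac_vanish (part_a Qd) (part_b Qd) (part_c Qd) (part_c Qd)"
      using jac_CCB N.jac_vanish_swap34 N.jac_vanish_swap23 N.jac_vanish_swap12 by metis
    show "N.jac_vanish (part_a Qd) (part_c Qd) (part_c Qd) (part_c Qd)"
      using jac_CCC N.jac_vanish_swap34 N.jac_vanish_swap23 N.jac_vanish_swap12 by metis
  qed (use that in simp_all)
  then show ?thesis
    using quad_Qd by (simp add: manin_quadruple_iff)
qed

theorem double_iso:
  "(restrict (\<lambda>(X, u, \<alpha>). u) (part_b Qd), restrict fst (part_a Qd)) \<in> qbialg_isos (induced_qbialg Qd) S"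
proof -
  define \<phi> where "\<phi> = restrict (\<lambda>(X, u, \<alpha>). u) (part_b Qd)"
  define \<psi> where "\<psi> = restrict fst (part_a Qd)"
  have \<phi>: "\<phi> (0, u, 0) = u" if "u \<in> \<GG>" for u using that by (simp add: \<phi>_def)
  have \<psi>: "\<psi> (X, 0, 0) = X" if "X \<in> \<HH>" for X using that by (simp add: \<psi>_def)
  have pb: "pullback (base_of Qd) \<phi> (lower u) = N.fb (0, u, 0)" if "u \<in> \<GG>" for u
  proof
    fix x show "pullback (base_of Qd) \<phi> (lower u) x = N.fb (0, u, 0) x"
      by (cases "x \<in> part_b Qd") (auto simp: pullback_def flat_def \<phi> pair_def)
  qed
  have pa: "pullback (alg_of Qd) \<psi> \<alpha> = N.fn (0, 0, \<alpha>)" if "\<alpha> \<in> dual (alg S)" for \<alpha>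
  proof
    fix x show "pullback (alg_of Qd) \<psi> \<alpha> x = N.fn (0, 0, \<alpha>) x"
      by (cases "x \<in> part_a Qd") (auto simp: pullback_def functional_of_def flat_def \<psi> pair_def \<kappa>_lin clos)
  qed
  have 1: "lie_iso (base_of Qd) (base S) \<phi>"
    unfolding lie_iso_def linear_on_def bij_betw_def inj_on_def
    by (auto simp: \<phi> sc_def clos brd_BB image_iff) (auto simp: \<phi>_def)
  have 2: "lie_iso (alg_of Qd) (alg S) \<psi>"
    unfolding lie_iso_def linear_on_def bij_betw_def inj_on_def
    by (auto simp: \<psi> sc_def clos brd_AA image_iff) (auto simp: \<psi>_def)
  have 3: "tensor_map (base_of Qd) (base S) \<phi> \<phi> N.t = \<tau>"
  proof (intro ext)
    fix \<alpha> \<beta> show "tensor_map (base_of Qd) (base S) \<phi> \<phi> N.t \<alpha> \<beta> = \<tau> \<alpha> \<beta>"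
    proof (cases "\<alpha> \<in> dual (base S) \<and> \<beta> \<in> dual (base S)")
      case True
      then obtain u v where uv: "u \<in> \<GG>" "\<alpha> = lower u" "v \<in> \<GG>" "\<beta> = lower v"
        using lower_surj by metis
      then have "N.t (N.fb (0, u, 0)) (N.fb (0, v, 0)) = \<kappa> u v"
        using N.form_fb(1)[of "(0, v, 0)" "N.fb (0, u, 0)"] N.fb_dual[of "(0, u, 0)"]
        by (simp add: flat_def) (simp add: pair_def)
      then show ?thesis
        using uv by (simp add: tensor_map_def lower pb)
    next
      case False
      then show ?thesis using \<tau>_outside by (auto simp: tensor_map_def)
    qed
  qed
  have 4: "\<psi> (lbracket (double Qd) v X) = \<rho> (\<phi> v) (\<psi> X)" if "v \<in> part_b Qd" "X \<in> part_a Qd" for v X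
    using that by (auto simp: \<phi> \<psi> brd_BA clos)
  have 5: "\<delta> (\<psi> X) = tensor_map (alg_of Qd) (alg S) \<psi> \<psi> (N.\<delta> X)" if X: "X \<in> part_a Qd" for X
  proof (intro ext)
    fix \<alpha> \<beta> show "\<delta> (\<psi> X) \<alpha> \<beta> = tensor_map (alg_of Qd) (alg S) \<psi> \<psi> (N.\<delta> X) \<alpha> \<beta>"
    proof (cases "\<alpha> \<in> dual (alg S) \<and> \<beta> \<in> dual (alg S)")
      case True
      then have "N.\<delta> X (N.fn (0, 0, \<alpha>)) (N.fn (0, 0, \<beta>)) = pair X (brd (0, 0, \<beta>) (0, 0, \<alpha>))"
        using N.cobr_fn[of "(0, 0, \<alpha>)" "(0, 0, \<beta>)" X] by simp
      then show ?thesis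
        using True X by (auto simp: tensor_map_def pa brd_CC pair_def \<psi> tb_apply \<kappa>_lin clos)
    next
      case False
      then show ?thesis using X \<delta>_outside by (auto simp: tensor_map_def \<psi>)
    qed
  qed
  show ?thesis
    unfolding \<phi>_def[symmetric] \<psi>_def[symmetric] qbialg_isos_def mem_Collect_eq prod.case
      induced_qbialg_simps alg_of_simps base_of_simps
    by (intro conjI ballI 1 2 3 4 5; assumption)
qed

end

theorem theorem4p1:
  "(\<forall>Q :: ('k::field, 'd::ab_group_add) quadruple. manin_quadruple Q \<longrightarrow>
      lie_quasi_bialgebra (induced_qbialg Q) \<and>
      (\<forall>v\<in>part_b Q. \<forall>X\<in>part_a Q. act (induced_qbialg Q) v X = lbracket (double Q) v X) \<and>
      (\<forall>X\<in>part_a Q. \<forall>A\<in>part_c Q. \<forall>B\<in>part_c Q.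
         cobr (induced_qbialg Q) X (functional_of Q A) (functional_of Q B)
           = pairing Q X (lbracket (double Q) B A))) \<and>
   (\<forall>(Q :: ('k, 'd) quadruple) (Q' :: ('k, 'e::ab_group_add) quadruple).
      manin_quadruple Q \<longrightarrow> manin_quadruple Q' \<longrightarrow>
      bij_betw (induced_iso Q) (quadruple_isos Q Q')
        (qbialg_isos (induced_qbialg Q) (induced_qbialg Q'))) \<and>
   (\<forall>S :: ('k, 'g::ab_group_add, 'h::ab_group_add) qbialg. lie_quasi_bialgebra S \<longrightarrow>
      (\<exists>Q :: ('k, 'h \<times> 'g \<times> ('h \<Rightarrow> 'k)) quadruple.
         manin_quadruple Q \<and> qbialg_isos (induced_qbialg Q) S \<noteq> {}))"
proof (intro conjI allI impI ballI)
  fix Q :: "('k, 'd) quadruple" assume Q: "manin_quadruple Q"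
  then interpret quad Q by (simp add: manin_quadruple_iff)
  show "lie_quasi_bialgebra (induced_qbialg Q)"
    using Q by (intro induced_quasi_bialgebra) (simp add: manin_quadruple_iff)
  show "act (induced_qbialg Q) v X = br v X" for v X
    by simp
  show "cobr (induced_qbialg Q) X (fn P) (fn R) = K X (br R P)" if "P \<in> C" "R \<in> C" for X P R
    using that by (simp add: cobr_fn)
next
  fix Q :: "('k, 'd) quadruple" and Q' :: "('k, 'e) quadruple"
  assume "manin_quadruple Q" "manin_quadruple Q'"
  then interpret quad_pair Q Q'
    by (simp add: quad_pair_def manin_quadruple_iff)
  show "bij_betw (induced_iso Q) (quadruple_isos Q Q') (qbialg_isos (induced_qbialg Q) (induced_qbialg Q'))"
    by (rule bij_induced_iso)
next
  fix S :: "('k, 'g, 'h) qbialg" assume "lie_quasi_bialgebra S"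
  then interpret quasi_bialgebra S by unfold_locales
  show "\<exists>Q :: ('k, 'h \<times> 'g \<times> ('h \<Rightarrow> 'k)) quadruple. manin_quadruple Q \<and> qbialg_isos (induced_qbialg Q) S \<noteq> {}"
    using manin_quadruple_double double_iso by blast
qed

end
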